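(* With the notation of the context, assume that: (1) the symmetric matrix $A_0=(a_{ij}(t,x))_{i,j=1,\dots,p_0}$ satisfies $\mu M|\xi|^2<\sum_{i,j=1}^{p_0}a_{ij}(t,x)\xi_i\xi_j<M|\xi|^2$ for all $(t,x)\in\mathbb{R}\times\mathbb{R}^d$, $\xi\in\mathbb{R}^{p_0}\setminus\{0\}$, for some positive constants $M,\mu$; (2) $B$ is a constant $d\times d$ matrix of the block form described in the context; (3) $a_{ij},a_i\in C^{N,1}_B$ with $\|a_{ij}\|_{C^{N,1}_B},\|a_i\|_{C^{N,1}_B}\le M$. Then for any $n\in\mathbb{N}$ with $n\le N$ and any $\bar z\in\mathbb{R}\times\mathbb{R}^d$, $$u^{(\bar z)}_n(t,x)=\mathcal{L}^{(\bar z)}_n(t,T,x)\,u^{(\bar z)}_0(t,x),\qquad (t,x)\in[0,T[\times\mathbb{R}^d,$$ where $\mathcal{L}^{(\bar z)}_n(t,T,x)$ is the differential operator $$\mathcal{L}^{(\bar z)}_n(t,T,x)=\sum_{h=1}^n\int_t^Tds_1\int_{s_1}^Tds_2\cdots\int_{s_{h-1}}^Tds_h\sum_{i\in I_{n,h}}\mathcal{G}^{(\bar z)}_{i_1}(t,s_1,x)\cdots\mathcal{G}^{(\bar z)}_{i_h}(t,s_h,x),$$ with $I_{n,h}=\{i=(i_1,\dots,i_h)\in\mathbb{N}^h\mid i_1+\dots+i_h=n\}$ for $1\le h\le n$, and $$\mathcal{G}^{(\bar z)}_n(t,s,x)=\frac12\sum_{i,j=1}^{p_0}\big(\mathbf{T}_n(a_{ij},\bar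 z)-\mathbf{T}_{n-1}(a_{ij},\bar z)\big)\big(s,\mathcal{M}^{(\bar z)}(s-t,x)\big)\big(e^{-(s-t)B^*}\nabla_x\big)_i\big(e^{-(s-t)B^*}\nabla_x\big)_j$$ $$\qquad+\sum_{i=1}^{p_0}\big(\mathbf{T}_{n-1}(a_i,\bar z)-\mathbf{T}_{n-2}(a_i,\bar z)\big)\big(s,\mathcal{M}^{(\bar z)}(s-t,x)\big)\big(e^{-(s-t)B^*}\nabla_x\big)_i,$$ where $$\mathcal{M}^{(\bar z)}(t,x)=e^{tB}\big(x+\mathbf{M}_{\bar z}(t)\nabla_x\big),\qquad \mathbf{M}_{\bar z}(t)=e^{-tB}\mathbf{C}_{\bar z}(t)e^{-tB^*}.$$
   Context: $N\in\mathbb{N}_0$ and $T>0$ are fixed; $\mathbb{N}=\{1,2,\dots\}$, $\mathbb{N}_0=\mathbb{N}\cup\{0\}$; $p_0\le d$; $a_{ij},a_i$ ($i,j\le p_0$) are functions on $\mathbb{R}\times\mathbb{R}^d$. The final datum $\varphi$ is a continuous function on $\mathbb{R}^d$ with sub-exponential growth. **Block structure of $B$.** $B$ has constant entries and $$B=\begin{pmatrix}0&0&\cdots&0&0\\ B_1&0&\cdots&0&0\\ 0&B_2&\cdots&0&0\\ \vdots&\vdots&\ddots&\vdots&\vdots\\ 0&0&\cdots&B_r&0\end{pmatrix},$$ where each $B_j$ is a $(p_j\times p_{j-1})$-matrix of rank $p_j$, $p_0\ge p_1\ge\cdots\ge p_r\ge1$ and $\sum_{j=0}^rp_j=d$. $B^*$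 is the transpose of $B$. **Intrinsic notions.** $Y=\langle Bx,\nabla_x\rangle+\partial_t$. $\sigma_j=1$ for the first $p_0$ indices, $\sigma_j=3$ for the next $p_1$, ..., $\sigma_j=2r+1$ for the last $p_r$; $|\beta|_B=\sum_j\sigma_j\beta_j$ for $\beta\in\mathbb{N}_0^d$. For a Lipschitz vector field $Z$, $\delta\mapsto e^{\delta Z}(z)$ is its integral curve from $z$: $e^{\delta\partial_{x_i}}(t,x)=(t,x+\delta\mathbf{e}_i)$, $e^{\delta Y}(t,x)=(t+\delta,e^{\delta B}x)$. $Yf(z)=\frac{d}{d\delta}f(e^{\delta Y}(z))|_{\delta=0}$. Formal degrees: $m_{\partial_{x_i}}=1$ ($i\le p_0$), $m_Y=2$. For $\alpha\in]0,m_Z]$, $f\in C^\alpha_Z$ if $\|f\|_{C^\alpha_Z}=\sup|f|+\sup_{\delta\neq0,z}|f(e^{\delta Z}(z))-f(z)|\,|\delta|^{-\alpha/m_Z}<\infty$ (suprema over $z\in\mathbb{R}\times\mathbb{R}^d$). For $\alpha\in]0,1]$: $f\in C^{0,\alpha}_B$ if $f\in C^\alpha_Y$ and $f\in C^\alpha_{\partial_{x_i}}$ for $i\le p_0$; $f\in C^{1,\alpha}_B$ if $f\in C^{1+\alpha}_Y$ and $\partial_{x_i}f\in C^{0,\alpha}_B$ for $i\le p_0$; for $n\ge2$, $f\in C^{n,\alpha}_B$ if $Yf\in C^{n-2,\alpha}_B$ and $\partial_{x_i}f\in C^{n-1,\alpha}_B$ for $i\le p_0$. Norms: $\|f\|_{C^{0,\alpha}_B}=\|f\|_{C^\alpha_Y}+\sum_{i\le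 p_0}\|f\|_{C^\alpha_{\partial_{x_i}}}$, $\|f\|_{C^{1,\alpha}_B}=\|f\|_{C^{1+\alpha}_Y}+\sum_{i\le p_0}\|\partial_{x_i}f\|_{C^{0,\alpha}_B}$, $\|f\|_{C^{n,\alpha}_B}=\|Yf\|_{C^{n-2,\alpha}_B}+\sum_{i\le p_0}\|\partial_{x_i}f\|_{C^{n-1,\alpha}_B}$. **Intrinsic Taylor polynomials.** For $f\in C^{n,\alpha}_B$, $\zeta=(s,\xi)$, $z=(t,x)$, $$\mathbf{T}_n(f,\zeta)(z)=\sum_{2k+|\beta|_B\le n}\frac{1}{k!\,\beta!}\big(Y^k\partial_\xi^\beta f(s,\xi)\big)(t-s)^k\big(x-e^{(t-s)B}\xi\big)^\beta$$ (for $f\in C^{n,\alpha}_B$ the derivatives appearing exist), and $\mathbf{T}_{-1}(f,\zeta)\equiv0$. For fixed $t$ this is a polynomial in $x$. **The functions $u_n^{(\bar z)}$.** For $0\le n\le N$, $$\mathcal{K}^{(\bar z)}_n=\frac12\sum_{i,j=1}^{p_0}\mathbf{T}_n(a_{ij},\bar z)(z)\partial_{x_ix_j}+\sum_{i=1}^{p_0}\mathbf{T}_{n-1}(a_i,\bar z)(z)\partial_{x_i}+Y.$$ Let $A(\bar z)$ be the $d\times d$ matrix with upper-left block $A_0(\bar z)$ and zeros elsewhere, $\mathbf{C}_{\bar z}(t)=\int_0^te^{sB}A(\bar z)e^{sB^*}ds$, and, for $t<s$, $$\Gamma^{(\bar z)}_0(t,x;s,y)=\frac{1}{\sqrt{(2\pi)^d|\mathbf{C}_{\bar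 z}(s-t)|}}\exp\Big(-\tfrac12\big\langle\mathbf{C}^{-1}_{\bar z}(s-t)(y-e^{(s-t)B}x),\,y-e^{(s-t)B}x\big\rangle\Big)$$ the fundamental solution of $\mathcal{K}_0^{(\bar z)}$ ($|\cdot|$ of a matrix is its determinant). The $u_n^{(\bar z)}$ are the unique non-rapidly increasing solutions of $$\mathcal{K}^{(\bar z)}_0u^{(\bar z)}_0=0\ \text{on }[0,T[\times\mathbb{R}^d,\quad u^{(\bar z)}_0(T,\cdot)=\varphi,$$ and, for $1\le n\le N$, $$\mathcal{K}^{(\bar z)}_0u^{(\bar z)}_n=-\sum_{h=1}^n\big(\mathcal{K}^{(\bar z)}_h-\mathcal{K}^{(\bar z)}_{h-1}\big)u^{(\bar z)}_{n-h}\ \text{on }[0,T[\times\mathbb{R}^d,\quad u^{(\bar z)}_n(T,\cdot)=0;$$ that is, $u_0^{(\bar z)}(t,x)=\int\Gamma_0^{(\bar z)}(t,x;T,y)\varphi(y)\,dy$ and $u_n^{(\bar z)}(t,x)=\sum_{h=1}^n\int_t^T\int_{\mathbb{R}^d}\Gamma_0^{(\bar z)}(t,x;s,\xi)\big((\mathcal{K}^{(\bar z)}_h-\mathcal{K}^{(\bar z)}_{h-1})u^{(\bar z)}_{n-h}\big)(s,\xi)\,d\xi\,ds$ for $t<T$. **Polynomials of $\mathcal{M}$.** $\mathcal{M}^{(\bar z)}(t,x)$ is a vector of $d$ first-order differential operators acting on $x$. For a polynomial $p(s,y)=\sum_\beta c_\beta(s)y^\beta$ in $y$, $p(s,\mathcal{M})=\sum_\beta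 c_\beta(s)\mathcal{M}_1^{\beta_1}\cdots\mathcal{M}_d^{\beta_d}$; this is unambiguous because the components of $\mathcal{M}^{(\bar z)}(s-t,x)$ commute when applied to $\Gamma_0^{(\bar z)}(t,x;s,y)$, to its derivatives, and to solutions $u_0^{(\bar z)}$ of the Cauchy problem above. *)

theory Defs
  imports "HOL-Analysis.Analysis"
begin

(* Space-time points are pairs z = (t, x) of type 'd point. The index type 'd is finite and
   linearly ordered, so that "the first p 0 coordinates" makes sense; d is CARD('d). *)

type_synonym 'd rvec = "(real, 'd) vec"
type_synonym 'd rmat = "((real, 'd) vec, 'd) vec"
type_synonym 'd point = "real \<times> (real, 'd) vec"

section \<open>Matrix exponential\<close>

definition matpow :: "'d::finite rmat \<Rightarrow> nat \<Rightarrow> 'd rmat" where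
  "matpow A k = (((**) A) ^^ k) (mat 1)"

definition matexp :: "'d::finite rmat \<Rightarrow> 'd rmat" where
  "matexp A = (\<Sum>k. (1 / fact k) *\<^sub>R matpow A k)"

section \<open>Blocks\<close>

(* The sequence p gives the block sizes p 0, ..., p r; block p i is the number (0, ..., r) of
   the block that contains the coordinate i. *)

definition position :: "'d::{finite,linorder} \<Rightarrow> nat" where
  "position i = card {j. j < i}"

definition block :: "(nat \<Rightarrow> nat) \<Rightarrow> 'd::{finite,linorder} \<Rightarrow> nat" where
  "block p i = (LEAST k. position i < (\<Sum>j\<le>k. p j))"

definition first_block :: "(nat \<Rightarrow> nat) \<Rightarrow> 'd::{finite,linorder} set" where
  "first_block p = {i. block p i = 0}"

(* The block B_j (rows in block j, columns in block j - 1), padded with zeros to a d \<times> d matrix;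
   the padding does not change the rank. *)
definition subdiag_block :: "(nat \<Rightarrow> nat) \<Rightarrow> 'd::{finite,linorder} rmat \<Rightarrow> nat \<Rightarrow> 'd rmat" where
  "subdiag_block p B j =
     (\<chi> i k. if block p i = j \<and> Suc (block p k) = j then B $ i $ k else 0)"

definition block_form :: "nat \<Rightarrow> (nat \<Rightarrow> nat) \<Rightarrow> 'd::{finite,linorder} rmat \<Rightarrow> bool" where
  "block_form r p B \<longleftrightarrow>
     (\<forall>j<r. p (Suc j) \<le> p j) \<and> 1 \<le> p r \<and> (\<Sum>j\<le>r. p j) = CARD('d) \<and>
     (\<forall>i k. block p i \<noteq> Suc (block p k) \<longrightarrow> B $ i $ k = 0) \<and>
     (\<forall>j\<in>{1..r}. rank (subdiag_block p B j) = p j)"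

definition sigma :: "(nat \<Rightarrow> nat) \<Rightarrow> 'd::{finite,linorder} \<Rightarrow> nat" where
  "sigma p i = 2 * block p i + 1"

definition B_degree :: "(nat \<Rightarrow> nat) \<Rightarrow> ('d::{finite,linorder} \<Rightarrow> nat) \<Rightarrow> nat" where
  "B_degree p \<beta> = (\<Sum>i\<in>UNIV. sigma p i * \<beta> i)"

section \<open>Vector fields and derivatives\<close>

definition flow_dx :: "'d::finite \<Rightarrow> real \<Rightarrow> 'd point \<Rightarrow> 'd point" where
  "flow_dx i \<delta> z = (fst z, snd z + \<delta> *\<^sub>R axis i 1)"

definition flow_Y :: "'d::finite rmat \<Rightarrow> real \<Rightarrow> 'd point \<Rightarrow> 'd point" where
  "flow_Y B \<delta> z = (fst z + \<delta>, matexp (\<delta> *\<^sub>R B) *v snd z)"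

definition has_lie :: "(real \<Rightarrow> 'd::finite point \<Rightarrow> 'd point) \<Rightarrow> ('d point \<Rightarrow> real) \<Rightarrow> bool" where
  "has_lie \<Phi> f \<longleftrightarrow> (\<forall>z. (\<lambda>\<delta>. f (\<Phi> \<delta> z)) differentiable (at 0))"

definition lie :: "(real \<Rightarrow> 'd::finite point \<Rightarrow> 'd point) \<Rightarrow> ('d point \<Rightarrow> real) \<Rightarrow> 'd point \<Rightarrow> real" where
  "lie \<Phi> f z = deriv (\<lambda>\<delta>. f (\<Phi> \<delta> z)) 0"

abbreviation dx :: "'d::finite \<Rightarrow> ('d point \<Rightarrow> real) \<Rightarrow> 'd point \<Rightarrow> real" where
  "dx i \<equiv> lie (flow_dx i)"

abbreviation dY :: "'d::finite rmat \<Rightarrow> ('d point \<Rightarrow> real) \<Rightarrow> 'd point \<Rightarrow> real" where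
  "dY B \<equiv> lie (flow_Y B)"

(* For operators D i, the composition (D i1 ^^ \<beta> i1) o ... o (D id ^^ \<beta> id), where i1 < ... < id
   are all the indices. *)
definition op_power :: "('d::{finite,linorder} \<Rightarrow> 'f \<Rightarrow> 'f) \<Rightarrow> ('d \<Rightarrow> nat) \<Rightarrow> 'f \<Rightarrow> 'f" where
  "op_power D \<beta> = foldr (\<lambda>i. D i ^^ \<beta> i) (sorted_list_of_set UNIV)"

section \<open>Intrinsic Hoelder spaces\<close>

definition holder_norm ::
  "(real \<Rightarrow> 'd::finite point \<Rightarrow> 'd point) \<Rightarrow> real \<Rightarrow> real \<Rightarrow> ('d point \<Rightarrow> real) \<Rightarrow> ennreal" where
  "holder_norm \<Phi> m \<alpha> f =
     (SUP z. ennreal \<bar>f z\<bar>) +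
     (SUP \<delta>\<in>{\<delta>. \<delta> \<noteq> 0}. SUP z. ennreal (\<bar>f (\<Phi> \<delta> z) - f z\<bar> * \<bar>\<delta>\<bar> powr (- \<alpha> / m)))"

abbreviation norm_dx :: "'d::finite \<Rightarrow> real \<Rightarrow> ('d point \<Rightarrow> real) \<Rightarrow> ennreal" where
  "norm_dx i \<equiv> holder_norm (flow_dx i) 1"

abbreviation norm_Y :: "'d::finite rmat \<Rightarrow> real \<Rightarrow> ('d point \<Rightarrow> real) \<Rightarrow> ennreal" where
  "norm_Y B \<equiv> holder_norm (flow_Y B) 2"

fun in_CB :: "(nat \<Rightarrow> nat) \<Rightarrow> 'd::{finite,linorder} rmat \<Rightarrow> nat \<Rightarrow> real \<Rightarrow> ('d point \<Rightarrow> real) \<Rightarrow> bool" where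
  "in_CB p B 0 \<alpha> f \<longleftrightarrow>
     norm_Y B \<alpha> f < \<infinity> \<and> (\<forall>i\<in>first_block p. norm_dx i \<alpha> f < \<infinity>)"
| "in_CB p B (Suc 0) \<alpha> f \<longleftrightarrow>
     norm_Y B (1 + \<alpha>) f < \<infinity> \<and>
     (\<forall>i\<in>first_block p. has_lie (flow_dx i) f \<and> in_CB p B 0 \<alpha> (dx i f))"
| "in_CB p B (Suc (Suc n)) \<alpha> f \<longleftrightarrow>
     has_lie (flow_Y B) f \<and> in_CB p B n \<alpha> (dY B f) \<and>
     (\<forall>i\<in>first_block p. has_lie (flow_dx i) f \<and> in_CB p B (Suc n) \<alpha> (dx i f))"

fun CB_norm :: "(nat \<Rightarrow> nat) \<Rightarrow> 'd::{finite,linorder} rmat \<Rightarrow> nat \<Rightarrow> real \<Rightarrow> ('d point \<Rightarrow> real) \<Rightarrow> ennreal" where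
  "CB_norm p B 0 \<alpha> f = norm_Y B \<alpha> f + (\<Sum>i\<in>first_block p. norm_dx i \<alpha> f)"
| "CB_norm p B (Suc 0) \<alpha> f =
     norm_Y B (1 + \<alpha>) f + (\<Sum>i\<in>first_block p. CB_norm p B 0 \<alpha> (dx i f))"
| "CB_norm p B (Suc (Suc n)) \<alpha> f =
     CB_norm p B n \<alpha> (dY B f) + (\<Sum>i\<in>first_block p. CB_norm p B (Suc n) \<alpha> (dx i f))"

section \<open>Intrinsic Taylor polynomials\<close>

(* The order n is an integer so that n = -1 is allowed: for n < 0 the index set is empty and the polynomial is 0. *)
definition taylor ::
  "(nat \<Rightarrow> nat) \<Rightarrow> 'd::{finite,linorder} rmat \<Rightarrow> int \<Rightarrow> ('d point \<Rightarrow> real) \<Rightarrow> 'd point \<Rightarrow> 'd point \<Rightarrow> real" where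
  "taylor p B n f \<zeta> z =
     (\<Sum>(k, \<beta>) \<in> {(k, \<beta>). int (2 * k + B_degree p \<beta>) \<le> n}.
        1 / (fact k * (\<Prod>i\<in>UNIV. fact (\<beta> i))) *
        (dY B ^^ k) (op_power dx \<beta> f) \<zeta> *
        (fst z - fst \<zeta>) ^ k *
        (\<Prod>i\<in>UNIV. ((snd z - matexp ((fst z - fst \<zeta>) *\<^sub>R B) *v snd \<zeta>) $ i) ^ \<beta> i))"

section \<open>The expansion of the solution\<close>

(* The symmetric matrix A_0 = (a i j) and the drift (a_i), written b i, are only used for indices
   in first_block p. *)

definition K_op ::
  "(nat \<Rightarrow> nat) \<Rightarrow> 'd::{finite,linorder} rmat \<Rightarrow> ('d \<Rightarrow> 'd \<Rightarrow> 'd point \<Rightarrow> real) \<Rightarrow> ('d \<Rightarrow> 'd point \<Rightarrow> real) \<Rightarrow>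
   'd point \<Rightarrow> nat \<Rightarrow> ('d point \<Rightarrow> real) \<Rightarrow> 'd point \<Rightarrow> real" where
  "K_op p B a b zb n v z =
     1/2 * (\<Sum>i\<in>first_block p. \<Sum>j\<in>first_block p. taylor p B (int n) (a i j) zb z * dx i (dx j v) z)
     + (\<Sum>i\<in>first_block p. taylor p B (int n - 1) (b i) zb z * dx i v z)
     + dY B v z"

definition A_mat ::
  "(nat \<Rightarrow> nat) \<Rightarrow> ('d::{finite,linorder} \<Rightarrow> 'd \<Rightarrow> 'd point \<Rightarrow> real) \<Rightarrow> 'd point \<Rightarrow> 'd rmat" where
  "A_mat p a zb = (\<chi> i j. if i \<in> first_block p \<and> j \<in> first_block p then a i j zb else 0)"

definition C_mat ::
  "(nat \<Rightarrow> nat) \<Rightarrow> 'd::{finite,linorder} rmat \<Rightarrow> ('d \<Rightarrow> 'd \<Rightarrow> 'd point \<Rightarrow> real) \<Rightarrow> 'd point \<Rightarrow> real \<Rightarrow> 'd rmat" where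
  "C_mat p B a zb t =
     (LINT s:{0..t}|lborel. matexp (s *\<^sub>R B) ** A_mat p a zb ** matexp (s *\<^sub>R transpose B))"

definition Gamma0 ::
  "(nat \<Rightarrow> nat) \<Rightarrow> 'd::{finite,linorder} rmat \<Rightarrow> ('d \<Rightarrow> 'd \<Rightarrow> 'd point \<Rightarrow> real) \<Rightarrow> 'd point \<Rightarrow>
   'd point \<Rightarrow> 'd point \<Rightarrow> real" where
  "Gamma0 p B a zb = (\<lambda>(t, x) (s, y).
     1 / sqrt ((2 * pi) ^ CARD('d) * det (C_mat p B a zb (s - t))) *
     exp (- 1/2 * ((matrix_inv (C_mat p B a zb (s - t)) *v (y - matexp ((s - t) *\<^sub>R B) *v x))
                   \<bullet> (y - matexp ((s - t) *\<^sub>R B) *v x))))"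

(* u_0 is the non-rapidly increasing solution of K_0 u_0 = 0 on [0,T), u_0(T,.) = phi, and u_n that
   of K_0 u_n = - (sum of (K_h - K_(h-1)) u_(n-h) over h = 1..n), u_n(T,.) = 0: they are given by
   the representation formulas with the fundamental solution Gamma0. *)
fun u_exp ::
  "(nat \<Rightarrow> nat) \<Rightarrow> 'd::{finite,linorder} rmat \<Rightarrow> ('d \<Rightarrow> 'd \<Rightarrow> 'd point \<Rightarrow> real) \<Rightarrow> ('d \<Rightarrow> 'd point \<Rightarrow> real) \<Rightarrow>
   'd point \<Rightarrow> real \<Rightarrow> ('d rvec \<Rightarrow> real) \<Rightarrow> nat \<Rightarrow> 'd point \<Rightarrow> real" where
  "u_exp p B a b zb T \<phi> 0 (t, x) =
     (if t < T then LINT y|lborel. Gamma0 p B a zb (t, x) (T, y) * \<phi> y else \<phi> x)"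
| "u_exp p B a b zb T \<phi> (Suc n) (t, x) =
     (\<Sum>h=1..Suc n. LINT s:{t..T}|lborel. LINT \<xi>|lborel.
        Gamma0 p B a zb (t, x) (s, \<xi>) *
        (K_op p B a b zb h (u_exp p B a b zb T \<phi> (Suc n - h)) (s, \<xi>)
         - K_op p B a b zb (h - 1) (u_exp p B a b zb T \<phi> (Suc n - h)) (s, \<xi>)))"

(* phi is O(exp (C |x|)) for some C. This is the weakest common meaning of "sub-exponential growth":
   it follows from phi being O(exp (c |x|)) for all c > 0. *)
definition subexponential :: "('d::finite rvec \<Rightarrow> real) \<Rightarrow> bool" where
  "subexponential \<phi> \<longleftrightarrow> (\<exists>C. \<forall>x. \<bar>\<phi> x\<bar> \<le> C * exp (C * norm x))"

section \<open>The differential operators\<close>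

(* Operators in x act on functions of type 'd rvec \<Rightarrow> real. *)

definition partial :: "'d::finite \<Rightarrow> ('d rvec \<Rightarrow> real) \<Rightarrow> 'd rvec \<Rightarrow> real" where
  "partial i g x = deriv (\<lambda>\<delta>. g (x + \<delta> *\<^sub>R axis i 1)) 0"

definition M_mat ::
  "(nat \<Rightarrow> nat) \<Rightarrow> 'd::{finite,linorder} rmat \<Rightarrow> ('d \<Rightarrow> 'd \<Rightarrow> 'd point \<Rightarrow> real) \<Rightarrow> 'd point \<Rightarrow> real \<Rightarrow> 'd rmat" where
  "M_mat p B a zb t = matexp (- t *\<^sub>R B) ** C_mat p B a zb t ** matexp (- t *\<^sub>R transpose B)"

(* Component i of exp(tB) (x + M(t) grad). *)
definition M_op ::
  "(nat \<Rightarrow> nat) \<Rightarrow> 'd::{finite,linorder} rmat \<Rightarrow> ('d \<Rightarrow> 'd \<Rightarrow> 'd point \<Rightarrow> real) \<Rightarrow> 'd point \<Rightarrow> real \<Rightarrow>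
   'd \<Rightarrow> ('d rvec \<Rightarrow> real) \<Rightarrow> 'd rvec \<Rightarrow> real" where
  "M_op p B a zb t i g x =
     (\<Sum>j\<in>UNIV. matexp (t *\<^sub>R B) $ i $ j *
        (x $ j * g x + (\<Sum>k\<in>UNIV. M_mat p B a zb t $ j $ k * partial k g x)))"

(* Component i of exp(-t B^T) grad. *)
definition grad_op :: "'d::finite rmat \<Rightarrow> real \<Rightarrow> 'd \<Rightarrow> ('d rvec \<Rightarrow> real) \<Rightarrow> 'd rvec \<Rightarrow> real" where
  "grad_op B t i g x = (\<Sum>k\<in>UNIV. matexp (- t *\<^sub>R transpose B) $ i $ k * partial k g x)"

definition coeffs_of :: "('d::finite rvec \<Rightarrow> real) \<Rightarrow> (('d \<Rightarrow> nat) \<Rightarrow> real) \<Rightarrow> bool" where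
  "coeffs_of q c \<longleftrightarrow> finite {\<beta>. c \<beta> \<noteq> 0} \<and>
     (\<forall>y. q y = (\<Sum>\<beta> | c \<beta> \<noteq> 0. c \<beta> * (\<Prod>i\<in>UNIV. (y $ i) ^ \<beta> i)))"

(* For a polynomial function q, its coefficients are unique, and poly_op q D is q with the
   operators D i substituted for the variables y $ i. *)
definition poly_op ::
  "('d::{finite,linorder} rvec \<Rightarrow> real) \<Rightarrow> ('d \<Rightarrow> ('d rvec \<Rightarrow> real) \<Rightarrow> 'd rvec \<Rightarrow> real) \<Rightarrow>
   ('d rvec \<Rightarrow> real) \<Rightarrow> 'd rvec \<Rightarrow> real" where
  "poly_op q D g x = (let c = (SOME c. coeffs_of q c) in \<Sum>\<beta> | c \<beta> \<noteq> 0. c \<beta> * op_power D \<beta> g x)"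

definition G_op ::
  "(nat \<Rightarrow> nat) \<Rightarrow> 'd::{finite,linorder} rmat \<Rightarrow> ('d \<Rightarrow> 'd \<Rightarrow> 'd point \<Rightarrow> real) \<Rightarrow> ('d \<Rightarrow> 'd point \<Rightarrow> real) \<Rightarrow>
   'd point \<Rightarrow> nat \<Rightarrow> real \<Rightarrow> real \<Rightarrow> ('d rvec \<Rightarrow> real) \<Rightarrow> 'd rvec \<Rightarrow> real" where
  "G_op p B a b zb n t s g x =
     1/2 * (\<Sum>i\<in>first_block p. \<Sum>j\<in>first_block p.
        poly_op (\<lambda>y. taylor p B (int n) (a i j) zb (s, y) - taylor p B (int n - 1) (a i j) zb (s, y))
          (M_op p B a zb (s - t)) (grad_op B (s - t) i (grad_op B (s - t) j g)) x)
     + (\<Sum>i\<in>first_block p.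
        poly_op (\<lambda>y. taylor p B (int n - 1) (b i) zb (s, y) - taylor p B (int n - 2) (b i) zb (s, y))
          (M_op p B a zb (s - t)) (grad_op B (s - t) i g) x)"

definition I_set :: "nat \<Rightarrow> nat \<Rightarrow> nat list set" where
  "I_set n h = {is. length is = h \<and> (\<forall>k\<in>set is. 1 \<le> k) \<and> sum_list is = n}"

(* simplex_integral h t T F is the iterated integral of F [s_1, ..., s_h] over
   t \<le> s_1 \<le> ... \<le> s_h \<le> T, with the integral in s_1 outermost. *)
fun simplex_integral :: "nat \<Rightarrow> real \<Rightarrow> real \<Rightarrow> (real list \<Rightarrow> real) \<Rightarrow> real" where
  "simplex_integral 0 t T F = F []"
| "simplex_integral (Suc h) t T F =
     (LINT s:{t..T}|lborel. simplex_integral h s T (\<lambda>ss. F (s # ss)))"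

(* In the product of the operators G the factor with s_1 is applied last. *)
definition L_op ::
  "(nat \<Rightarrow> nat) \<Rightarrow> 'd::{finite,linorder} rmat \<Rightarrow> ('d \<Rightarrow> 'd \<Rightarrow> 'd point \<Rightarrow> real) \<Rightarrow> ('d \<Rightarrow> 'd point \<Rightarrow> real) \<Rightarrow>
   'd point \<Rightarrow> nat \<Rightarrow> real \<Rightarrow> real \<Rightarrow> ('d rvec \<Rightarrow> real) \<Rightarrow> 'd rvec \<Rightarrow> real" where
  "L_op p B a b zb n t T g x =
     (\<Sum>h=1..n. simplex_integral h t T (\<lambda>ss.
        \<Sum>is\<in>I_set n h. foldr (\<lambda>(k, s). G_op p B a b zb k t s) (zip is ss) g x))"

end

(* The operator K_0 with coefficients frozen at zb generates a Gaussian semigroup P with u_0(t) = P(s - t) u_0(s) for s < T.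
   Differentiating the kernel shows that P(s - t) turns multiplication by the coordinates into the
   operators M(s - t) and the gradient into exp(-(s - t) B^T) grad, so that
   P(s - t) G_k(s, s_1) = G_k(t, s_1) P(s - t); moreover K_k - K_(k-1) at time s is G_k(s, s).
   By induction P(s - t) therefore carries the expansion of u_(n-k)(s) to operators at time t acting
   on u_0(t). These are finite sums of fixed differential operators with coefficients continuous in
   the integration times, so that they commute with the integrals although the derivatives of
   u_0(s) may blow up as s tends to T. *)

theory Submission
  imports Defs "HOL-Probability.Distributions"
begin

text \<open>The datum \<phi> is only continuous, so no derivative may fall on it: u_0(s) is smooth
  for s < T because the kernel is, with bounds that degenerate as s tends to T. Everything therefore
  happens in a class of functions, \<open>tame\<close>, that contains each u_0(s) with s < T and is
  stable under derivatives, multiplication by coordinates and P. The kernel exists because the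
  covariance matrix C is positive definite although A is degenerate; this is Kalman's rank condition
  and rests on the full rank of the blocks of B. The same block structure makes B nilpotent, so that
  exp(tB) is a polynomial in t. The operators M originate in a special property of Gaussians: the
  gradient of the kernel is the kernel times a linear function. Solving this relation for
  multiplication by a coordinate brings in the inverse of the precision matrix, that is C. That the
  lags add up in the intertwining relations is the group law for exp(tB) together with the cocycle
  identity for C, which expresses C(s + t) through C(s) and C(t).\<close>

declare transpose_matrix_vector [simp del]

section \<open>Exponentials of nilpotent matrices\<close>

lemma matpow_0 [simp]: "matpow A 0 = mat 1"
  by (simp add: matpow_def)

lemma matpow_Suc: "matpow A (Suc k) = A ** matpow A k"
  by (simp add: matpow_def)

lemma matpow_add: "matpow A (i + j) = matpow A i ** matpow A j"
  by (induction i) (simp_all add: matpow_Suc matrix_mul_assoc)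

lemma matpow_Suc2: "matpow A (Suc k) = matpow A k ** A"
  using matpow_add[of A k 1] by (simp add: matpow_Suc)

lemma matpow_scaleR: "matpow (c *\<^sub>R A) k = c ^ k *\<^sub>R matpow A k" for A :: "'d::finite rmat"
  by (induction k) (simp_all add: matpow_Suc scalar_matrix_assoc matrix_scalar_ac mult.commute)

lemma matpow_transpose: "matpow (transpose A) k = transpose (matpow A k)" for A :: "'d::finite rmat"
proof (induction k)
  case (Suc k)
  then show ?case
    unfolding matpow_Suc matpow_Suc2[of A] by (simp add: matrix_transpose_mul matpow_Suc[symmetric])
       (metis matpow_Suc matpow_Suc2 matrix_transpose_mul)
qed simp

lemma transpose_sum: "transpose (\<Sum>k\<in>S. f k) = (\<Sum>k\<in>S. transpose (f k))"
  by (simp add: transpose_def vec_eq_iff sum_component)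

lemma matrix_add_rdistrib: "(A + B) ** C = A ** C + B ** C" for A :: "'a::semiring_1^'n^'m"
  by (simp add: matrix_matrix_mult_def vec_eq_iff sum.distrib algebra_simps)

lemma matrix_mult_sum_left: "(\<Sum>k\<in>S. f k) ** A = (\<Sum>k\<in>S. f k ** A)" for A :: "'d::finite rmat"
  by (induction S rule: infinite_finite_induct) (auto simp: matrix_add_rdistrib)

lemma matrix_mult_sum_right: "A ** (\<Sum>k\<in>S. f k) = (\<Sum>k\<in>S. A ** f k)" for A :: "'d::finite rmat"
  by (induction S rule: infinite_finite_induct) (auto simp: matrix_add_ldistrib)

text \<open>Nilpotency turns the exponential series into a finite sum, so that all facts about
  \<open>matexp\<close> below are polynomial identities in t.\<close>

locale nilpotent_matrix =
  fixes B :: "'d::finite rmat" and m :: nat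
  assumes nilpotent: "matpow B m = 0"
begin

lemma matpow_eq_0: "m \<le> k \<Longrightarrow> matpow B k = 0"
  using matpow_add[of B "k - m" m] by (simp add: nilpotent)

lemma matexp_eq_sum: "matexp (t *\<^sub>R B) = (\<Sum>k<m. (t ^ k / fact k) *\<^sub>R matpow B k)"
  unfolding matexp_def by (subst suminf_finite[of "{..<m}"]) (auto simp: matpow_scaleR matpow_eq_0 not_less)

lemma matexp_0: "matexp (0 *\<^sub>R B) = mat 1"
  unfolding matexp_eq_sum
\<comment> \<open>For \<open>m = 0\<close> the assumption of the locale reads
  \<open>mat 1 = 0\<close>, which is the claim for the empty sum.\<close>
proof (cases m)
  case (Suc l)
  have "(\<Sum>k<m. (0 ^ k / fact k) *\<^sub>R matpow B k) = (\<Sum>k<m. if k = 0 then mat 1 else 0)"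
    by (intro sum.cong) auto
  then show "(\<Sum>k<m. (0 ^ k / fact k) *\<^sub>R matpow B k) = mat 1"
    by (simp add: Suc)
qed (use nilpotent in simp)

text \<open>Cauchy product of two finite sums. The square of index pairs may be replaced by the
  triangle i + j < m because the remaining terms contain a vanishing power of B; along the diagonals
  the binomial theorem applies.\<close>

lemma matexp_add: "matexp ((s + t) *\<^sub>R B) = matexp (s *\<^sub>R B) ** matexp (t *\<^sub>R B)"
proof -
  define g where "g i j = (s ^ i * t ^ j / (fact i * fact j)) *\<^sub>R matpow B (i + j)" for i j
  have "matexp (s *\<^sub>R B) ** matexp (t *\<^sub>R B) = (\<Sum>i<m. \<Sum>j<m. g i j)"
    unfolding matexp_eq_sum g_def
    by (simp add: matrix_mult_sum_left matrix_mult_sum_right scalar_matrix_assoc[symmetric] matrix_scalar_ac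
        matpow_add scaleR_sum_right, subst sum.swap, simp add: field_simps)
  also have "\<dots> = (\<Sum>(i, j)\<in>{..<m} \<times> {..<m}. g i j)"
    by (simp add: sum.cartesian_product)
  also have "\<dots> = (\<Sum>(i, j)\<in>{(i, j). i + j < m}. g i j)"
  proof (rule sum.mono_neutral_right)
    have "g i j = 0" if "\<not> i + j < m" for i j
      using that by (simp add: g_def matpow_eq_0)
    then show "\<forall>x\<in>{..<m} \<times> {..<m} - {(i, j). i + j < m}. (case x of (i, j) \<Rightarrow> g i j) = 0"
      by auto
  qed auto
  also have "\<dots> = (\<Sum>k<m. \<Sum>i\<le>k. g i (k - i))"
    by (rule sum.triangle_reindex)
  also have "\<dots> = (\<Sum>k<m. ((s + t) ^ k / fact k) *\<^sub>R matpow B k)"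
  proof (rule sum.cong[OF refl])
    fix k
    have "(\<Sum>i\<le>k. g i (k - i)) = (\<Sum>i\<le>k. (s ^ i * t ^ (k - i) / (fact i * fact (k - i)))) *\<^sub>R matpow B k"
      unfolding scaleR_sum_left by (intro sum.cong) (auto simp: g_def)
    also have "(\<Sum>i\<le>k. (s ^ i * t ^ (k - i) / (fact i * fact (k - i)))) = (s + t) ^ k / fact k"
      unfolding binomial_ring sum_divide_distrib
      by (intro sum.cong) (auto simp: binomial_fact field_simps)
    finally show "(\<Sum>i\<le>k. g i (k - i)) = ((s + t) ^ k / fact k) *\<^sub>R matpow B k" .
  qed
  finally show ?thesis by (simp add: matexp_eq_sum)
qed

lemma continuous_on_matexp: "continuous_on S (\<lambda>t. matexp (t *\<^sub>R B))"
  unfolding matexp_eq_sum by (intro continuous_intros) auto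

lemma matexp_transpose: "matexp (t *\<^sub>R transpose B) = transpose (matexp (t *\<^sub>R B))"
proof -
  have "transpose (0 :: 'd rmat) = 0"
    by (simp add: transpose_def vec_eq_iff)
  then interpret T: nilpotent_matrix "transpose B" m
    by unfold_locales (simp add: matpow_transpose nilpotent)
  show ?thesis
    unfolding T.matexp_eq_sum matexp_eq_sum by (simp add: transpose_sum transpose_scalar matpow_transpose)
qed

end

section \<open>The block structure and the Kalman condition\<close>

lemma position_bij: "bij_betw (position :: 'd::{finite,linorder} \<Rightarrow> nat) UNIV {..<CARD('d)}"
proof -
  have lt: "position i < position j" if "i < j" for i j :: 'd
    unfolding position_def by (rule psubset_card_mono) (use that in auto)
  have "inj (position :: 'd \<Rightarrow> nat)"
    by (metis injI lt less_irrefl linorder_less_linear)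
  moreover have "position i < CARD('d)" for i :: 'd
    unfolding position_def by (rule psubset_card_mono) auto
  ultimately show ?thesis
    by (intro bij_betw_imageI card_subset_eq) (auto simp: card_image)
qed

locale block_matrix =
  fixes r :: nat and p :: "nat \<Rightarrow> nat" and B :: "'d::{finite,linorder} rmat"
  assumes bf: "block_form r p B"
begin

lemma block_le: "block p (i::'d) \<le> r"
proof -
  have "position i < (\<Sum>j\<le>r. p j)"
    using position_bij[where 'd='d] bf by (auto simp: block_form_def bij_betw_def)
  then show ?thesis unfolding block_def by (rule Least_le)
qed

lemma block_eq_iff: 
  assumes "k \<le> r"
  shows "block p (i::'d) = k \<longleftrightarrow> (\<Sum>j<k. p j) \<le> position i \<and> position i < (\<Sum>j\<le>k. p j)"
proof -
  have ex: "position i < (\<Sum>j\<le>r. p j)"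
    using position_bij[where 'd='d] bf by (auto simp: block_form_def bij_betw_def)
  have mono: "(\<Sum>j\<le>k. p j) \<le> (\<Sum>j<l. p j)" if "k < l" for k l
    by (rule sum_mono2) (use that in auto)
  show ?thesis
  proof
    assume b: "block p i = k"
    have "position i < (\<Sum>j\<le>k. p j)"
      using LeastI[where P="\<lambda>k. position i < (\<Sum>j\<le>k. p j)", OF ex] b unfolding block_def by simp
    moreover have "(\<Sum>j<k. p j) \<le> position i"
    proof (cases k)
      case (Suc l)
      then have "\<not> position i < (\<Sum>j\<le>l. p j)"
        using b not_less_Least[of l "\<lambda>k. position i < (\<Sum>j\<le>k. p j)"] unfolding block_def by simp
      then show ?thesis by (simp add: Suc lessThan_Suc_atMost)
    qed simp
    ultimately show "(\<Sum>j<k. p j) \<le> position i \<and> position i < (\<Sum>j\<le>k. p j)" by simp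
  next
    assume *: "(\<Sum>j<k. p j) \<le> position i \<and> position i < (\<Sum>j\<le>k. p j)"
    show "block p i = k" unfolding block_def
    proof (rule Least_equality)
      fix l assume "position i < (\<Sum>j\<le>l. p j)"
      then show "k \<le> l" using mono[of l k] * by (meson leD le_less_trans not_le order_trans)
    qed (use * in simp)
  qed
qed

lemma card_block: 
  assumes "k \<le> r"
  shows "card {i::'d. block p i = k} = p k"
proof -
  let ?lo = "\<Sum>j<k. p j" and ?hi = "\<Sum>j\<le>k. p j"
  have hi: "?hi \<le> CARD('d)"
  proof -
    have "?hi \<le> (\<Sum>j\<le>r. p j)" by (rule sum_mono2) (use assms in auto)
    then show ?thesis using bf by (simp add: block_form_def)
  qed
  have "position ` {i::'d. block p i = k} = {?lo..<?hi}"
  proof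
    show "{?lo..<?hi} \<subseteq> position ` {i::'d. block p i = k}"
    proof
      fix n assume n: "n \<in> {?lo..<?hi}"
      then have "n \<in> position ` (UNIV :: 'd set)" using hi position_bij[where 'd='d] by (auto simp: bij_betw_def)
      then show "n \<in> position ` {i::'d. block p i = k}" using n block_eq_iff[OF assms] by auto
    qed
  qed (use block_eq_iff[OF assms] in auto)
  moreover have "inj_on position {i::'d. block p i = k}"
    using position_bij[where 'd='d] by (auto simp: bij_betw_def inj_on_def)
  ultimately have "card {i::'d. block p i = k} = card {?lo..<?hi}"
    by (metis card_image)
  then show ?thesis by (simp add: lessThan_Suc_atMost[symmetric])
qed

text \<open>B maps each block into the next one, so its k-th power is supported k blocks below the
  diagonal. Beyond k = r no room is left.\<close>

lemma matpow_eq_0_block: "block p i \<noteq> block p j + k \<Longrightarrow> matpow B k $ i $ j = 0"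
proof (induction k arbitrary: i)
  case 0
  then show ?case by (auto simp: mat_def)
next
  case (Suc k)
  have "B $ i $ l * matpow B k $ l $ j = 0" for l
    using bf Suc.IH[of l] Suc.prems unfolding block_form_def by (metis add_Suc_right mult_eq_0_iff)
  then have "(\<Sum>l\<in>UNIV. B $ i $ l * matpow B k $ l $ j) = 0"
    by (intro sum.neutral) blast
  then show ?case by (simp add: matpow_Suc matrix_matrix_mult_def)
qed

lemma matpow_nilpotent: "matpow B (Suc r) = 0"
proof -
  have "block p i \<noteq> block p j + Suc r" for i j :: 'd
    using block_le[of i] by simp
  then show ?thesis
    using matpow_eq_0_block by (simp add: vec_eq_iff)
qed

text \<open>The padded block has rank p j and at most p j nonzero rows, namely those of block j.
  Hence these rows are distinct and linearly independent, and v, supported on block j, gives a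
  vanishing combination of them.\<close>

lemma subdiag_block_rows_independent:
  assumes j: "j \<in> {1..r}" and supp: "\<And>i. block p i \<noteq> j \<Longrightarrow> v $ i = 0"
    and v: "v v* subdiag_block p B j = 0"
  shows "v = (0 :: 'd rvec)"
proof -
  define R where "R = subdiag_block p B j"
  define S where "S = {i::'d. block p i = j}"
  have rk: "dim (rows R) = p j" using bf j by (simp add: block_form_def row_rank_def R_def)
  have r0: "row i R = 0" if "i \<notin> S" for i
    using that by (auto simp: S_def R_def row_def subdiag_block_def vec_eq_iff)
  have cS: "card S = p j" unfolding S_def by (rule card_block) (use j in auto)
  have "rows R \<subseteq> span ((\<lambda>i. row i R) ` S)"
  proof
    fix x assume "x \<in> rows R"
    then obtain i where "x = row i R" by (auto simp: rows_def)
    then show "x \<in> span ((\<lambda>i. row i R) ` S)"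
      using r0[of i] by (cases "i \<in> S") (auto intro: span_base span_zero)
  qed
  then have "p j \<le> dim ((\<lambda>i. row i R) ` S)" using rk by (metis dim_mono)
  also have "\<dots> \<le> card ((\<lambda>i. row i R) ` S)" by (rule dim_le_card') simp
  finally have "card S \<le> card ((\<lambda>i. row i R) ` S)" by (simp add: cS)
  then have inj: "inj_on (\<lambda>i. row i R) S"
    by (simp add: card_image_le eq_card_imp_inj_on le_antisym)
  have "card ((\<lambda>i. row i R) ` S) \<le> dim ((\<lambda>i. row i R) ` S)"
    using \<open>p j \<le> dim _\<close> card_image_le[of S "\<lambda>i. row i R"] cS by simp
  then have ind: "independent ((\<lambda>i. row i R) ` S)"
    by (intro card_le_dim_spanning[of _ "span ((\<lambda>i. row i R) ` S)"]) (auto simp: span_superset)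
  have "(\<Sum>i\<in>S. v $ i *\<^sub>R row i R) = v v* R"
  proof -
    have "(\<Sum>i\<in>S. v $ i *\<^sub>R row i R) = (\<Sum>i\<in>UNIV. v $ i *\<^sub>R row i R)"
      by (rule sum.mono_neutral_left) (use supp in \<open>auto simp: S_def\<close>)
    then show ?thesis by (simp add: vec_eq_iff vector_matrix_mult_def sum_component row_def mult.commute)
  qed
  \<comment> \<open>The combination is re-indexed by the row vectors themselves, since independence
    is formulated for coefficients attached to vectors; injectivity of i \<mapsto> row i makes this
    possible.\<close>
  then have "(\<Sum>x\<in>(\<lambda>i. row i R) ` S. v $ (inv_into S (\<lambda>i. row i R) x) *\<^sub>R x) = 0"
    using v by (simp add: sum.reindex[OF inj] inv_into_f_f[OF inj] R_def[symmetric])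
  then have "v $ (inv_into S (\<lambda>i. row i R) x) = 0" if "x \<in> (\<lambda>i. row i R) ` S" for x
    using independentD[OF ind _ order_refl _ that, of "\<lambda>x. v $ (inv_into S (\<lambda>i. row i R) x)"] by simp
  then have "v $ i = 0" if "i \<in> S" for i
    using that inj by (metis imageI inv_into_f_f)
  then show ?thesis using supp by (auto simp: vec_eq_iff S_def)
qed

text \<open>Kalman's rank condition in dual form, by induction on the block number. Suppose block j
  of every vector \<open>transpose (matpow B k) *v \<xi>\<close> vanishes. Block j of the vector for
  k + 1 is the transpose of the block B_(j+1) applied to block j + 1 of the vector for k, and this
  transposed block is injective; so block j + 1 vanishes too.\<close>

lemma kalman:
  assumes "\<And>k i. i \<in> first_block p \<Longrightarrow> (transpose (matpow B k) *v \<xi>) $ i = 0"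
  shows "\<xi> = 0"
proof -
  let ?\<eta> = "\<lambda>k. transpose (matpow B k) *v \<xi>"
  have step: "?\<eta> (Suc k) = transpose B *v ?\<eta> k" for k
    by (simp add: matpow_Suc2 matrix_transpose_mul matrix_vector_mul_assoc)
  have "\<forall>k i. block p i = j \<longrightarrow> ?\<eta> k $ i = 0" if "j \<le> r" for j
    using that
  proof (induction j)
    case 0
    then show ?case using assms by (auto simp: first_block_def)
  next
    case (Suc j)
    show ?case
    proof (intro allI impI)
      fix k and i :: 'd assume i: "block p i = Suc j"
      define v :: "'d rvec" where "v = (\<chi> i. if block p i = Suc j then ?\<eta> k $ i else 0)"
      have "v v* subdiag_block p B (Suc j) = 0"
      proof (subst vec_eq_iff, rule allI)
        fix l
        show "(v v* subdiag_block p B (Suc j)) $ l = 0 $ l"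
        proof (cases "block p l = j")
          case True
          have "(v v* subdiag_block p B (Suc j)) $ l = (\<Sum>i\<in>UNIV. B $ i $ l * ?\<eta> k $ i)"
            unfolding vector_matrix_mult_def using bf True
            by (auto simp: v_def subdiag_block_def block_form_def intro!: sum.cong)
          also have "\<dots> = ?\<eta> (Suc k) $ l"
            unfolding step by (simp add: matrix_vector_mult_def transpose_def)
          also have "\<dots> = 0" using Suc True by simp
          finally show ?thesis by simp
        next
          case False
          then show ?thesis by (simp add: vector_matrix_mult_def subdiag_block_def)
        qed
      qed
      then have "v = 0"
        using Suc.prems by (intro subdiag_block_rows_independent[of "Suc j" v]) (simp_all add: v_def)
      then have "v $ i = 0" by simp
      then show "?\<eta> k $ i = 0" using i by (simp add: v_def)
    qed
  qed
  then have "?\<eta> 0 $ i = 0" for i using block_le[of i] by blast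
  then show ?thesis by (simp add: vec_eq_iff)
qed

end

section \<open>The covariance matrix\<close>

locale degenerate_diffusion = block_matrix r p B
  for r p and B :: "'d::{finite,linorder} rmat" +
  fixes A :: "'d rmat"
  assumes A_sym: "transpose A = A"
    and A_nonneg: "\<And>\<eta>. 0 \<le> (A *v \<eta>) \<bullet> \<eta>"
    and A_definite: "\<And>\<eta> i. (A *v \<eta>) \<bullet> \<eta> = 0 \<Longrightarrow> i \<in> first_block p \<Longrightarrow> \<eta> $ i = 0"
begin

sublocale nilpotent_matrix B "Suc r"
  by unfold_locales (rule matpow_nilpotent)

definition E :: "real \<Rightarrow> 'd rmat" where "E t = matexp (t *\<^sub>R B)"

definition F :: "real \<Rightarrow> 'd rmat" where "F s = E s ** A ** transpose (E s)"

text \<open>The covariance as a gauge integral, for which splitting the interval, shifting it and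
  pulling out linear maps are at hand; \<open>C_eq\<close> identifies it with the Lebesgue
  integral.\<close>

definition C :: "real \<Rightarrow> 'd rmat" where "C t = integral {0..t} F"

lemma E_0: "E 0 = mat 1"
  using matexp_0 by (simp add: E_def)

lemma E_add: "E (s + t) = E s ** E t"
  by (simp add: E_def matexp_add)

lemma continuous_on_E: "continuous_on S E"
  unfolding E_def by (rule continuous_on_matexp)

lemma continuous_on_F: "continuous_on S F"
  unfolding F_def matrix_matrix_mult_def transpose_def
  by (intro continuous_intros continuous_on_E)

lemma F_integrable: "F integrable_on {a..b}"
  by (rule integrable_continuous_interval) (rule continuous_on_F)

lemma bounded_linear_mult: "bounded_linear (\<lambda>X :: 'd rmat. U ** X ** V)"
  unfolding linear_conv_bounded_linear[symmetric]
  by (rule linearI) (simp_all add: matrix_add_ldistrib matrix_add_rdistrib scalar_matrix_assoc matrix_scalar_ac)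

lemma bounded_linear_transpose: "bounded_linear (\<lambda>X :: 'd rmat. transpose X)"
  unfolding linear_conv_bounded_linear[symmetric]
  by (rule linearI) (simp_all add: transpose_def vec_eq_iff)

lemma C_eq: "C t = (LINT s:{0..t}|lborel. F s)"
proof -
  have "set_integrable lborel {0..t} F"
    by (rule borel_integrable_atLeastAtMost') (rule continuous_on_F)
  then show ?thesis by (simp add: C_def set_borel_integral_eq_integral)
qed

lemma C_0: "C 0 = 0"
  by (simp add: C_def)

text \<open>Splitting the integral at t and using F(s + t) = E(t) F(s) E(t)^T. Probabilistically,
  the covariance accumulated first is transported by the flow and an independent one is
  added.\<close>

lemma C_add:
  assumes "0 \<le> s" "0 \<le> t"
  shows "C (s + t) = C t + E t ** C s ** transpose (E t)"
proof -
  have "C (s + t) = integral {0..t} F + integral {t..s + t} F"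
    unfolding C_def by (rule Henstock_Kurzweil_Integration.integral_combine[symmetric]) (use assms F_integrable in auto)
  also have "integral {t..s + t} F = integral {0..s} (F \<circ> (\<lambda>x. x + t))"
    using integral_shift[of 0 t s F] continuous_on_F by simp
  also have "F \<circ> (\<lambda>x. x + t) = (\<lambda>X. E t ** X ** transpose (E t)) \<circ> F"
    by (simp add: fun_eq_iff F_def add.commute[of _ t] E_add matrix_transpose_mul matrix_mul_assoc)
  also have "integral {0..s} \<dots> = E t ** C s ** transpose (E t)"
    unfolding C_def by (rule integral_linear[OF F_integrable bounded_linear_mult])
  finally show ?thesis by (simp add: C_def)
qed

lemma C_sym: "transpose (C t) = C t"
proof -
  have "transpose (C t) = integral {0..t} (transpose \<circ> F)"
    unfolding C_def by (rule integral_linear[OF F_integrable bounded_linear_transpose, symmetric])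
  also have "transpose \<circ> F = F"
    by (simp add: fun_eq_iff F_def matrix_transpose_mul A_sym matrix_mul_assoc)
  finally show ?thesis by (simp add: C_def)
qed

lemma continuous_on_C: "continuous_on {0..b} C"
  unfolding C_def by (rule indefinite_integral_continuous_1[OF F_integrable])

lemma bounded_linear_quadratic: "bounded_linear (\<lambda>X :: 'd rmat. (X *v \<xi>) \<bullet> \<xi>)"
  unfolding linear_conv_bounded_linear[symmetric]
  by (rule linearI) (simp_all add: matrix_vector_mult_add_rdistrib inner_left_distrib scaleR_matrix_vector_assoc[symmetric])

text \<open>The controllability argument. A vanishing form forces the continuous nonnegative
  integrand to vanish on [0, t], hence also the first-block components of
  \<open>transpose (E s) *v \<xi>\<close>. These are polynomials in s, so with infinitely many zeros
  all their coefficients vanish, which is the hypothesis of \<open>kalman\<close>.\<close>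

lemma C_pos:
  assumes t: "0 < t" and "\<xi> \<noteq> 0"
  shows "0 < (C t *v \<xi>) \<bullet> \<xi>"
proof -
  define \<eta> where "\<eta> s = transpose (E s) *v \<xi>" for s
  define g where "g s = (A *v \<eta> s) \<bullet> \<eta> s" for s
  have g: "(F s *v \<xi>) \<bullet> \<xi> = g s" for s
    unfolding F_def g_def \<eta>_def
    by (simp add: matrix_vector_mul_assoc[symmetric] dot_lmul_matrix[symmetric] inner_commute transpose_matrix_vector)
  have C: "(C t *v \<xi>) \<bullet> \<xi> = integral {0..t} g"
    unfolding C_def integral_linear[OF F_integrable bounded_linear_quadratic, symmetric] by (simp add: o_def g)
  have cont: "continuous_on S g" for S
    unfolding g[symmetric] matrix_vector_mult_def
    by (intro continuous_intros continuous_on_F)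
  have "integral {0..t} g \<noteq> 0"
  proof
    assume "integral {0..t} g = 0"
    then have g0: "g s = 0" if "s \<in> {0..t}" for s
      using integral_eq_0_iff[OF cont, of 0 t] that t A_nonneg by (auto simp: g_def)
    have "(transpose (matpow B k) *v \<xi>) $ i = 0" if i: "i \<in> first_block p" for k i
    proof (cases "k < Suc r")
      case True
      define c where "c k = (transpose (matpow B k) *v \<xi>) $ i / fact k" for k
      have \<eta>: "\<eta> s $ i = (\<Sum>k\<le>r. c k * s ^ k)" for s
        unfolding \<eta>_def E_def matexp_eq_sum transpose_sum
        by (simp add: transpose_scalar c_def matrix_vector_mult_def sum_component sum_distrib_left sum_distrib_right
              lessThan_Suc_atMost, subst sum.swap, simp add: field_simps sum_divide_distrib)
      have "{0..t} \<subseteq> {s. (\<Sum>k\<le>r. c k * s ^ k) = 0}"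
        using g0 A_definite[OF _ i] unfolding \<eta>[symmetric] by (auto simp: g_def)
      then have "infinite {s. (\<Sum>k\<le>r. c k * s ^ k) = 0}"
        using t infinite_super infinite_Icc by blast
      then have "c k = 0"
        using polyfun_finite_roots[of c r] True by (metis less_Suc_eq_le)
      then show ?thesis by (simp add: c_def)
    qed (simp add: matpow_eq_0 transpose_def matrix_vector_mult_def)
    then have "\<xi> = 0" by (rule kalman)
    then show False using assms by simp
  qed
  moreover have "0 \<le> integral {0..t} g"
    by (rule integral_nonneg) (use integrable_continuous_interval[OF cont] A_nonneg in \<open>auto simp: g_def\<close>)
  ultimately show ?thesis by (simp add: C)
qed

end

section \<open>Gaussian integrals\<close>

lemma measurable_vec_lambda [measurable]:
  "(\<lambda>f. \<chi> i. f i) \<in> borel_measurable (\<Pi>\<^sub>M i\<in>(UNIV::'d::finite set). (lborel :: real measure))"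
proof (subst borel_measurable_euclidean_space, rule ballI)
  fix b :: "real^'d" assume "b \<in> Basis"
  then obtain i where "b = axis i 1" by (auto simp: Basis_vec_def)
  then show "(\<lambda>f. (\<chi> i. f i) \<bullet> b) \<in> borel_measurable (\<Pi>\<^sub>M i\<in>(UNIV::'d set). (lborel :: real measure))"
    by (simp add: inner_axis)
qed

text \<open>Lebesgue measure is determined by its values on boxes, whose preimages are products of
  intervals. The identity makes it possible to integrate out one coordinate at a time.\<close>

lemma lborel_vec: "(lborel :: (real^'d) measure) = distr (\<Pi>\<^sub>M i\<in>(UNIV::'d set). lborel) borel (\<lambda>f. \<chi> i. f i)"
proof (rule lborel_eqI)
  interpret product_sigma_finite "\<lambda>_::'d. lborel :: real measure"
    by unfold_locales
  fix l u :: "real^'d"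
  assume le: "\<And>b. b \<in> Basis \<Longrightarrow> l \<bullet> b \<le> u \<bullet> b"
  have le': "l $ i \<le> u $ i" for i
    using le[of "axis i 1"] by (simp add: inner_axis Basis_vec_def) blast
  have "(\<lambda>f. \<chi> i. f i) -` box l u \<inter> space (\<Pi>\<^sub>M i\<in>(UNIV::'d set). lborel) = (\<Pi>\<^sub>E i\<in>UNIV. {l $ i <..< u $ i})"
    by (auto simp: mem_box_cart space_PiM PiE_def Pi_def)
  then have "emeasure (distr (\<Pi>\<^sub>M i\<in>(UNIV::'d set). lborel) borel (\<lambda>f. \<chi> i. f i)) (box l u) =
      emeasure (\<Pi>\<^sub>M i\<in>(UNIV::'d set). lborel) (\<Pi>\<^sub>E i\<in>UNIV. {l $ i <..< u $ i})"
    by (subst emeasure_distr) auto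
  also have "\<dots> = (\<Prod>i\<in>UNIV. ennreal (u $ i - l $ i))"
    using le' by (subst emeasure_PiM) auto
  also have "\<dots> = (\<Prod>b\<in>Basis. (u - l) \<bullet> b)"
  proof -
    have inj: "inj (\<lambda>i::'d. axis i (1::real))" by (auto simp: inj_on_def axis_eq_axis)
    have "(Basis :: (real^'d) set) = range (\<lambda>i. axis i 1)" by (auto simp: Basis_vec_def)
    then have "(\<Prod>b\<in>Basis. (u - l) \<bullet> b) = (\<Prod>b\<in>range (\<lambda>i. axis i 1). (u - l) \<bullet> b)"
      by simp
    also have "\<dots> = (\<Prod>i\<in>UNIV. u $ i - l $ i)"
      by (subst prod.reindex[OF inj]) (simp add: inner_axis)
    finally have "(\<Prod>b\<in>Basis. (u - l) \<bullet> b) = (\<Prod>i\<in>UNIV. u $ i - l $ i)" .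
    then show ?thesis
      using le' by (simp add: prod_ennreal)
  qed
  finally show "emeasure (distr (\<Pi>\<^sub>M i\<in>(UNIV::'d set). lborel) borel (\<lambda>f. \<chi> i. f i)) (box l u) =
      ennreal (\<Prod>b\<in>Basis. (u - l) \<bullet> b)" .
qed simp

lemma nn_integral_gaussian:
  fixes a c :: real
  assumes a: "0 < a"
  shows "(\<integral>\<^sup>+ y. ennreal (exp (- (a * (y - c)\<^sup>2) / 2)) \<partial>lborel) = ennreal (sqrt (2 * pi / a))"
proof -
  \<comment> \<open>The standard deviation for which the exponential is a multiple of a normal
    density with mean c.\<close>
  define \<sigma> where "\<sigma> = 1 / sqrt a"
  have \<sigma>: "0 < \<sigma>" "\<sigma>\<^sup>2 = 1 / a" using a by (auto simp: \<sigma>_def power_divide)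
  have "exp (- (a * (y - c)\<^sup>2) / 2) = sqrt (2 * pi / a) * normal_density c \<sigma> y" for y
    using a by (simp add: normal_density_def \<sigma> field_simps real_sqrt_divide)
  then have "(\<integral>\<^sup>+ y. ennreal (exp (- (a * (y - c)\<^sup>2) / 2)) \<partial>lborel) =
      ennreal (sqrt (2 * pi / a)) * (\<integral>\<^sup>+ y. ennreal (normal_density c \<sigma> y) \<partial>lborel)"
    using a by (simp add: ennreal_mult nn_integral_cmult)
  also have "(\<integral>\<^sup>+ y. ennreal (normal_density c \<sigma> y) \<partial>lborel) = 1"
    using \<sigma> by (subst nn_integral_eq_integral) auto
  finally show ?thesis by simp
qed

section \<open>Eliminating one variable from a quadratic form\<close>

lemma det_row_operations:
  fixes A :: "'a::comm_ring_1^'n^'n"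
  assumes "finite S" "k \<notin> S"
  shows "det (\<chi> i. if i \<in> S then row i A + c i *s row k A else row i A) = det A"
  using assms
proof (induction S rule: finite_induct)
  case (insert l S)
  let ?A = "\<chi> i. if i \<in> S then row i A + c i *s row k A else row i A"
  have "det (\<chi> i. if i = l then row l ?A + c l *s row k ?A else row i ?A) = det ?A"
    by (rule det_row_operation) (use insert in auto)
  also have "(\<chi> i. if i = l then row l ?A + c l *s row k ?A else row i ?A) =
      (\<chi> i. if i \<in> insert l S then row i A + c i *s row k A else row i A)"
    using insert by (auto simp: vec_eq_iff row_def)
  finally show ?case using insert by simp
qed (simp add: row_def)

definition qform :: "'d set \<Rightarrow> ('d \<Rightarrow> 'd \<Rightarrow> real) \<Rightarrow> ('d \<Rightarrow> real) \<Rightarrow> real" where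
  "qform I q w = (\<Sum>i\<in>I. \<Sum>j\<in>I. q i j * w i * w j)"

text \<open>The identity outside I keeps the matrix type fixed while the determinant is that of the
  I-by-I part, so that induction on the index set becomes possible.\<close>

definition padded :: "'d set \<Rightarrow> ('d \<Rightarrow> 'd \<Rightarrow> real) \<Rightarrow> real^'d^'d" where
  "padded I q = (\<chi> i j. if i \<in> I \<and> j \<in> I then q i j else if i = j then 1 else 0)"

lemma qform_insert:
  fixes k :: "'d::finite"
  assumes "finite I" "k \<notin> I" and sym: "\<And>i j. q i j = q j i"
  shows "qform (insert k I) q (w(k := y)) = q k k * y\<^sup>2 + 2 * (\<Sum>j\<in>I. q k j * w j) * y + qform I q w"
proof -
  let ?v = "w(k := y)"
  have "qform (insert k I) q v = q k k * v k * v k + (\<Sum>j\<in>I. q k j * v k * v j) +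
      (\<Sum>i\<in>I. q i k * v i * v k) + qform I q v" for v
    unfolding qform_def using assms(1,2) by (simp add: sum.distrib)
  moreover have "(\<Sum>j\<in>I. q k j * ?v k * ?v j) = y * (\<Sum>j\<in>I. q k j * w j)"
    unfolding sum_distrib_left by (rule sum.cong) (use assms in auto)
  moreover have "(\<Sum>i\<in>I. q i k * ?v i * ?v k) = y * (\<Sum>j\<in>I. q k j * w j)"
    unfolding sum_distrib_left by (subst sym, rule sum.cong) (use assms(1,2) in auto)
  moreover have "qform I q ?v = qform I q w"
    unfolding qform_def by (intro sum.cong) (use assms(1,2) in auto)
  ultimately show ?thesis by (simp add: power2_eq_square)
qed

text \<open>Gaussian elimination with pivot q k k: \<open>M1\<close> has column k cleared,
  \<open>M2\<close> also row k. What remains next to the pivot is the Schur complement.\<close>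

lemma det_padded_insert:
  fixes k :: "'d::finite"
  assumes fin: "finite I" and k: "k \<notin> I" and sym: "\<And>i j. q i j = q j i" and pos: "q k k \<noteq> 0"
  shows "det (padded (insert k I) q) = q k k * det (padded I (\<lambda>i j. q i j - q k i * q k j / q k k))"
proof -
  let ?q = "\<lambda>i j. q i j - q k i * q k j / q k k"
  define M where "M = padded (insert k I) q"
  define M1 where "M1 = (\<chi> i. if i \<in> I then row i M + (- q k i / q k k) *s row k M else row i M)"
  define M2 where "M2 = (\<chi> i. if i \<in> I then row i (transpose M1) + (- q k i / q k k) *s row k (transpose M1)
     else row i (transpose M1))"
  have "det M2 = det M"
    unfolding M2_def by (subst det_row_operations[OF fin k]) (simp add: M1_def det_row_operations[OF fin k])
  moreover have "M2 = (\<chi> i. if i = k then q k k *s row i (padded I ?q) else row i (padded I ?q))"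
  proof -
    have "M2 $ i $ j = (if i = k then q k k *s row i (padded I ?q) else row i (padded I ?q)) $ j" for i j
      using k pos sym[of i j] sym[of j k] unfolding M2_def M1_def M_def
      by (auto simp: row_def transpose_def padded_def)
    then show ?thesis by (simp add: vec_eq_iff)
  qed
  moreover have "det (\<chi> i. if i = k then q k k *s row i (padded I ?q) else row i (padded I ?q)) =
      q k k * det (\<chi> i. if i = k then row i (padded I ?q) else row i (padded I ?q))"
    by (rule det_row_mul)
  ultimately show ?thesis by (simp add: M_def row_def)
qed

text \<open>The variable w k is integrated out after completing the square. The remaining exponent
  is the form of the Schur complement \<open>q'\<close>, and the factor 1 / q k k under the root is
  the one by which the determinants differ.\<close>

lemma nn_integral_gaussian_padded:
  fixes q :: "'d::finite \<Rightarrow> 'd \<Rightarrow> real"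
  assumes "finite I" and "\<And>i j. q i j = q j i" and "\<And>w. \<exists>i\<in>I. w i \<noteq> 0 \<Longrightarrow> 0 < qform I q w"
  shows "0 < det (padded I q) \<and>
    (\<integral>\<^sup>+ w. ennreal (exp (- (1/2) * qform I q w)) \<partial>(\<Pi>\<^sub>M i\<in>I. lborel)) =
      ennreal (sqrt ((2 * pi) ^ card I / det (padded I q)))"
  using assms
proof (induction I arbitrary: q rule: finite_induct)
  case empty
  have "padded {} q = mat 1" by (simp add: padded_def mat_def)
  then show ?case by (simp add: qform_def PiM_empty nn_integral_count_space_finite)
next
  case (insert k I q)
  interpret product_sigma_finite "\<lambda>_::'d. lborel :: real measure"
    by unfold_locales
  have sym: "q i j = q j i" for i j by fact
  define b where "b w = (\<Sum>j\<in>I. q k j * w j)" for w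
  define q' where "q' i j = q i j - q k i * q k j / q k k" for i j
  have ins: "qform (insert k I) q (w(k := y)) = q k k * y\<^sup>2 + 2 * b w * y + qform I q w" for w y
    unfolding b_def by (rule qform_insert[OF insert.hyps sym])
  have kk: "0 < q k k"
    using insert.prems(2)[of "(\<lambda>_. 0)(k := 1)"] unfolding ins by (simp add: b_def qform_def)
  have q': "qform I q' w = qform I q w - (b w)\<^sup>2 / q k k" for w
    unfolding qform_def q'_def b_def power2_eq_square sum_product
    by (simp add: sum_subtractf[symmetric] sum_divide_distrib algebra_simps)
  have pos: "0 < qform I q' w" if "\<exists>i\<in>I. w i \<noteq> 0" for w
  proof -
    \<comment> \<open>The Schur complement is the minimum of the form over the k-th variable,
      attained at - b w / q k k; this is why it inherits positivity.\<close>
    have "0 < qform (insert k I) q (w(k := - b w / q k k))"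
      by (rule insert.prems) (use that insert.hyps in auto)
    also have "\<dots> = qform I q' w"
      unfolding ins q' using kk by (simp add: field_simps power2_eq_square)
    finally show ?thesis .
  qed
  note IH = insert.IH[of q', OF _ pos]
  have sym': "q' i j = q' j i" for i j by (simp add: q'_def sym[of i j])
  have det: "det (padded (insert k I) q) = q k k * det (padded I q')"
    unfolding q'_def by (rule det_padded_insert) (use insert.hyps sym kk in auto)
  have [measurable]: "(\<lambda>w. qform J q w) \<in> borel_measurable (\<Pi>\<^sub>M i\<in>J. lborel)" for J q
    unfolding qform_def by measurable
  have "(\<integral>\<^sup>+ w. ennreal (exp (- (1/2) * qform (insert k I) q w)) \<partial>(\<Pi>\<^sub>M i\<in>insert k I. lborel)) =
    (\<integral>\<^sup>+ w. (\<integral>\<^sup>+ y. ennreal (exp (- (1/2) * qform (insert k I) q (w(k := y)))) \<partial>lborel) \<partial>(\<Pi>\<^sub>M i\<in>I. lborel))"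
    by (rule product_nn_integral_insert) (use insert.hyps in auto)
  also have "\<dots> = (\<integral>\<^sup>+ w. ennreal (exp (- (1/2) * qform I q' w)) * ennreal (sqrt (2 * pi / q k k)) \<partial>(\<Pi>\<^sub>M i\<in>I. lborel))"
  proof (rule nn_integral_cong)
    fix w
    have "exp (- (1/2) * qform (insert k I) q (w(k := y))) =
        exp (- (1/2) * qform I q' w) * exp (- (q k k * (y - (- b w / q k k))\<^sup>2) / 2)" for y
      unfolding ins q' exp_add[symmetric] using kk by (simp add: field_simps power2_eq_square)
    then show "(\<integral>\<^sup>+ y. ennreal (exp (- (1/2) * qform (insert k I) q (w(k := y)))) \<partial>lborel) =
        ennreal (exp (- (1/2) * qform I q' w)) * ennreal (sqrt (2 * pi / q k k))"
      unfolding nn_integral_gaussian[OF kk, of "- b w / q k k", symmetric]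
      by (simp add: ennreal_mult nn_integral_cmult)
  qed
  also have "\<dots> = ennreal (sqrt ((2 * pi) ^ card I / det (padded I q'))) * ennreal (sqrt (2 * pi / q k k))"
    using IH sym' by (simp add: nn_integral_multc)
  also have "\<dots> = ennreal (sqrt ((2 * pi) ^ card (insert k I) / det (padded (insert k I) q)))"
    using IH sym' kk insert.hyps unfolding det
    by (simp add: ennreal_mult[symmetric] real_sqrt_mult[symmetric] field_simps)
  finally show ?case using IH sym' kk by (simp add: det)
qed

definition pos_def :: "real^'d^'d \<Rightarrow> bool" where
  "pos_def Q \<longleftrightarrow> transpose Q = Q \<and> (\<forall>w. w \<noteq> 0 \<longrightarrow> 0 < (Q *v w) \<bullet> w)"

lemma gaussian_integral:
  fixes Q :: "real^'d^'d"
  assumes "pos_def Q"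
  shows "0 < det Q"
    and "has_bochner_integral lborel (\<lambda>w. exp (- (1/2) * ((Q *v w) \<bullet> w))) (sqrt ((2 * pi) ^ CARD('d) / det Q))"
proof -
  define q where "q i j = Q $ i $ j" for i j
  have sym: "q i j = q j i" for i j
    using assms unfolding pos_def_def q_def transpose_def by (metis vec_lambda_beta)
  have Q: "padded UNIV q = Q" by (simp add: padded_def q_def vec_eq_iff)
  have qf: "qform UNIV q w = (Q *v (\<chi> i. w i)) \<bullet> (\<chi> i. w i)" for w
    by (simp add: qform_def q_def matrix_vector_mult_def inner_vec_def sum_distrib_left mult_ac)
  have "0 < qform UNIV q w" if "\<exists>i\<in>UNIV. w i \<noteq> 0" for w
    using assms that by (simp add: qf pos_def_def vec_eq_iff)
  note G = nn_integral_gaussian_padded[OF finite sym this, unfolded Q]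
  show det: "0 < det Q" using G by simp
  have [measurable]: "(\<lambda>w. (Q *v w) \<bullet> w) \<in> borel_measurable borel"
    by (intro borel_measurable_continuous_onI continuous_intros linear_continuous_on) auto
  have "(\<integral>\<^sup>+ w. ennreal (exp (- (1/2) * ((Q *v w) \<bullet> w))) \<partial>lborel) = 
     (\<integral>\<^sup>+ w. ennreal (exp (- (1/2) * qform UNIV q w)) \<partial>(\<Pi>\<^sub>M i\<in>UNIV. lborel))"
    unfolding lborel_vec qf by (subst nn_integral_distr) auto
  also have "\<dots> = ennreal (sqrt ((2 * pi) ^ CARD('d) / det Q))"
    using G by simp
  finally show "has_bochner_integral lborel (\<lambda>w. exp (- (1/2) * ((Q *v w) \<bullet> w))) (sqrt ((2 * pi) ^ CARD('d) / det Q))"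
    using det by (intro has_bochner_integral_nn_integral) auto
qed

section \<open>Smooth functions whose derivatives grow at most exponentially\<close>

lemma subexponentialI: 
  assumes "\<And>x. \<bar>f x\<bar> \<le> K * exp (A * norm x)"
  shows "subexponential f"
  unfolding subexponential_def
proof (intro exI allI)
  fix x
  have "\<bar>f x\<bar> \<le> K * exp (A * norm x)" by fact
  \<comment> \<open>The definition uses one constant both as factor and as rate; the larger of the
    two moduli serves for both.\<close>
  also have "\<dots> \<le> max \<bar>K\<bar> \<bar>A\<bar> * exp (max \<bar>K\<bar> \<bar>A\<bar> * norm x)"
    by (intro mult_mono) (auto intro!: mult_right_mono)
  finally show "\<bar>f x\<bar> \<le> max \<bar>K\<bar> \<bar>A\<bar> * exp (max \<bar>K\<bar> \<bar>A\<bar> * norm x)" .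
qed

lemma subexponentialE:
  assumes "subexponential f"
  obtains C where "0 \<le> C" "\<And>x. \<bar>f x\<bar> \<le> C * exp (C * norm x)"
proof -
  obtain C where C: "\<And>x. \<bar>f x\<bar> \<le> C * exp (C * norm x)"
    using assms by (auto simp: subexponential_def)
  moreover have "0 \<le> C" using C[of 0] by simp
  ultimately show thesis using that by blast
qed

lemma subexponential_add:
  assumes "subexponential f" "subexponential g"
  shows "subexponential (\<lambda>x. f x + g x)"
proof -
  obtain C D where C: "0 \<le> C" "\<And>x. \<bar>f x\<bar> \<le> C * exp (C * norm x)" and D: "0 \<le> D" "\<And>x. \<bar>g x\<bar> \<le> D * exp (D * norm x)"
    using assms by (auto elim!: subexponentialE)
  show ?thesis
  proof (rule subexponentialI)
    fix x
    have "\<bar>f x + g x\<bar> \<le> C * exp (C * norm x) + D * exp (D * norm x)" using C D by (smt (verit))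
    also have "\<dots> \<le> C * exp ((C + D) * norm x) + D * exp ((C + D) * norm x)"
      using C(1) D(1) by (intro add_mono mult_left_mono) (auto simp: algebra_simps)
    finally show "\<bar>f x + g x\<bar> \<le> (C + D) * exp ((C + D) * norm x)" by (simp add: algebra_simps)
  qed
qed

lemma subexponential_mult:
  assumes "subexponential f" "subexponential g"
  shows "subexponential (\<lambda>x. f x * g x)"
proof -
  obtain C D where C: "0 \<le> C" "\<And>x. \<bar>f x\<bar> \<le> C * exp (C * norm x)" and D: "0 \<le> D" "\<And>x. \<bar>g x\<bar> \<le> D * exp (D * norm x)"
    using assms by (auto elim!: subexponentialE)
  show ?thesis
  proof (rule subexponentialI)
    fix x
    have "\<bar>f x * g x\<bar> \<le> (C * exp (C * norm x)) * (D * exp (D * norm x))"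
      unfolding abs_mult using C D by (intro mult_mono) auto
    also have "\<dots> = (C * D) * exp ((C + D) * norm x)" by (simp add: algebra_simps exp_add)
    finally show "\<bar>f x * g x\<bar> \<le> (C * D) * exp ((C + D) * norm x)" .
  qed
qed

lemma subexponential_const: "subexponential (\<lambda>_. c)"
  by (rule subexponentialI[of _ "\<bar>c\<bar>" 0]) simp

lemma subexponential_cmult: "subexponential f \<Longrightarrow> subexponential (\<lambda>x. c * f x)"
  by (intro subexponential_mult subexponential_const)

lemma subexponential_sum:
  assumes "\<And>i. i \<in> S \<Longrightarrow> subexponential (f i)"
  shows "subexponential (\<lambda>x. \<Sum>i\<in>S. f i x)"
  using assms
  by (induction S rule: infinite_finite_induct) (auto intro!: subexponential_add subexponential_const)

lemma subexponential_coord: "subexponential (\<lambda>x :: real^'d. x $ k)"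
proof (rule subexponentialI)
  fix x :: "real^'d"
  have "\<bar>x $ k\<bar> \<le> 1 + 1 * norm x" using component_le_norm_cart[of x k] by simp
  also have "\<dots> \<le> exp (1 * norm x)" by (metis exp_ge_add_one_self)
  finally show "\<bar>x $ k\<bar> \<le> 1 * exp (1 * norm x)" by simp
qed

lemma subexponential_compose_linear:
  assumes "subexponential f"
  shows "subexponential (\<lambda>x. f (A *v x))" 
proof -
  obtain C where C: "0 \<le> C" "\<And>x. \<bar>f x\<bar> \<le> C * exp (C * norm x)"
    using assms by (auto elim!: subexponentialE)
  have "norm (A *v x) \<le> onorm ((*v) A) * norm x" for x
    by (rule onorm) simp
  then have "C * exp (C * norm (A *v x)) \<le> C * exp (C * onorm ((*v) A) * norm x)" for x
    using C(1) by (intro mult_left_mono) (auto simp: mult.assoc intro!: mult_left_mono)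
  then show ?thesis using C(2) by (intro subexponentialI) (rule order_trans)
qed

text \<open>Differentiability along every line, with a derivative linear in the direction. Mere
  existence of the partial derivatives would not survive composition with a linear map, which
  \<open>E \<tau>\<close> makes necessary.\<close>

definition dir_diff :: "('d::finite rvec \<Rightarrow> real) \<Rightarrow> bool" where
  "dir_diff f \<longleftrightarrow> (\<forall>x v. ((\<lambda>\<delta>. f (x + \<delta> *\<^sub>R v)) has_real_derivative (\<Sum>i\<in>UNIV. v $ i * partial i f x)) (at 0))"

lemma sum_axis: "(\<Sum>j\<in>UNIV. axis i (1::real) $ j * g j) = g i"
  by (simp add: axis_def if_distrib[of "\<lambda>x. x * _"] cong: if_cong)

lemma dir_diffI:
  assumes "\<And>x v. ((\<lambda>\<delta>. f (x + \<delta> *\<^sub>R v)) has_real_derivative (\<Sum>i\<in>UNIV. v $ i * f' i x)) (at 0)"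
  shows "dir_diff f" and "partial i f = f' i"
proof -
  have p: "partial i f = f' i" for i
    unfolding partial_def fun_eq_iff using DERIV_imp_deriv[OF assms[of _ "axis i 1"]] by (simp add: sum_axis)
  show "partial i f = f' i" by (rule p)
  show "dir_diff f" unfolding dir_diff_def p using assms by blast
qed

lemma dir_diffD:
  assumes "dir_diff f"
  shows "((\<lambda>\<delta>. f (x + \<delta> *\<^sub>R v)) has_real_derivative (\<Sum>i\<in>UNIV. v $ i * partial i f (x + \<delta>0 *\<^sub>R v))) (at \<delta>0)"
proof -
  have "((\<lambda>\<delta>. f ((x + \<delta>0 *\<^sub>R v) + \<delta> *\<^sub>R v)) has_real_derivative (\<Sum>i\<in>UNIV. v $ i * partial i f (x + \<delta>0 *\<^sub>R v))) (at 0)"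
    using assms unfolding dir_diff_def by blast
  then show ?thesis
    using DERIV_shift[of "\<lambda>\<delta>. f (x + \<delta> *\<^sub>R v)" _ 0 \<delta>0] by (simp add: algebra_simps)
qed

lemma dir_diff_add:
  assumes "dir_diff f" "dir_diff g"
  shows "dir_diff (\<lambda>x. f x + g x)" "partial i (\<lambda>x. f x + g x) = (\<lambda>x. partial i f x + partial i g x)"
proof -
  have *: "((\<lambda>\<delta>. f (x + \<delta> *\<^sub>R v) + g (x + \<delta> *\<^sub>R v)) has_real_derivative
      (\<Sum>i\<in>UNIV. v $ i * (partial i f x + partial i g x))) (at 0)" for x v
    using DERIV_add[OF dir_diffD[OF assms(1), of x v 0] dir_diffD[OF assms(2), of x v 0]]
    by (simp add: algebra_simps sum.distrib)
  show "dir_diff (\<lambda>x. f x + g x)" "partial i (\<lambda>x. f x + g x) = (\<lambda>x. partial i f x + partial i g x)"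
    using dir_diffI[where f="\<lambda>x. f x + g x" and f'="\<lambda>i x. partial i f x + partial i g x", OF *] by auto
qed

lemma dir_diff_cmult:
  assumes "dir_diff f"
  shows "dir_diff (\<lambda>x. c * f x)" "partial i (\<lambda>x. c * f x) = (\<lambda>x. c * partial i f x)"
proof -
  have *: "((\<lambda>\<delta>. c * f (x + \<delta> *\<^sub>R v)) has_real_derivative (\<Sum>i\<in>UNIV. v $ i * (c * partial i f x))) (at 0)" for x v
    using DERIV_cmult[OF dir_diffD[OF assms(1), of x v 0], of c] by (simp add: sum_distrib_left mult_ac)
  show "dir_diff (\<lambda>x. c * f x)" "partial i (\<lambda>x. c * f x) = (\<lambda>x. c * partial i f x)"
    using dir_diffI[where f="\<lambda>x. c * f x" and f'="\<lambda>i x. c * partial i f x", OF *] by auto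
qed

lemma dir_diff_coord_mult:
  assumes "dir_diff f"
  shows "dir_diff (\<lambda>x. x $ k * f x)" 
    "partial i (\<lambda>x. x $ k * f x) = (\<lambda>x. of_bool (i = k) * f x + x $ k * partial i f x)"
proof -
  have *: "((\<lambda>\<delta>. (x + \<delta> *\<^sub>R v) $ k * f (x + \<delta> *\<^sub>R v)) has_real_derivative
     (\<Sum>i\<in>UNIV. v $ i * (of_bool (i = k) * f x + x $ k * partial i f x))) (at 0)" for x v
  proof -
    have "((\<lambda>\<delta>. (x + \<delta> *\<^sub>R v) $ k) has_real_derivative v $ k) (at 0)"
      by (auto intro!: derivative_eq_intros)
    from DERIV_mult[OF this dir_diffD[OF assms(1), of x v 0]]
    have "((\<lambda>\<delta>. (x + \<delta> *\<^sub>R v) $ k * f (x + \<delta> *\<^sub>R v)) has_real_derivative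
       v $ k * f x + (\<Sum>i\<in>UNIV. v $ i * partial i f x) * x $ k) (at 0)" by simp
    also have "v $ k * f x + (\<Sum>i\<in>UNIV. v $ i * partial i f x) * x $ k = 
       (\<Sum>i\<in>UNIV. v $ i * (of_bool (i = k) * f x + x $ k * partial i f x))"
    proof -
      have "(\<Sum>i\<in>UNIV. v $ i * (of_bool (i = k) * f x)) = (\<Sum>i\<in>UNIV. if i = k then v $ k * f x else 0)"
        by (intro sum.cong) auto
      then have "(\<Sum>i\<in>UNIV. v $ i * (of_bool (i = k) * f x)) = v $ k * f x"
        by simp
      then show ?thesis
        by (simp add: distrib_left sum.distrib sum_distrib_left sum_distrib_right mult_ac)
    qed
    finally show ?thesis .
  qed
  show "dir_diff (\<lambda>x. x $ k * f x)" 
    "partial i (\<lambda>x. x $ k * f x) = (\<lambda>x. of_bool (i = k) * f x + x $ k * partial i f x)"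
    using dir_diffI[where f="\<lambda>x. x $ k * f x" and f'="\<lambda>i x. of_bool (i = k) * f x + x $ k * partial i f x", OF *] by auto
qed

lemma dir_diff_compose_linear:
  assumes "dir_diff f"
  shows "dir_diff (\<lambda>x. f (A *v x))" 
    "partial k (\<lambda>x. f (A *v x)) = (\<lambda>x. \<Sum>i\<in>UNIV. A $ i $ k * partial i f (A *v x))"
proof -
  have *: "((\<lambda>\<delta>. f (A *v (x + \<delta> *\<^sub>R v))) has_real_derivative
     (\<Sum>k\<in>UNIV. v $ k * (\<Sum>i\<in>UNIV. A $ i $ k * partial i f (A *v x)))) (at 0)" for x v
  proof -
    have "(\<Sum>i\<in>UNIV. (A *v v) $ i * partial i f (A *v x)) =
       (\<Sum>k\<in>UNIV. v $ k * (\<Sum>i\<in>UNIV. A $ i $ k * partial i f (A *v x)))"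
      unfolding matrix_vector_mult_def
      by (simp add: sum_distrib_left sum_distrib_right mult_ac) (rule sum.swap)
    then show ?thesis
      using dir_diffD[OF assms(1), of "A *v x" "A *v v" 0]
      by (simp add: algebra_simps)
  qed
  show "dir_diff (\<lambda>x. f (A *v x))" 
    "partial k (\<lambda>x. f (A *v x)) = (\<lambda>x. \<Sum>i\<in>UNIV. A $ i $ k * partial i f (A *v x))"
    using dir_diffI[where f="\<lambda>x. f (A *v x)" and f'="\<lambda>k x. \<Sum>i\<in>UNIV. A $ i $ k * partial i f (A *v x)", OF *] by auto
qed

text \<open>Measurability is demanded at every order because differentiability along lines does not
  imply continuity. Recursion on the order lets each closure property be proved by
  induction.\<close>

primrec smooth_upto :: "nat \<Rightarrow> ('d::finite rvec \<Rightarrow> real) \<Rightarrow> bool" where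
  "smooth_upto 0 f \<longleftrightarrow> f \<in> borel_measurable borel \<and> subexponential f"
| "smooth_upto (Suc n) f \<longleftrightarrow> f \<in> borel_measurable borel \<and> subexponential f \<and> dir_diff f \<and> (\<forall>i. smooth_upto n (partial i f))"

lemma smooth_upto_basic: "smooth_upto n f \<Longrightarrow> f \<in> borel_measurable borel \<and> subexponential f"
  by (cases n) auto

lemma smooth_upto_Suc: "smooth_upto (Suc n) f \<Longrightarrow> smooth_upto n f"
  by (induction n arbitrary: f) auto

lemma smooth_upto_add: "smooth_upto n f \<Longrightarrow> smooth_upto n g \<Longrightarrow> smooth_upto n (\<lambda>x. f x + g x)"
  by (induction n arbitrary: f g) (auto simp: subexponential_add dir_diff_add)

lemma smooth_upto_cmult: "smooth_upto n f \<Longrightarrow> smooth_upto n (\<lambda>x. c * f x)"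
  by (induction n arbitrary: f) (auto simp: subexponential_cmult dir_diff_cmult)

lemma smooth_upto_const: "smooth_upto n (\<lambda>_ :: real^'d. c)"
proof (induction n arbitrary: c)
  case (Suc n)
  have "dir_diff (\<lambda>_ :: real^'d. c)" "partial i (\<lambda>_. c) = (\<lambda>_. 0)" for i :: 'd
    using dir_diffI[of "\<lambda>_. c" "\<lambda>_ _. 0"] by auto
  then show ?case using Suc subexponential_const by auto
qed (use subexponential_const in auto)

lemma smooth_upto_sum: "(\<And>i. i \<in> S \<Longrightarrow> smooth_upto n (f i)) \<Longrightarrow> smooth_upto n (\<lambda>x. \<Sum>i\<in>S. f i x)"
  by (induction S rule: infinite_finite_induct) (auto intro: smooth_upto_add smooth_upto_const)

lemma measurable_coord [measurable]: "(\<lambda>x::real^'d. x $ k) \<in> borel_measurable borel"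
  by (intro borel_measurable_continuous_onI continuous_intros)

lemma measurable_matrix_vector [measurable]: "(\<lambda>x::real^'d. (A :: real^'d^'n) *v x) \<in> borel \<rightarrow>\<^sub>M borel"
  by (intro borel_measurable_continuous_onI linear_continuous_on) auto

lemma smooth_upto_coord_mult: "smooth_upto n f \<Longrightarrow> smooth_upto n (\<lambda>x. x $ k * f x)"
proof (induction n arbitrary: f)
  case (Suc n)
  then show ?case
    using smooth_upto_Suc[OF Suc.prems]
    by (auto simp: dir_diff_coord_mult
        intro!: subexponential_mult subexponential_coord smooth_upto_add smooth_upto_cmult)
qed (auto intro: subexponential_mult subexponential_coord)

lemma smooth_upto_compose_linear: "smooth_upto n f \<Longrightarrow> smooth_upto n (\<lambda>x. f (A *v x))"
proof (induction n arbitrary: f)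
  case 0
  then show ?case using measurable_compose[OF measurable_matrix_vector] by (auto simp: subexponential_compose_linear)
next
  case (Suc n)
  then show ?case
    using measurable_compose[OF measurable_matrix_vector]
    by (auto simp: dir_diff_compose_linear subexponential_compose_linear intro!: smooth_upto_sum smooth_upto_cmult)
qed

text \<open>The common domain of all operators of the expansion. The rate of growth may depend on
  the derivative, so multiplication by coordinates and Gaussian averaging stay inside.\<close>

definition tame :: "('d::finite rvec \<Rightarrow> real) \<Rightarrow> bool" where
  "tame f \<longleftrightarrow> (\<forall>n. smooth_upto n f)"

lemma tame_measurable [measurable_dest]: "tame f \<Longrightarrow> f \<in> borel_measurable borel"
  and tame_subexponential: "tame f \<Longrightarrow> subexponential f"
  using smooth_upto_basic unfolding tame_def by blast+

lemma tame_dir_diff: "tame f \<Longrightarrow> dir_diff f"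
  and tame_partial: "tame f \<Longrightarrow> tame (partial i f)"
  using smooth_upto.simps(2) unfolding tame_def by blast+

lemma tame_add: "tame f \<Longrightarrow> tame g \<Longrightarrow> tame (\<lambda>x. f x + g x)"
  and tame_cmult: "tame f \<Longrightarrow> tame (\<lambda>x. c * f x)"
  and tame_coord_mult: "tame f \<Longrightarrow> tame (\<lambda>x. x $ k * f x)"
  and tame_compose_linear: "tame f \<Longrightarrow> tame (\<lambda>x. f (A *v x))"
  and tame_const: "tame (\<lambda>_. c)"
  unfolding tame_def
  by (auto intro: smooth_upto_add smooth_upto_cmult smooth_upto_coord_mult smooth_upto_compose_linear smooth_upto_const)

lemma tame_sum: "(\<And>i. i \<in> S \<Longrightarrow> tame (f i)) \<Longrightarrow> tame (\<lambda>x. \<Sum>i\<in>S. f i x)"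
  unfolding tame_def by (auto intro: smooth_upto_sum)

section \<open>Differentiation under the integral sign\<close>

text \<open>By the mean value inequality a bound on the derivatives for \<bar>\<delta>\<bar> < 1
  also bounds the difference quotients, and dominated convergence applies along every sequence
  tending to 0.\<close>

lemma has_derivative_integral:
  fixes h :: "real \<Rightarrow> 'a \<Rightarrow> real"
  assumes int: "\<And>\<delta>. \<bar>\<delta>\<bar> < 1 \<Longrightarrow> integrable M (h \<delta>)"
    and deriv: "\<And>\<delta> y. \<bar>\<delta>\<bar> < 1 \<Longrightarrow> ((\<lambda>\<delta>. h \<delta> y) has_real_derivative h' \<delta> y) (at \<delta>)"
    and bound: "\<And>\<delta> y. \<bar>\<delta>\<bar> < 1 \<Longrightarrow> \<bar>h' \<delta> y\<bar> \<le> w y"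
    and w: "integrable M w" and meas: "h' 0 \<in> borel_measurable M"
  shows "((\<lambda>\<delta>. \<integral>y. h \<delta> y \<partial>M) has_real_derivative (\<integral>y. h' 0 y \<partial>M)) (at 0)"
proof -
  let ?S = "{-1<..<1::real}"
  have 0: "at 0 = (at 0 within ?S)" by (rule at_within_open[symmetric]) auto
  have quot: "\<bar>(h \<delta> y - h 0 y) / \<delta>\<bar> \<le> w y" if "\<delta> \<in> ?S - {0}" for \<delta> y
  proof -
    have "norm (h \<delta> y - h 0 y) \<le> w y * norm (\<delta> - 0)"
    proof (rule field_differentiable_bound[of ?S _ "\<lambda>\<delta>. h' \<delta> y"])
      show "((\<lambda>\<delta>. h \<delta> y) has_real_derivative h' \<delta> y) (at \<delta> within ?S)" if "\<delta> \<in> ?S" for \<delta>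
        by (rule has_field_derivative_at_within[OF deriv]) (use that in auto)
      show "norm (h' \<delta> y) \<le> w y" if "\<delta> \<in> ?S" for \<delta>
        using that bound[of \<delta> y] by (auto simp: abs_less_iff)
    qed (use that in auto)
    then show ?thesis using that by (auto simp: abs_divide divide_le_eq)
  qed
  have "((\<lambda>\<delta>. ((\<integral>y. h \<delta> y \<partial>M) - (\<integral>y. h 0 y \<partial>M)) / (\<delta> - 0)) \<longlongrightarrow> (\<integral>y. h' 0 y \<partial>M)) (at 0 within ?S)"
    unfolding tendsto_at_iff_sequentially
  proof (intro allI impI)
    fix X :: "nat \<Rightarrow> real"
    assume X: "\<forall>i. X i \<in> ?S - {0}" and lim: "X \<longlonglongrightarrow> 0"
    then have X1: "\<bar>X i\<bar> < 1" "X i \<noteq> 0" for i by (auto simp: abs_less_iff)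
    have "(\<lambda>i. \<integral>y. (h (X i) y - h 0 y) / X i \<partial>M) \<longlonglongrightarrow> (\<integral>y. h' 0 y \<partial>M)"
    proof (rule integral_dominated_convergence[OF meas _ w])
      show "(\<lambda>y. (h (X i) y - h 0 y) / X i) \<in> borel_measurable M" for i
        using int[of "X i"] int[of 0] X1 by (auto dest!: borel_measurable_integrable)
      have "(\<lambda>i. (h (X i) y - h 0 y) / X i) \<longlonglongrightarrow> h' 0 y" for y
      proof -
        have "((\<lambda>\<delta>. (h \<delta> y - h 0 y) / (\<delta> - 0)) \<longlongrightarrow> h' 0 y) (at 0)"
          using deriv[of 0 y] by (simp add: has_field_derivative_iff)
        then show ?thesis
          using X1 lim unfolding tendsto_at_iff_sequentially by (auto simp: o_def)
      qed
      then show "AE y in M. (\<lambda>i. (h (X i) y - h 0 y) / X i) \<longlonglongrightarrow> h' 0 y" by simp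
      show "AE y in M. norm ((h (X i) y - h 0 y) / X i) \<le> w y" for i
        using quot[of "X i"] X by simp
    qed
    moreover have "(\<integral>y. (h (X i) y - h 0 y) / X i \<partial>M) = ((\<integral>y. h (X i) y \<partial>M) - (\<integral>y. h 0 y \<partial>M)) / X i" for i
      using int X1 by simp
    ultimately show "((\<lambda>\<delta>. ((\<integral>y. h \<delta> y \<partial>M) - (\<integral>y. h 0 y \<partial>M)) / (\<delta> - 0)) \<circ> X) \<longlonglongrightarrow> (\<integral>y. h' 0 y \<partial>M)"
      using X1 by (simp add: o_def)
  qed
  then show ?thesis unfolding 0[symmetric] has_field_derivative_iff .
qed

section \<open>Convolution with a Gaussian kernel\<close>

text \<open>The form has a positive minimum on the compact unit sphere, and homogeneity carries it
  to all vectors.\<close>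

lemma pos_def_coercive:
  fixes Q :: "real^'d^'d"
  assumes "pos_def Q"
  obtains c where "0 < c" "\<And>w. c * (norm w)\<^sup>2 \<le> (Q *v w) \<bullet> w"
proof -
  have "continuous_on (sphere 0 1) (\<lambda>w. (Q *v w) \<bullet> w)"
    by (intro continuous_intros linear_continuous_on) auto
  then obtain u where u: "u \<in> sphere 0 1" "\<And>w. w \<in> sphere 0 1 \<Longrightarrow> (Q *v u) \<bullet> u \<le> (Q *v w) \<bullet> w"
    using continuous_attains_inf[of "sphere (0::real^'d) 1" "\<lambda>w. (Q *v w) \<bullet> w"] by force
  show thesis
  proof
    have "u \<noteq> 0" using u by auto
    then show "0 < (Q *v u) \<bullet> u" using assms unfolding pos_def_def by blast
    fix w :: "real^'d"
    show "(Q *v u) \<bullet> u * (norm w)\<^sup>2 \<le> (Q *v w) \<bullet> w"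
    proof (cases "w = 0")
      case False
      then have "(Q *v u) \<bullet> u \<le> (Q *v ((1 / norm w) *\<^sub>R w)) \<bullet> ((1 / norm w) *\<^sub>R w)"
        by (intro u(2)) simp
      also have "\<dots> = ((Q *v w) \<bullet> w) / (norm w)\<^sup>2"
        by (simp add: matrix_vector_mult_scaleR power2_eq_square)
      finally show ?thesis using False by (simp add: field_simps)
    qed simp
  qed
qed

lemma integrable_gaussian:
  assumes "0 < c"
  shows "integrable lborel (\<lambda>y :: real^'d. exp (- c * (norm y)\<^sup>2))"
proof -
  have mat: "(mat (2 * c) :: real^'d^'d) *v y = (2 * c) *\<^sub>R y" for y
    by (simp add: matrix_vector_mult_def mat_def vec_eq_iff if_distrib[of "\<lambda>x. x * _"] cong: if_cong)
  have "pos_def (mat (2 * c) :: real^'d^'d)"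
    using assms by (simp add: pos_def_def mat)
  from gaussian_integral(2)[OF this] show ?thesis
    by (auto simp: mat power2_norm_eq_inner dest: integrable.intros)
qed

text \<open>Moving the centre within a ball and multiplying by an exponential costs no more than
  half of the Gaussian rate and a constant that is uniform over the ball.\<close>

lemma gaussian_domination:
  assumes c: "0 < c" and R: "0 \<le> R" and A: "0 \<le> A"
  obtains K where "0 \<le> K" 
    "\<And>y v :: 'a::real_inner. norm v \<le> R \<Longrightarrow> exp (- c * (norm (y - v))\<^sup>2) * exp (A * norm y) \<le> K * exp (- (c / 2) * (norm y)\<^sup>2)"
proof
  \<comment> \<open>\<open>D\<close> is the total coefficient of norm y in the exponent: 2 c R from
    the mixed term of the square and A from the exponential. The maximum of D n - c n^2 / 2 over n
    is D^2 / (2 c), hence the constant.\<close>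
  define D where "D = 2 * c * R + A"
  show "0 \<le> exp (D\<^sup>2 / (2 * c))" by simp
  fix y v :: 'a assume v: "norm v \<le> R"
  let ?n = "norm y"
  have "y \<bullet> v \<le> ?n * R"
    using norm_cauchy_schwarz[of y v] v by (meson mult_left_mono norm_ge_zero order_trans)
  moreover have "(norm (y - v))\<^sup>2 = ?n\<^sup>2 - 2 * (y \<bullet> v) + (norm v)\<^sup>2"
    by (simp add: power2_norm_eq_inner inner_diff_left inner_diff_right inner_commute)
  ultimately have "?n\<^sup>2 - 2 * (?n * R) \<le> (norm (y - v))\<^sup>2"
    by (smt (verit) zero_le_power2)
  then have "c * (?n\<^sup>2 - 2 * (?n * R)) \<le> c * (norm (y - v))\<^sup>2"
    using c by simp
  moreover have "0 \<le> (c * ?n - D)\<^sup>2 / (2 * c)" using c by simp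
  then have "D * ?n - c / 2 * ?n\<^sup>2 \<le> D\<^sup>2 / (2 * c)"
    using c by (simp add: power2_diff field_simps power2_eq_square)
  ultimately have "- c * (norm (y - v))\<^sup>2 + A * ?n \<le> D\<^sup>2 / (2 * c) + - (c / 2) * ?n\<^sup>2"
    unfolding D_def by (simp add: algebra_simps)
  then show "exp (- c * (norm (y - v))\<^sup>2) * exp (A * ?n) \<le> exp (D\<^sup>2 / (2 * c)) * exp (- (c / 2) * ?n\<^sup>2)"
    unfolding exp_add[symmetric] by simp
qed

lemma lborel_integral_translation:
  fixes g :: "real^'d \<Rightarrow> real"
  shows "(\<integral>y. g (y + v) \<partial>lborel) = (\<integral>y. g y \<partial>lborel)" 
    and "integrable lborel (\<lambda>y. g (y + v)) \<longleftrightarrow> integrable lborel g"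
proof -
  have *: "distr lborel borel ((+) v) = (lborel :: (real^'d) measure)"
    by (rule lborel_distr_plus)
  show "(\<integral>y. g (y + v) \<partial>lborel) = (\<integral>y. g y \<partial>lborel)"
  proof (cases "g \<in> borel_measurable borel")
    case True
    then have "(\<integral>y. g y \<partial>distr lborel borel ((+) v)) = (\<integral>y. g (v + y) \<partial>lborel)"
      by (subst integral_distr) auto
    then show ?thesis by (simp add: * add.commute)
  next
    case False
    \<comment> \<open>Without measurability neither function is integrable, so both integrals take
      the default value 0 and the identity holds for every g.\<close>
    have "\<not> (\<lambda>y. g (y + v)) \<in> borel_measurable borel"
    proof
      assume g: "(\<lambda>y. g (y + v)) \<in> borel_measurable borel"
      have "(\<lambda>y. y - v) \<in> borel \<rightarrow>\<^sub>M borel" by simp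
      from measurable_compose[OF this g] False show False by simp
    qed
    then have "\<not> integrable lborel (\<lambda>y. g (y + v))" "\<not> integrable lborel g"
      using False borel_measurable_integrable by fastforce+
    then show ?thesis by (simp add: not_integrable_integral_eq)
  qed
  show "integrable lborel (\<lambda>y. g (y + v)) \<longleftrightarrow> integrable lborel g"
  proof
    assume i: "integrable lborel g"
    then have "integrable (distr lborel borel ((+) v)) g" by (simp add: *)
    then have "integrable lborel (\<lambda>y. g (v + y))"
      using i by (subst (asm) integrable_distr_eq) (auto dest!: borel_measurable_integrable)
    then show "integrable lborel (\<lambda>y. g (y + v))" by (simp add: add.commute)
  next
    assume i: "integrable lborel (\<lambda>y. g (y + v))"
    then have "integrable (distr lborel borel ((+) (- v))) (\<lambda>y. g (y + v))" by (simp add: lborel_distr_plus)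
    then have "integrable lborel (\<lambda>y. g ((- v + y) + v))"
      using i by (subst (asm) integrable_distr_eq) (auto dest!: borel_measurable_integrable)
    then show "integrable lborel g" by simp
  qed
qed

text \<open>The factor \<open>\<kappa>\<close> is left free: the rules for derivatives and
  coordinates are homogeneous in the kernel, and the normalisation matters for the semigroup
  law.\<close>

locale gaussian_kernel =
  fixes Q :: "real^'d^'d" and \<kappa> :: real
  assumes Q: "pos_def Q"
begin

definition k :: "real^'d \<Rightarrow> real" where
  "k w = \<kappa> * exp (- (1/2) * ((Q *v w) \<bullet> w))"

definition J :: "(real^'d \<Rightarrow> real) \<Rightarrow> real^'d \<Rightarrow> real" where
  "J f v = (\<integral>y. k (y - v) * f y \<partial>lborel)"

lemma k_measurable [measurable]: "k \<in> borel_measurable borel"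
  unfolding k_def
  by (intro borel_measurable_continuous_onI continuous_intros linear_continuous_on) auto

lemma k_bound:
  obtains c where "0 < c" "\<And>w. \<bar>k w\<bar> \<le> \<bar>\<kappa>\<bar> * exp (- c * (norm w)\<^sup>2)"
proof -
  obtain c where c: "0 < c" "\<And>w. c * (norm w)\<^sup>2 \<le> (Q *v w) \<bullet> w"
    using pos_def_coercive[OF Q] by metis
  show thesis
  proof (rule that[of "c / 2"])
    fix w
    show "\<bar>k w\<bar> \<le> \<bar>\<kappa>\<bar> * exp (- (c / 2) * (norm w)\<^sup>2)"
      unfolding k_def abs_mult using c(2)[of w] by (intro mult_left_mono) auto
  qed (use c in simp)
qed

text \<open>A single majorant for all centres v in a ball, as differentiation with respect to the
  centre requires. The factor g is meant for the linear function that a derivative of the kernel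
  produces.\<close>

lemma kernel_dominated:
  assumes "subexponential f" "subexponential g" "0 \<le> R"
  obtains W where "integrable lborel W" 
    "\<And>y v. norm v \<le> R \<Longrightarrow> \<bar>k (y - v) * g (y - v) * f y\<bar> \<le> W y"
proof -
  obtain c where c: "0 < c" "\<And>w. \<bar>k w\<bar> \<le> \<bar>\<kappa>\<bar> * exp (- c * (norm w)\<^sup>2)"
    using k_bound by metis
  obtain C where C: "0 \<le> C" "\<And>x. \<bar>f x\<bar> \<le> C * exp (C * norm x)"
    using assms(1) by (rule subexponentialE) blast
  obtain D where D: "0 \<le> D" "\<And>x. \<bar>g x\<bar> \<le> D * exp (D * norm x)"
    using assms(2) by (rule subexponentialE) blast
  obtain K where K: "0 \<le> K" 
    "\<And>y v :: real^'d. norm v \<le> R \<Longrightarrow> exp (- c * (norm (y - v))\<^sup>2) * exp ((C + D) * norm y) \<le> K * exp (- (c / 2) * (norm y)\<^sup>2)"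
    using gaussian_domination[of c R "C + D"] c(1) assms(3) C(1) D(1) by (metis add_nonneg_nonneg)
  show thesis
  proof (rule that[of "\<lambda>y. \<bar>\<kappa>\<bar> * D * exp (D * R) * C * (K * exp (- (c / 2) * (norm y)\<^sup>2))"])
    show "integrable lborel (\<lambda>y::real^'d. \<bar>\<kappa>\<bar> * D * exp (D * R) * C * (K * exp (- (c / 2) * (norm y)\<^sup>2)))"
      by (intro integrable_mult_right integrable_gaussian) (use c in auto)
    fix y v :: "real^'d" assume v: "norm v \<le> R"
    have "norm (y - v) \<le> norm y + R" using norm_triangle_ineq4[of y v] v by linarith
    then have "D * norm (y - v) \<le> D * norm y + D * R" 
      using D(1) by (metis distrib_left mult_left_mono)
    then have g: "\<bar>g (y - v)\<bar> \<le> D * (exp (D * R) * exp (D * norm y))"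
      using D(2)[of "y - v"] D(1) unfolding exp_add[symmetric]
      by (smt (verit) exp_le_cancel_iff mult_left_mono)
    have "\<bar>k (y - v) * g (y - v) * f y\<bar> \<le> 
       (\<bar>\<kappa>\<bar> * exp (- c * (norm (y - v))\<^sup>2)) * (D * (exp (D * R) * exp (D * norm y))) * (C * exp (C * norm y))"
      unfolding abs_mult using c(2)[of "y - v"] g C(2)[of y] by (intro mult_mono) (auto simp: D C)
    also have "\<dots> = \<bar>\<kappa>\<bar> * D * exp (D * R) * C * (exp (- c * (norm (y - v))\<^sup>2) * exp ((C + D) * norm y))"
      by (simp add: algebra_simps exp_add)
    also have "\<dots> \<le> \<bar>\<kappa>\<bar> * D * exp (D * R) * C * (K * exp (- (c / 2) * (norm y)\<^sup>2))"
      using K(2)[OF v, of y] C(1) D(1) by (intro mult_left_mono) auto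
    finally show "\<bar>k (y - v) * g (y - v) * f y\<bar> \<le> \<bar>\<kappa>\<bar> * D * exp (D * R) * C * (K * exp (- (c / 2) * (norm y)\<^sup>2))" .
  qed
qed

lemma kernel_integrable:
  assumes "f \<in> borel_measurable borel" "subexponential f" "g \<in> borel_measurable borel" "subexponential g" 
  shows "integrable lborel (\<lambda>y. k (y - v) * g (y - v) * f y)"
proof -
  obtain W where W: "integrable lborel W" "\<And>y. \<bar>k (y - v) * g (y - v) * f y\<bar> \<le> W y"
    by (rule kernel_dominated[OF assms(2,4), of "norm v"]) auto
  show ?thesis
    by (rule Bochner_Integration.integrable_bound[OF W(1)]) (use assms W(2) in \<open>auto intro: order_trans[OF _ abs_ge_self]\<close>)
qed

lemma J_integrable:
  assumes "f \<in> borel_measurable borel" "subexponential f"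
  shows "integrable lborel (\<lambda>y. k (y - v) * f y)"
  using kernel_integrable[OF assms, of "\<lambda>_. 1" v] by (simp add: subexponential_const)

lemma J_add:
  assumes "f \<in> borel_measurable borel" "subexponential f" "g \<in> borel_measurable borel" "subexponential g"
  shows "J (\<lambda>x. f x + g x) v = J f v + J g v"
  unfolding J_def using J_integrable[OF assms(1,2)] J_integrable[OF assms(3,4)] by (simp add: distrib_left)

lemma J_cmult: "J (\<lambda>x. c * f x) v = c * J f v"
  unfolding J_def by (simp add: mult.left_commute)

lemma J_translate: "J f v = (\<integral>w. k w * f (w + v) \<partial>lborel)"
  using lborel_integral_translation(1)[of "\<lambda>y. k (y - v) * f y" v] by (simp add: J_def)

lemma J_measurable [measurable]: 
  assumes [measurable]: "f \<in> borel_measurable borel"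
  shows "J f \<in> borel_measurable borel"
  unfolding J_def by measurable

text \<open>After translation the growth of f at w + v splits into a factor in w, absorbed by the
  Gaussian, and a factor exp(C norm v) that leaves the integral.\<close>

lemma J_subexponential:
  assumes "f \<in> borel_measurable borel" "subexponential f"
  shows "subexponential (J f)"
proof -
  obtain C where C: "0 \<le> C" "\<And>x. \<bar>f x\<bar> \<le> C * exp (C * norm x)"
    using assms(2) by (rule subexponentialE) blast
  let ?h = "\<lambda>w :: real^'d. \<bar>k w\<bar> * exp (C * norm w)"
  have int: "integrable lborel ?h"
  proof -
    have "integrable lborel (\<lambda>y. k (y - 0) * exp (C * norm y))"
      by (rule J_integrable) (auto intro!: subexponentialI[of _ 1 C])
    then show ?thesis using integrable_norm by (fastforce simp: abs_mult)
  qed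
  show ?thesis
  proof (rule subexponentialI[of _ "C * (\<integral>w. ?h w \<partial>lborel)" C])
    fix v
    have "\<bar>k w * f (w + v)\<bar> \<le> (C * exp (C * norm v)) * ?h w" for w
    proof -
      have "\<bar>f (w + v)\<bar> \<le> C * exp (C * norm (w + v))" by (rule C)
      also have "\<dots> \<le> C * exp (C * norm w + C * norm v)"
        using C(1) norm_triangle_ineq[of w v] by (intro mult_left_mono) (auto simp: distrib_left[symmetric] intro!: mult_left_mono)
      finally have "\<bar>k w\<bar> * \<bar>f (w + v)\<bar> \<le> \<bar>k w\<bar> * (C * exp (C * norm w + C * norm v))"
        by (intro mult_left_mono) auto
      then show ?thesis by (simp add: abs_mult exp_add mult_ac)
    qed
    then have "\<bar>J f v\<bar> \<le> (\<integral>w. (C * exp (C * norm v)) * ?h w \<partial>lborel)"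
      unfolding J_translate
      using Bochner_Integration.integral_norm_bound_integral[of lborel "\<lambda>w. k w * f (w + v)" "\<lambda>w. (C * exp (C * norm v)) * ?h w"]
        J_integrable[OF assms, of v] lborel_integral_translation(2)[of "\<lambda>y. k (y - v) * f y" v] int
      by simp
    also have "\<dots> = (C * exp (C * norm v)) * (\<integral>w. ?h w \<partial>lborel)"
      by (rule integral_mult_right_zero)
    finally show "\<bar>J f v\<bar> \<le> C * (\<integral>w. ?h w \<partial>lborel) * exp (C * norm v)" by (simp add: mult_ac)
  qed
qed

lemma k_deriv: "((\<lambda>\<delta>. k (w - \<delta> *\<^sub>R u)) has_real_derivative ((Q *v (w - \<delta> *\<^sub>R u)) \<bullet> u) * k (w - \<delta> *\<^sub>R u)) (at \<delta>)"
proof -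
  have sym: "(Q *v x) \<bullet> y = (Q *v y) \<bullet> x" for x y
    using Q unfolding pos_def_def by (metis dot_lmul_matrix inner_commute transpose_matrix_vector)
  have "(Q *v (w - \<delta> *\<^sub>R u)) \<bullet> (w - \<delta> *\<^sub>R u) = (Q *v w) \<bullet> w - 2 * \<delta> * ((Q *v w) \<bullet> u) + \<delta>\<^sup>2 * ((Q *v u) \<bullet> u)" for \<delta>
    using sym[of w u] by (simp add: algebra_simps inner_diff_left inner_diff_right power2_eq_square)
  then have k: "k (w - \<delta> *\<^sub>R u) = \<kappa> * exp (- (1/2) * ((Q *v w) \<bullet> w - 2 * \<delta> * ((Q *v w) \<bullet> u) + \<delta>\<^sup>2 * ((Q *v u) \<bullet> u)))" for \<delta>
    by (simp add: k_def)
  show ?thesis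
    unfolding k by (auto intro!: derivative_eq_intros simp: algebra_simps inner_diff_left)
qed

text \<open>The derivative falls on the kernel, so growth and measurability of f suffice. The factor
  \<open>(Q *v (y - v)) $ i\<close> is the logarithmic derivative of the kernel in v.\<close>

lemma J_dir_diff:
  assumes f: "f \<in> borel_measurable borel" "subexponential f"
  shows "dir_diff (J f)"
    and "partial i (J f) = (\<lambda>v. \<integral>y. k (y - v) * (Q *v (y - v)) $ i * f y \<partial>lborel)"
proof -
  note [measurable] = f(1)
  have sub: "subexponential (\<lambda>w. (Q *v w) $ i)" for i
    by (rule subexponential_compose_linear) (rule subexponential_coord)
  have sub_u: "subexponential (\<lambda>w. (Q *v w) \<bullet> u)" for u
    unfolding inner_vec_def inner_real_def
    by (intro subexponential_sum subexponential_mult[OF sub subexponential_const])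
  have int: "integrable lborel (\<lambda>y. k (y - v) * (Q *v (y - v)) $ i * f y)" for v i
    by (rule kernel_integrable[OF f]) (auto intro: sub)
  have *: "((\<lambda>\<delta>. J f (v + \<delta> *\<^sub>R u)) has_real_derivative
      (\<Sum>i\<in>UNIV. u $ i * (\<integral>y. k (y - v) * (Q *v (y - v)) $ i * f y \<partial>lborel))) (at 0)" for v u
  proof -
    let ?h = "\<lambda>\<delta> y. k (y - (v + \<delta> *\<^sub>R u)) * f y"
    let ?h' = "\<lambda>\<delta> y. k (y - (v + \<delta> *\<^sub>R u)) * ((Q *v (y - (v + \<delta> *\<^sub>R u))) \<bullet> u) * f y"
    obtain W where W: "integrable lborel W"
      "\<And>y v'. norm v' \<le> norm v + norm u \<Longrightarrow> \<bar>k (y - v') * ((Q *v (y - v')) \<bullet> u) * f y\<bar> \<le> W y"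
      by (rule kernel_dominated[OF f(2) sub_u[of u], of "norm v + norm u"]) auto
    have "((\<lambda>\<delta>. \<integral>y. ?h \<delta> y \<partial>lborel) has_real_derivative (\<integral>y. ?h' 0 y \<partial>lborel)) (at 0)"
    proof (rule has_derivative_integral[where w=W])
      show "integrable lborel (?h \<delta>)" for \<delta> by (rule J_integrable[OF f])
      show "((\<lambda>\<delta>. ?h \<delta> y) has_real_derivative ?h' \<delta> y) (at \<delta>)" for \<delta> y
        using DERIV_cmult_right[OF k_deriv[of "y - v" u \<delta>], of "f y"] by (simp add: algebra_simps)
      show "\<bar>?h' \<delta> y\<bar> \<le> W y" if "\<bar>\<delta>\<bar> < 1" for \<delta> y
      proof (rule W(2))
        have "norm (v + \<delta> *\<^sub>R u) \<le> norm v + \<bar>\<delta>\<bar> * norm u" using norm_triangle_ineq[of v "\<delta> *\<^sub>R u"] by simp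
        also have "\<dots> \<le> norm v + norm u" using that by (simp add: mult_left_le_one_le)
        finally show "norm (v + \<delta> *\<^sub>R u) \<le> norm v + norm u" .
      qed
    qed (use W in auto)
    moreover have "(\<integral>y. ?h' 0 y \<partial>lborel) = (\<integral>y. (\<Sum>i\<in>UNIV. u $ i * (k (y - v) * (Q *v (y - v)) $ i * f y)) \<partial>lborel)"
      by (simp add: inner_vec_def sum_distrib_left sum_distrib_right mult_ac)
    ultimately show ?thesis using int by (simp add: J_def)
  qed
  show "dir_diff (J f)"
    "partial i (J f) = (\<lambda>v. \<integral>y. k (y - v) * (Q *v (y - v)) $ i * f y \<partial>lborel)"
    using dir_diffI[where f="J f" and f'="\<lambda>i v. \<integral>y. k (y - v) * (Q *v (y - v)) $ i * f y \<partial>lborel", OF *] by auto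
qed

text \<open>Expanding the linear factor expresses the gradient through averages of f and of y_j f,
  functions of the same class. This feeds the induction in \<open>J_tame\<close>, and solved for the
  averages of y_j f it becomes \<open>J_coord\<close>.\<close>

lemma J_partial:
  assumes f: "f \<in> borel_measurable borel" "subexponential f"
  shows "partial i (J f) = (\<lambda>v. \<Sum>j\<in>UNIV. Q $ i $ j * (J (\<lambda>y. y $ j * f y) v + (-1) * (v $ j * J f v)))"
proof
  fix v
  have coord: "(\<lambda>y. y $ j * f y) \<in> borel_measurable borel" "subexponential (\<lambda>y. y $ j * f y)" for j
    using f by (auto intro: subexponential_mult subexponential_coord)
  have "partial i (J f) v = (\<integral>y. (\<Sum>j\<in>UNIV. Q $ i $ j * (k (y - v) * (y $ j * f y) + (-1) * (v $ j * (k (y - v) * f y)))) \<partial>lborel)"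
    unfolding J_dir_diff(2)[OF f]
    by (simp add: matrix_vector_mult_def sum_distrib_left sum_distrib_right algebra_simps)
  also have "\<dots> = (\<Sum>j\<in>UNIV. Q $ i $ j * (J (\<lambda>y. y $ j * f y) v + (-1) * (v $ j * J f v)))"
    using J_integrable[OF f, of v] J_integrable[OF coord, where v=v] unfolding J_def
    by (simp add: Bochner_Integration.integral_sum)
  finally show "partial i (J f) v = (\<Sum>j\<in>UNIV. Q $ i $ j * (J (\<lambda>y. y $ j * f y) v + (-1) * (v $ j * J f v)))" .
qed

lemma J_tame:
  assumes f: "f \<in> borel_measurable borel" "subexponential f"
  shows "tame (J f)"
proof -
  have "smooth_upto n (J f)" for n
    using f
  proof (induction n arbitrary: f)
    case 0
    then show ?case by (simp add: J_subexponential J_measurable)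
  next
    case (Suc n)
    have "smooth_upto n (partial i (J f))" for i
      unfolding J_partial[OF Suc.prems]
      by (intro smooth_upto_sum smooth_upto_cmult smooth_upto_add smooth_upto_coord_mult Suc)
        (use Suc.prems in \<open>auto intro: subexponential_mult subexponential_coord\<close>)
    then show ?case using Suc.prems by (simp add: J_subexponential J_measurable J_dir_diff)
  qed
  then show ?thesis by (simp add: tame_def)
qed

text \<open>\<open>J_partial\<close> says that the gradient of J f is Q applied to the vector of
  averages of (y_j - v_j) f; multiplication by C, the inverse of Q, isolates them. This is the
  source of the gradient term in M.\<close>

lemma J_coord:
  assumes f: "f \<in> borel_measurable borel" "subexponential f" and C: "C ** Q = mat 1"
  shows "J (\<lambda>y. y $ i * f y) v = v $ i * J f v + (\<Sum>j\<in>UNIV. C $ i $ j * partial j (J f) v)"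
proof -
  define a :: "real^'d" where "a = (\<chi> j. J (\<lambda>y. y $ j * f y) v + (-1) * (v $ j * J f v))"
  have "(\<chi> j. partial j (J f) v) = Q *v a"
    unfolding J_partial[OF f] by (simp add: a_def matrix_vector_mult_def vec_eq_iff)
  then have "C *v (\<chi> j. partial j (J f) v) = a"
    by (simp add: matrix_vector_mul_assoc C)
  then have "(C *v (\<chi> j. partial j (J f) v)) $ i = a $ i" by simp
  then show ?thesis by (simp add: a_def matrix_vector_mult_def)
qed

text \<open>In the form \<open>J_translate\<close> the centre v sits in the argument of f, so that
  here the derivative falls on f, and the growth bound of its derivatives provides the
  majorant.\<close>

lemma J_partial_tame:
  assumes f: "tame f"
  shows "partial i (J f) = J (partial i f)"
proof -
  note m = tame_measurable[OF f] and s = tame_subexponential[OF f]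
  have pm: "partial i f \<in> borel_measurable borel" and ps: "subexponential (partial i f)" for i
    using f tame_measurable tame_partial tame_subexponential by blast+
  note [measurable] = m pm
  have int: "integrable lborel (\<lambda>w. k w * g (w + v))" if "g \<in> borel_measurable borel" "subexponential g" for g v
    using lborel_integral_translation(2)[of "\<lambda>y. k (y - v) * g y" v] J_integrable[OF that, of v] by simp
  have *: "((\<lambda>\<delta>. J f (v + \<delta> *\<^sub>R u)) has_real_derivative (\<Sum>i\<in>UNIV. u $ i * J (partial i f) v)) (at 0)" for v u
  proof -
    let ?h = "\<lambda>\<delta> w. k w * f (w + (v + \<delta> *\<^sub>R u))"
    let ?p = "\<lambda>x. \<Sum>i\<in>UNIV. u $ i * partial i f x"
    let ?h' = "\<lambda>\<delta> w. k w * ?p (w + (v + \<delta> *\<^sub>R u))"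
    have "subexponential ?p" by (intro subexponential_sum subexponential_cmult ps)
    then obtain C where C: "0 \<le> C" "\<And>x. \<bar>?p x\<bar> \<le> C * exp (C * norm x)"
      by (rule subexponentialE) blast
    define R where "R = norm v + norm u"
    let ?W = "\<lambda>w. \<bar>k (w - 0) * exp (C * norm w)\<bar> * (C * exp (C * R))"
    have "((\<lambda>\<delta>. \<integral>y. ?h \<delta> y \<partial>lborel) has_real_derivative (\<integral>y. ?h' 0 y \<partial>lborel)) (at 0)"
    proof (rule has_derivative_integral[where w = ?W])
      show "integrable lborel (?h \<delta>)" for \<delta> by (rule int[OF m s])
      show "((\<lambda>\<delta>. ?h \<delta> w) has_real_derivative ?h' \<delta> w) (at \<delta>)" for \<delta> w
        using DERIV_cmult[OF dir_diffD[OF tame_dir_diff[OF f], of "w + v" u \<delta>], of "k w"] by (simp add: add_ac)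
      show "integrable lborel ?W"
        by (intro integrable_mult_left integrable_abs J_integrable) (auto intro!: subexponentialI[of _ 1 C])
      show "\<bar>?h' \<delta> w\<bar> \<le> ?W w" if "\<bar>\<delta>\<bar> < 1" for \<delta> w
      proof -
        have "norm (v + \<delta> *\<^sub>R u) \<le> norm v + \<bar>\<delta>\<bar> * norm u" using norm_triangle_ineq[of v "\<delta> *\<^sub>R u"] by simp
        also have "\<dots> \<le> R" using that by (simp add: R_def mult_left_le_one_le)
        finally have "norm (w + (v + \<delta> *\<^sub>R u)) \<le> norm w + R" 
          using norm_triangle_ineq[of w "v + \<delta> *\<^sub>R u"] by linarith
        then have "C * exp (C * norm (w + (v + \<delta> *\<^sub>R u))) \<le> C * exp (C * norm w + C * R)"
          using C(1) by (intro mult_left_mono) (auto simp: distrib_left[symmetric] intro!: mult_left_mono)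
        then have "\<bar>?p (w + (v + \<delta> *\<^sub>R u))\<bar> \<le> C * exp (C * norm w + C * R)"
          using C(2) order_trans by blast
        then have "\<bar>k w\<bar> * \<bar>?p (w + (v + \<delta> *\<^sub>R u))\<bar> \<le> \<bar>k w\<bar> * (C * exp (C * norm w + C * R))"
          by (intro mult_left_mono) auto
        then show ?thesis by (simp add: abs_mult exp_add mult_ac)
      qed
    qed measurable
    moreover have "(\<integral>y. ?h' 0 y \<partial>lborel) = (\<integral>w. (\<Sum>i\<in>UNIV. u $ i * (k w * partial i f (w + v))) \<partial>lborel)"
      by (simp add: sum_distrib_left mult_ac)
    also have "\<dots> = (\<Sum>i\<in>UNIV. u $ i * J (partial i f) v)"
      using int[OF pm ps, where v=v] by (simp add: J_translate)
    finally show ?thesis by (simp add: J_translate)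
  qed
  show ?thesis
    using dir_diffI(2)[where f="J f" and f'="\<lambda>i. J (partial i f)", OF *] .
qed

end

section \<open>The Gaussian semigroup\<close>

lemma pos_def_matrix_inv:
  fixes C :: "real^'d^'d"
  assumes "pos_def C"
  shows "invertible C" "C ** matrix_inv C = mat 1" "matrix_inv C ** C = mat 1" "pos_def (matrix_inv C)"
proof -
  show inv: "invertible C"
    using gaussian_integral(1)[OF assms] by (simp add: invertible_det_nz)
  show C: "C ** matrix_inv C = mat 1" "matrix_inv C ** C = mat 1"
    using someI_ex[OF inv[unfolded invertible_def]] by (auto simp: matrix_inv_def)
  have sym: "transpose C = C" using assms by (simp add: pos_def_def)
  have "transpose (matrix_inv C) = transpose (matrix_inv C) ** (C ** matrix_inv C)" by (simp add: C)
  also have "\<dots> = transpose (C ** matrix_inv C) ** matrix_inv C"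
    by (simp add: matrix_transpose_mul sym matrix_mul_assoc)
  also have "\<dots> = matrix_inv C" by (simp add: C)
  finally have "transpose (matrix_inv C) = matrix_inv C" .
  moreover have "0 < (matrix_inv C *v w) \<bullet> w" if "w \<noteq> 0" for w
  proof -
    define u where "u = matrix_inv C *v w"
    have w: "w = C *v u" by (simp add: u_def matrix_vector_mul_assoc C)
    then have "u \<noteq> 0" using that by auto
    then have "0 < (C *v u) \<bullet> u" using assms by (simp add: pos_def_def)
    then show ?thesis by (simp add: u_def[symmetric] w[symmetric] inner_commute)
  qed
  ultimately show "pos_def (matrix_inv C)" by (simp add: pos_def_def)
qed

lemma dot_matrix_left: "(A *v x) \<bullet> y = x \<bullet> (transpose A *v y)" for A :: "real^'d^'d"
  by (metis dot_lmul_matrix inner_commute transpose_matrix_vector transpose_transpose)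

text \<open>\<open>E\<close> is a one-parameter group and \<open>C\<close> a cocycle over it.
  Neither B nor the integral defining the covariance enters below this level.\<close>

locale gaussian_semigroup =
  fixes E C :: "real \<Rightarrow> real^'d^'d"
  assumes E_0: "E 0 = mat 1" and E_add: "\<And>s t. E (s + t) = E s ** E t"
    and C_add: "\<And>s t. 0 \<le> s \<Longrightarrow> 0 \<le> t \<Longrightarrow> C (s + t) = C t + E t ** C s ** transpose (E t)"
    and C_0: "C 0 = 0" and C_pos_def: "\<And>t. 0 < t \<Longrightarrow> pos_def (C t)"
    and continuous_on_E: "continuous_on UNIV E" and continuous_on_C: "\<And>b. continuous_on {0..b} C"
begin

abbreviation Q :: "real \<Rightarrow> real^'d^'d" where "Q \<tau> \<equiv> matrix_inv (C \<tau>)"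

definition \<kappa> :: "real \<Rightarrow> real" where "\<kappa> \<tau> = 1 / sqrt ((2 * pi) ^ CARD('d) * det (C \<tau>))"

abbreviation heat :: "real \<Rightarrow> real^'d \<Rightarrow> real" where "heat \<tau> \<equiv> gaussian_kernel.k (Q \<tau>) (\<kappa> \<tau>)"

abbreviation J :: "real \<Rightarrow> (real^'d \<Rightarrow> real) \<Rightarrow> real^'d \<Rightarrow> real" where "J \<tau> \<equiv> gaussian_kernel.J (Q \<tau>) (\<kappa> \<tau>)"

text \<open>Transition operator of the linear diffusion: the average of f under the Gaussian law
  with mean \<open>E \<tau> *v x\<close> and covariance \<open>C \<tau>\<close>.\<close>

definition P :: "real \<Rightarrow> (real^'d \<Rightarrow> real) \<Rightarrow> real^'d \<Rightarrow> real" where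
  "P \<tau> f x = J \<tau> f (E \<tau> *v x)"

definition Gr :: "real \<Rightarrow> 'd \<Rightarrow> (real^'d \<Rightarrow> real) \<Rightarrow> real^'d \<Rightarrow> real" where
  "Gr \<sigma> i g x = (\<Sum>k\<in>UNIV. transpose (E (- \<sigma>)) $ i $ k * partial k g x)"

definition Mo :: "real \<Rightarrow> 'd \<Rightarrow> (real^'d \<Rightarrow> real) \<Rightarrow> real^'d \<Rightarrow> real" where
  "Mo \<sigma> i g x = (\<Sum>j\<in>UNIV. E \<sigma> $ i $ j *
     (x $ j * g x + (\<Sum>k\<in>UNIV. (E (- \<sigma>) ** C \<sigma> ** transpose (E (- \<sigma>))) $ j $ k * partial k g x)))"

lemma E_inverse: "E \<sigma> ** E (- \<sigma>) = mat 1" "E (- \<sigma>) ** E \<sigma> = mat 1"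
  using E_add[of \<sigma> "- \<sigma>"] E_add[of "- \<sigma>" \<sigma>] by (simp_all add: E_0)

lemma kernel: "0 < \<tau> \<Longrightarrow> gaussian_kernel (Q \<tau>)"
  by (simp add: gaussian_kernel_def pos_def_matrix_inv C_pos_def)

lemma det_C: "0 < \<tau> \<Longrightarrow> 0 < det (C \<tau>)"
  using gaussian_integral(1)[OF C_pos_def] .

lemma heat_eq: "0 < \<tau> \<Longrightarrow> heat \<tau> w = \<kappa> \<tau> * exp (- (1/2) * ((Q \<tau> *v w) \<bullet> w))"
  using gaussian_kernel.k_def[OF kernel] .

lemma heat_nonneg: "0 < \<tau> \<Longrightarrow> 0 \<le> heat \<tau> w"
  using det_C[of \<tau>] unfolding heat_eq by (simp add: \<kappa>_def)

lemma P_add: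
  assumes "0 < \<tau>" "tame f" "tame g"
  shows "P \<tau> (\<lambda>x. f x + g x) = (\<lambda>x. P \<tau> f x + P \<tau> g x)"
  using gaussian_kernel.J_add[OF kernel] assms
  by (simp add: P_def fun_eq_iff tame_measurable tame_subexponential)

lemma P_cmult: "0 < \<tau> \<Longrightarrow> P \<tau> (\<lambda>x. c * f x) = (\<lambda>x. c * P \<tau> f x)"
  using gaussian_kernel.J_cmult[OF kernel] by (simp add: P_def fun_eq_iff)

lemma P_sum:
  assumes \<tau>: "0 < \<tau>" and f: "\<And>i. i \<in> S \<Longrightarrow> tame (f i)"
  shows "P \<tau> (\<lambda>x. \<Sum>i\<in>S. f i x) = (\<lambda>x. \<Sum>i\<in>S. P \<tau> (f i) x)"
proof -
  have 0: "P \<tau> (\<lambda>_. 0) = (\<lambda>_. 0)" using P_cmult[OF \<tau>, of 0 "\<lambda>_. 0"] by simp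
  show ?thesis using f
    by (induction S rule: infinite_finite_induct) (simp_all add: 0 P_add[OF \<tau>] tame_sum)
qed

lemma P_tame:
  assumes "0 < \<tau>" "f \<in> borel_measurable borel" "subexponential f"
  shows "tame (P \<tau> f)"
  unfolding P_def using tame_compose_linear[OF gaussian_kernel.J_tame[OF kernel[OF assms(1)] assms(2,3)], of "\<kappa> \<tau>" "E \<tau>"] .

text \<open>By the chain rule the gradient of P f is \<open>transpose (E \<tau>)\<close> applied to
  the averages of the gradient of f; \<open>transpose (E (- \<tau>))\<close> inverts this
  matrix.\<close>

lemma grad_P:
  assumes \<tau>: "0 < \<tau>" and f: "tame f"
  shows "(\<chi> i. P \<tau> (partial i f) x) = transpose (E (- \<tau>)) *v (\<chi> k. partial k (P \<tau> f) x)"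
proof -
  have "dir_diff (J \<tau> f)"
    by (rule gaussian_kernel.J_dir_diff[OF kernel[OF \<tau>] tame_measurable[OF f] tame_subexponential[OF f]])
  then have "partial k (P \<tau> f) x = (\<Sum>i\<in>UNIV. E \<tau> $ i $ k * P \<tau> (partial i f) x)" for k
    unfolding P_def[abs_def]
    by (simp add: dir_diff_compose_linear(2) gaussian_kernel.J_partial_tame[OF kernel[OF \<tau>] f])
  then have "(\<chi> k. partial k (P \<tau> f) x) = transpose (E \<tau>) *v (\<chi> i. P \<tau> (partial i f) x)"
    by (simp add: vec_eq_iff matrix_vector_mult_def transpose_def)
  then show ?thesis
    by (simp add: matrix_vector_mul_assoc matrix_transpose_mul[symmetric] E_inverse)
qed

lemma Gr_tame: "tame f \<Longrightarrow> tame (Gr \<sigma> i f)"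
  unfolding Gr_def by (intro tame_sum tame_cmult tame_partial)

lemma Gr_eq: "Gr \<sigma> i g x = (transpose (E (- \<sigma>)) *v (\<chi> k. partial k g x)) $ i"
  by (simp add: Gr_def matrix_vector_mult_def)

lemma P_Gr:
  assumes \<tau>: "0 < \<tau>" and f: "tame f"
  shows "P \<tau> (Gr \<sigma> i f) = Gr (\<sigma> + \<tau>) i (P \<tau> f)"
proof
  fix x
  have "P \<tau> (Gr \<sigma> i f) x = (transpose (E (- \<sigma>)) *v (\<chi> k. P \<tau> (partial k f) x)) $ i"
    unfolding Gr_def using f
    by (subst P_sum[OF \<tau>]) (auto simp: tame_cmult tame_partial P_cmult[OF \<tau>] matrix_vector_mult_def)
  also have "\<dots> = Gr (\<sigma> + \<tau>) i (P \<tau> f) x"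
    unfolding grad_P[OF \<tau> f] Gr_eq
    by (simp add: matrix_vector_mul_assoc matrix_transpose_mul[symmetric] E_add[symmetric] minus_diff_commute)
  finally show "P \<tau> (Gr \<sigma> i f) x = Gr (\<sigma> + \<tau>) i (P \<tau> f) x" .
qed

text \<open>Multiplied out, \<open>E \<sigma>\<close> cancels against \<open>E (- \<sigma>)\<close>.
  The coordinate part and the gradient part are separated, as \<open>P_Mo\<close> and the continuity
  in the lag require.\<close>

lemma Mo_eq: "Mo \<sigma> i g x = (\<Sum>j\<in>UNIV. E \<sigma> $ i $ j * (x $ j * g x)) + 
   (\<Sum>k\<in>UNIV. (C \<sigma> ** transpose (E (- \<sigma>))) $ i $ k * partial k g x)"
proof -
  define a where "a = (\<chi> k. partial k g x)"
  have "(\<Sum>j\<in>UNIV. E \<sigma> $ i $ j * (\<Sum>k\<in>UNIV. (E (- \<sigma>) ** C \<sigma> ** transpose (E (- \<sigma>))) $ j $ k * partial k g x))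
    = (E \<sigma> *v ((E (- \<sigma>) ** C \<sigma> ** transpose (E (- \<sigma>))) *v a)) $ i"
    by (simp add: matrix_vector_mult_def a_def)
  also have "\<dots> = ((C \<sigma> ** transpose (E (- \<sigma>))) *v a) $ i"
    by (simp add: matrix_vector_mul_assoc matrix_mul_assoc E_inverse)
  finally show ?thesis
    by (simp add: Mo_def distrib_left sum.distrib a_def matrix_vector_mult_def)
qed

lemma Mo_tame: "tame f \<Longrightarrow> tame (Mo \<sigma> i f)"
  unfolding Mo_eq by (intro tame_sum tame_cmult tame_partial tame_add tame_coord_mult)

text \<open>\<open>J_coord\<close> gives the average of the coordinates as (E(\<tau>) x) P f plus
  C(\<tau>) times the averaged gradient. The gradient terms combine by E(\<sigma>) C(\<tau>) +
  C(\<sigma>) E(-\<sigma>)^T = C(\<sigma> + \<tau>) E(-\<sigma>)^T, which is the cocycle identity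
  multiplied by E(-\<sigma>)^T; \<open>grad_P\<close> supplies the missing factor
  E(-\<tau>)^T.\<close>

lemma P_Mo:
  assumes \<tau>: "0 < \<tau>" and \<sigma>: "0 \<le> \<sigma>" and f: "tame f"
  shows "P \<tau> (Mo \<sigma> i f) = Mo (\<sigma> + \<tau>) i (P \<tau> f)"
proof
  fix x
  define a where "a = (\<chi> k. P \<tau> (partial k f) x)"
  have coord: "(\<chi> j. P \<tau> (\<lambda>y. y $ j * f y) x) = P \<tau> f x *\<^sub>R (E \<tau> *v x) + C \<tau> *v a"
  proof -
    have "C \<tau> ** Q \<tau> = mat 1" by (rule pos_def_matrix_inv) (rule C_pos_def[OF \<tau>])
    from gaussian_kernel.J_coord[OF kernel[OF \<tau>] tame_measurable[OF f] tame_subexponential[OF f] this]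
    show ?thesis
      by (simp add: P_def vec_eq_iff a_def matrix_vector_mult_def gaussian_kernel.J_partial_tame[OF kernel[OF \<tau>] f])
  qed
  have "P \<tau> (Mo \<sigma> i f) x = (E \<sigma> *v (\<chi> j. P \<tau> (\<lambda>y. y $ j * f y) x) + (C \<sigma> ** transpose (E (- \<sigma>))) *v a) $ i"
    unfolding Mo_eq using f
    by (subst P_add[OF \<tau>], (intro tame_sum tame_cmult tame_partial tame_coord_mult, assumption)+)
      (subst P_sum[OF \<tau>] P_sum[OF \<tau>], auto simp: tame_cmult tame_partial tame_coord_mult P_cmult[OF \<tau>] matrix_vector_mult_def a_def P_sum[OF \<tau>])
  also have "\<dots> = P \<tau> f x * (E (\<sigma> + \<tau>) *v x) $ i + ((E \<sigma> ** C \<tau> + C \<sigma> ** transpose (E (- \<sigma>))) *v a) $ i"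
    unfolding coord
    by (simp add: matrix_vector_right_distrib matrix_vector_mult_add_rdistrib matrix_vector_mul_assoc matrix_vector_mult_scaleR E_add)
  also have "E \<sigma> ** C \<tau> + C \<sigma> ** transpose (E (- \<sigma>)) = C (\<sigma> + \<tau>) ** transpose (E (- \<sigma>))"
  proof -
    have "C (\<sigma> + \<tau>) ** transpose (E (- \<sigma>)) = C \<sigma> ** transpose (E (- \<sigma>)) + E \<sigma> ** C \<tau> ** (transpose (E \<sigma>) ** transpose (E (- \<sigma>)))"
      using C_add[of \<tau> \<sigma>] \<tau> \<sigma> by (simp add: add.commute matrix_add_rdistrib matrix_mul_assoc)
    then show ?thesis
      by (simp add: matrix_transpose_mul[symmetric] E_inverse add.commute)
  qed
  also have "(C (\<sigma> + \<tau>) ** transpose (E (- \<sigma>))) *v a = (C (\<sigma> + \<tau>) ** transpose (E (- (\<sigma> + \<tau>)))) *v (\<chi> k. partial k (P \<tau> f) x)"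
    unfolding a_def grad_P[OF \<tau> f] matrix_vector_mul_assoc matrix_mul_assoc[symmetric] matrix_transpose_mul[symmetric]
    by (simp add: E_add[symmetric] minus_diff_commute)
  also have "P \<tau> f x * (E (\<sigma> + \<tau>) *v x) $ i + \<dots> $ i = Mo (\<sigma> + \<tau>) i (P \<tau> f) x"
    by (simp add: Mo_eq matrix_vector_mult_def sum_distrib_left mult_ac)
  finally show "P \<tau> (Mo \<sigma> i f) x = Mo (\<sigma> + \<tau>) i (P \<tau> f) x" .
qed

text \<open>The Chapman-Kolmogorov identity, by completing the square in the intermediate point
  \<xi>. The exponents and the normalising constants are matched separately.\<close>

lemma heat_convolution:
  assumes \<tau>: "0 < \<tau>" and \<sigma>: "0 < \<sigma>"
  shows "(\<integral>\<xi>. heat \<tau> \<xi> * heat \<sigma> (v - E \<sigma> *v \<xi>) \<partial>lborel) = heat (\<tau> + \<sigma>) v"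
proof -
  \<comment> \<open>\<open>R\<close> is the quadratic part of the joint exponent in \<open>\<xi>\<close>, and \<open>m\<close> is where that exponent is stationary.\<close>
  define R where "R = Q \<tau> + transpose (E \<sigma>) ** Q \<sigma> ** E \<sigma>"
  note Ct = pos_def_matrix_inv[OF C_pos_def[OF \<tau>]] and Cs = pos_def_matrix_inv[OF C_pos_def[OF \<sigma>]]
  have \<tau>\<sigma>: "0 < \<tau> + \<sigma>" using \<tau> \<sigma> by simp
  note Cts = pos_def_matrix_inv[OF C_pos_def[OF \<tau>\<sigma>]]
  have C: "C (\<tau> + \<sigma>) = C \<sigma> + E \<sigma> ** C \<tau> ** transpose (E \<sigma>)"
    using C_add \<tau> \<sigma> by simp
  have symt: "(Q \<tau> *v x) \<bullet> y = (Q \<tau> *v y) \<bullet> x" and syms: "(Q \<sigma> *v x) \<bullet> y = (Q \<sigma> *v y) \<bullet> x" for x y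
    using Ct(4) Cs(4) unfolding pos_def_def by (metis dot_matrix_left inner_commute)+
  have "pos_def R"
    unfolding pos_def_def
  proof (intro conjI allI impI)
    have "transpose (A + B) = transpose A + transpose B" for A B :: "real^'d^'d"
      by (simp add: transpose_def vec_eq_iff)
    then show "transpose R = R"
      using Ct(4) Cs(4) by (simp add: R_def pos_def_def matrix_transpose_mul matrix_mul_assoc)
    fix w :: "real^'d" assume "w \<noteq> 0"
    then have "0 < (Q \<tau> *v w) \<bullet> w" using Ct(4) by (simp add: pos_def_def)
    moreover have "0 \<le> (Q \<sigma> *v (E \<sigma> *v w)) \<bullet> (E \<sigma> *v w)"
      using Cs(4) by (cases "E \<sigma> *v w = 0") (auto simp: pos_def_def intro: less_imp_le)
    ultimately show "0 < (R *v w) \<bullet> w"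
      by (simp add: R_def matrix_vector_mult_add_rdistrib inner_add_left matrix_vector_mul_assoc[symmetric] dot_matrix_left)
  qed
  note R = pos_def_matrix_inv[OF this] gaussian_integral[OF this]
  define m where "m = matrix_inv R *v (transpose (E \<sigma>) *v (Q \<sigma> *v v))"
  \<comment> \<open>Stationarity at \<open>m\<close> reads
    \<open>Q \<tau> *v m = transpose (E \<sigma>) *v w\<close>. The cocycle identity turns it into
    \<open>C (\<tau> + \<sigma>) *v w = v\<close>, which identifies the minimal exponent w \<bullet>
    v with the form of \<open>Q (\<tau> + \<sigma>)\<close> at v.\<close>
  define w where "w = Q \<sigma> *v (v - E \<sigma> *v m)"
  have "R *v m = transpose (E \<sigma>) *v (Q \<sigma> *v v)"
    by (simp add: m_def matrix_vector_mul_assoc R matrix_mul_assoc)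
  then have Qm: "Q \<tau> *v m = transpose (E \<sigma>) *v w"
    by (simp add: R_def w_def algebra_simps matrix_vector_mul_assoc[symmetric])
  have "C (\<tau> + \<sigma>) *v w = C \<sigma> *v w + E \<sigma> *v (C \<tau> *v (Q \<tau> *v m))"
    unfolding C Qm by (simp add: algebra_simps matrix_vector_mul_assoc[symmetric])
  also have "\<dots> = v"
    unfolding w_def by (simp add: matrix_vector_mul_assoc matrix_mul_assoc Ct Cs flip: matrix_vector_mul_assoc[of "E \<sigma>"])
  finally have w: "w = Q (\<tau> + \<sigma>) *v v"
    by (metis Cts(3) matrix_vector_mul_assoc matrix_vector_mul_lid)
  have square: "(Q \<tau> *v (\<eta> + m)) \<bullet> (\<eta> + m) + (Q \<sigma> *v (v - E \<sigma> *v (\<eta> + m))) \<bullet> (v - E \<sigma> *v (\<eta> + m))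
     = (R *v \<eta>) \<bullet> \<eta> + (Q (\<tau> + \<sigma>) *v v) \<bullet> v" for \<eta>
  proof -
    have "(Q \<tau> *v (\<eta> + m)) \<bullet> (\<eta> + m) = (Q \<tau> *v \<eta>) \<bullet> \<eta> + 2 * ((Q \<tau> *v m) \<bullet> \<eta>) + (Q \<tau> *v m) \<bullet> m"
      using symt[of m \<eta>] by (simp add: algebra_simps inner_add_left inner_add_right)
    also have "(Q \<tau> *v m) \<bullet> \<eta> = w \<bullet> (E \<sigma> *v \<eta>)"
      unfolding Qm by (simp add: dot_matrix_left)
    also have "(Q \<tau> *v m) \<bullet> m = w \<bullet> (E \<sigma> *v m)"
      unfolding Qm by (simp add: dot_matrix_left)
    finally have 1: "(Q \<tau> *v (\<eta> + m)) \<bullet> (\<eta> + m) = (Q \<tau> *v \<eta>) \<bullet> \<eta> + 2 * (w \<bullet> (E \<sigma> *v \<eta>)) + w \<bullet> (E \<sigma> *v m)" .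
    have "(Q \<sigma> *v (v - E \<sigma> *v (\<eta> + m))) \<bullet> (v - E \<sigma> *v (\<eta> + m)) =
       (w - Q \<sigma> *v (E \<sigma> *v \<eta>)) \<bullet> ((v - E \<sigma> *v m) - E \<sigma> *v \<eta>)"
      by (simp add: w_def algebra_simps)
    also have "\<dots> = w \<bullet> v - w \<bullet> (E \<sigma> *v m) - 2 * (w \<bullet> (E \<sigma> *v \<eta>)) + (Q \<sigma> *v (E \<sigma> *v \<eta>)) \<bullet> (E \<sigma> *v \<eta>)"
      using syms[of "E \<sigma> *v \<eta>" "v - E \<sigma> *v m"] by (simp add: inner_diff_left inner_diff_right w_def[symmetric])
    finally have 2: "(Q \<sigma> *v (v - E \<sigma> *v (\<eta> + m))) \<bullet> (v - E \<sigma> *v (\<eta> + m)) =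
      w \<bullet> v - w \<bullet> (E \<sigma> *v m) - 2 * (w \<bullet> (E \<sigma> *v \<eta>)) + (Q \<sigma> *v (E \<sigma> *v \<eta>)) \<bullet> (E \<sigma> *v \<eta>)" .
    have "(R *v \<eta>) \<bullet> \<eta> = (Q \<tau> *v \<eta>) \<bullet> \<eta> + (Q \<sigma> *v (E \<sigma> *v \<eta>)) \<bullet> (E \<sigma> *v \<eta>)"
      by (simp add: R_def matrix_vector_mult_add_rdistrib inner_add_left matrix_vector_mul_assoc[symmetric] dot_matrix_left)
    with 1 2 show ?thesis by (simp add: w)
  qed
  have "(\<integral>\<xi>. heat \<tau> \<xi> * heat \<sigma> (v - E \<sigma> *v \<xi>) \<partial>lborel) = (\<integral>\<eta>. heat \<tau> (\<eta> + m) * heat \<sigma> (v - E \<sigma> *v (\<eta> + m)) \<partial>lborel)"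
    by (rule lborel_integral_translation(1)[symmetric])
  also have "\<dots> = (\<integral>\<eta>. \<kappa> \<tau> * \<kappa> \<sigma> * exp (- (1/2) * ((Q (\<tau> + \<sigma>) *v v) \<bullet> v)) * exp (- (1/2) * ((R *v \<eta>) \<bullet> \<eta>)) \<partial>lborel)"
  proof (rule Bochner_Integration.integral_cong[OF refl])
    fix \<eta>
    have "exp (- (1/2) * ((Q \<tau> *v (\<eta> + m)) \<bullet> (\<eta> + m))) * exp (- (1/2) * ((Q \<sigma> *v (v - E \<sigma> *v (\<eta> + m))) \<bullet> (v - E \<sigma> *v (\<eta> + m)))) =
      exp (- (1/2) * ((Q (\<tau> + \<sigma>) *v v) \<bullet> v)) * exp (- (1/2) * ((R *v \<eta>) \<bullet> \<eta>))"
      unfolding exp_add[symmetric] distrib_left[symmetric] square by (simp add: add.commute)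
    then show "heat \<tau> (\<eta> + m) * heat \<sigma> (v - E \<sigma> *v (\<eta> + m)) = 
       \<kappa> \<tau> * \<kappa> \<sigma> * exp (- (1/2) * ((Q (\<tau> + \<sigma>) *v v) \<bullet> v)) * exp (- (1/2) * ((R *v \<eta>) \<bullet> \<eta>))"
      unfolding heat_eq[OF \<tau>] heat_eq[OF \<sigma>] by (metis (no_types, lifting) mult.assoc mult.left_commute)
  qed
  also have "\<dots> = \<kappa> \<tau> * \<kappa> \<sigma> * exp (- (1/2) * ((Q (\<tau> + \<sigma>) *v v) \<bullet> v)) * sqrt ((2 * pi) ^ CARD('d) / det R)"
    using R(6) by (simp only: integral_mult_right_zero has_bochner_integral_integral_eq)
  also have "\<dots> = heat (\<tau> + \<sigma>) v"
  proof -
    \<comment> \<open>This factorisation yields the determinant of \<open>R\<close> from those of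
      the three covariances, the determinants of \<open>E \<sigma>\<close> and
      \<open>E (- \<sigma>)\<close> being inverse to each other.\<close>
    have "C \<sigma> ** transpose (E (- \<sigma>)) ** R ** C \<tau> ** transpose (E \<sigma>) = C (\<tau> + \<sigma>)"
    proof -
      have "transpose (E (- \<sigma>)) ** R ** C \<tau> ** transpose (E \<sigma>) = 
          transpose (E (- \<sigma>)) ** (Q \<tau> ** C \<tau>) ** transpose (E \<sigma>) + 
          (transpose (E (- \<sigma>)) ** transpose (E \<sigma>)) ** Q \<sigma> ** E \<sigma> ** C \<tau> ** transpose (E \<sigma>)"
        unfolding R_def by (simp add: matrix_add_ldistrib matrix_add_rdistrib matrix_mul_assoc)
      also have "\<dots> = mat 1 + Q \<sigma> ** E \<sigma> ** C \<tau> ** transpose (E \<sigma>)"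
        by (simp add: Ct matrix_transpose_mul[symmetric] E_inverse)
      finally have "C \<sigma> ** (transpose (E (- \<sigma>)) ** R ** C \<tau> ** transpose (E \<sigma>)) = 
          C \<sigma> + (C \<sigma> ** Q \<sigma>) ** E \<sigma> ** C \<tau> ** transpose (E \<sigma>)"
        by (simp add: matrix_add_ldistrib matrix_mul_assoc)
      then show ?thesis by (simp add: C Cs matrix_mul_assoc)
    qed
    then have "det (C (\<tau> + \<sigma>)) = det (C \<sigma>) * det (E (- \<sigma>)) * det R * det (C \<tau>) * det (E \<sigma>)"
      by (metis det_mul det_transpose)
    also have "\<dots> = det (C \<sigma>) * det R * det (C \<tau>) * det (E (- \<sigma>) ** E \<sigma>)"
      by (simp add: det_mul)
    finally have det: "det (C (\<tau> + \<sigma>)) = det (C \<sigma>) * det R * det (C \<tau>)"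
      by (simp add: E_inverse)
    have "\<kappa> \<tau> * \<kappa> \<sigma> * sqrt ((2 * pi) ^ CARD('d) / det R) = \<kappa> (\<tau> + \<sigma>)"
      unfolding \<kappa>_def det using det_C[OF \<tau>] det_C[OF \<sigma>] R(5)
      by (simp add: real_sqrt_mult real_sqrt_divide field_simps)
    then show ?thesis by (simp add: heat_eq[OF \<tau>\<sigma>] mult_ac)
  qed
  finally show ?thesis .
qed

text \<open>Fubini followed by the kernel identity. Absolute integrability holds because the inner
  average of \<bar>f\<bar> grows at most exponentially and can be averaged again.\<close>

lemma P_P:
  assumes \<tau>: "0 < \<tau>" and \<sigma>: "0 < \<sigma>" and f: "f \<in> borel_measurable borel" "subexponential f"
  shows "P \<tau> (P \<sigma> f) = P (\<tau> + \<sigma>) f"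
proof
  fix x
  let ?a = "E \<tau> *v x"
  note [measurable] = f(1) gaussian_kernel.k_measurable[OF kernel[OF \<tau>]] gaussian_kernel.k_measurable[OF kernel[OF \<sigma>]]
  have Jabs: "J \<sigma> (\<lambda>y. \<bar>f y\<bar>) \<in> borel_measurable borel" "subexponential (J \<sigma> (\<lambda>y. \<bar>f y\<bar>))"
    using f gaussian_kernel.J_measurable[OF kernel[OF \<sigma>]] gaussian_kernel.J_subexponential[OF kernel[OF \<sigma>]]
    by (auto simp: subexponential_def)
  let ?F = "\<lambda>\<xi> y. heat \<tau> (\<xi> - ?a) * (heat \<sigma> (y - E \<sigma> *v \<xi>) * f y)"
  have int: "integrable (lborel \<Otimes>\<^sub>M lborel) (\<lambda>(\<xi>, y). ?F \<xi> y)"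
  proof (rule lborel_pair.Fubini_integrable)
    show "(\<lambda>(\<xi>, y). ?F \<xi> y) \<in> borel_measurable (lborel \<Otimes>\<^sub>M lborel)" by measurable
    have "(\<integral>y. norm (?F \<xi> y) \<partial>lborel) = heat \<tau> (\<xi> - ?a) * J \<sigma> (\<lambda>y. \<bar>f y\<bar>) (E \<sigma> *v \<xi>)" for \<xi>
      unfolding gaussian_kernel.J_def[OF kernel[OF \<sigma>]] by (simp add: abs_mult heat_nonneg \<tau> \<sigma>)
    moreover have "integrable lborel (\<lambda>\<xi>. heat \<tau> (\<xi> - ?a) * J \<sigma> (\<lambda>y. \<bar>f y\<bar>) (E \<sigma> *v \<xi>))"
      by (rule gaussian_kernel.J_integrable[OF kernel[OF \<tau>]])
        (use Jabs measurable_compose[OF measurable_matrix_vector] in \<open>auto intro: subexponential_compose_linear\<close>)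
    ultimately show "integrable lborel (\<lambda>\<xi>. \<integral>y. norm (case (\<xi>, y) of (\<xi>, y) \<Rightarrow> ?F \<xi> y) \<partial>lborel)"
      by simp
    show "AE \<xi> in lborel. integrable lborel (\<lambda>y. case (\<xi>, y) of (\<xi>, y) \<Rightarrow> ?F \<xi> y)"
      using gaussian_kernel.J_integrable[OF kernel[OF \<sigma>] f] by simp
  qed
  have "P \<tau> (P \<sigma> f) x = (\<integral>\<xi>. \<integral>y. ?F \<xi> y \<partial>lborel \<partial>lborel)"
    by (simp add: P_def gaussian_kernel.J_def[OF kernel] \<tau> \<sigma>)
  also have "\<dots> = (\<integral>y. \<integral>\<xi>. ?F \<xi> y \<partial>lborel \<partial>lborel)"
    using lborel_pair.Fubini_integral[OF int] by simp
  also have "\<dots> = (\<integral>y. heat (\<tau> + \<sigma>) (y - E (\<tau> + \<sigma>) *v x) * f y \<partial>lborel)"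
  proof (rule Bochner_Integration.integral_cong[OF refl])
    fix y
    have "(\<integral>\<xi>. ?F \<xi> y \<partial>lborel) = (\<integral>\<xi>. heat \<tau> (\<xi> - ?a) * heat \<sigma> (y - E \<sigma> *v \<xi>) \<partial>lborel) * f y"
      by (simp flip: mult.assoc)
    also have "(\<integral>\<xi>. heat \<tau> (\<xi> - ?a) * heat \<sigma> (y - E \<sigma> *v \<xi>) \<partial>lborel) =
        (\<integral>\<xi>. heat \<tau> ((\<xi> + ?a) - ?a) * heat \<sigma> (y - E \<sigma> *v (\<xi> + ?a)) \<partial>lborel)"
      by (rule lborel_integral_translation(1)[symmetric])
    also have "\<dots> = (\<integral>\<xi>. heat \<tau> \<xi> * heat \<sigma> ((y - E \<sigma> *v ?a) - E \<sigma> *v \<xi>) \<partial>lborel)"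
      by (simp add: algebra_simps)
    also have "\<dots> = heat (\<tau> + \<sigma>) (y - E (\<tau> + \<sigma>) *v x)"
      unfolding heat_convolution[OF \<tau> \<sigma>] by (simp add: matrix_vector_mul_assoc E_add[symmetric] add.commute)
    finally show "(\<integral>\<xi>. ?F \<xi> y \<partial>lborel) = heat (\<tau> + \<sigma>) (y - E (\<tau> + \<sigma>) *v x) * f y" .
  qed
  also have "\<dots> = P (\<tau> + \<sigma>) f x"
    using \<tau> \<sigma> by (simp add: P_def gaussian_kernel.J_def[OF kernel])
  finally show "P \<tau> (P \<sigma> f) x = P (\<tau> + \<sigma>) f x" .
qed

end

section \<open>Polynomials with time-dependent coefficients\<close>

abbreviation mon :: "('d::finite \<Rightarrow> nat) \<Rightarrow> real^'d \<Rightarrow> real" where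
  "mon \<beta> y \<equiv> (\<Prod>i\<in>UNIV. (y $ i) ^ \<beta> i)"

text \<open>Induction on the variables: with the others fixed, the sum is a polynomial in y k, and
  the terms of each degree in y k vanish separately. The exponents are required to agree outside I,
  so that a single monomial is left when I is empty.\<close>

lemma monomials_independent:
  fixes c :: "('d \<Rightarrow> nat) \<Rightarrow> real"
  assumes "finite I" "finite S" "\<And>\<beta> \<beta>' i. \<beta> \<in> S \<Longrightarrow> \<beta>' \<in> S \<Longrightarrow> i \<notin> I \<Longrightarrow> \<beta> i = \<beta>' i"
    and "\<And>y :: 'd \<Rightarrow> real. (\<Sum>\<beta>\<in>S. c \<beta> * (\<Prod>i\<in>I. y i ^ \<beta> i)) = 0"
    and "\<beta> \<in> S"
  shows "c \<beta> = 0"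
  using assms
proof (induction I arbitrary: S \<beta> rule: finite_induct)
  case empty
  then have "S = {\<beta>}" by auto
  then show ?case using empty.prems(3) by simp
next
  case (insert k I)
  obtain N where N: "\<And>\<beta>. \<beta> \<in> S \<Longrightarrow> \<beta> k \<le> N"
    using finite_nat_set_iff_bounded_le[of "(\<lambda>\<beta>. \<beta> k) ` S"] insert.prems(1) by auto
  have "(\<Sum>\<beta>\<in>{\<beta>\<in>S. \<beta> k = m}. c \<beta> * (\<Prod>i\<in>I. y i ^ \<beta> i)) = 0" if m: "m \<le> N" for m and y :: "'d \<Rightarrow> real"
  proof -
    have "(\<Sum>m\<le>N. (\<Sum>\<beta>\<in>{\<beta>\<in>S. \<beta> k = m}. c \<beta> * (\<Prod>i\<in>I. y i ^ \<beta> i)) * t ^ m) = 0" for t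
    proof -
      have "(\<Prod>i\<in>I. (y(k := t)) i ^ \<beta> i) = (\<Prod>i\<in>I. y i ^ \<beta> i)" for \<beta>
        by (rule prod.cong) (use insert.hyps in auto)
      then have "(\<Sum>\<beta>\<in>S. c \<beta> * (\<Prod>i\<in>I. y i ^ \<beta> i) * t ^ \<beta> k) = 0"
        using insert.prems(3)[of "y(k := t)"] insert.hyps by (simp add: mult_ac)
      also have "(\<Sum>\<beta>\<in>S. c \<beta> * (\<Prod>i\<in>I. y i ^ \<beta> i) * t ^ \<beta> k) =
         (\<Sum>m\<le>N. \<Sum>\<beta>\<in>{\<beta>\<in>S. \<beta> k = m}. c \<beta> * (\<Prod>i\<in>I. y i ^ \<beta> i) * t ^ \<beta> k)"
        by (rule sum.group[symmetric]) (use insert.prems(1) N in auto)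
      finally show ?thesis by (simp add: sum_distrib_right)
    qed
    then show ?thesis
      using polyfun_eq_0[of "\<lambda>m. \<Sum>\<beta>\<in>{\<beta>\<in>S. \<beta> k = m}. c \<beta> * (\<Prod>i\<in>I. y i ^ \<beta> i)" N] m by auto
  qed
  note * = this
  show ?case
  proof (rule insert.IH[of "{\<beta>'\<in>S. \<beta>' k = \<beta> k}" \<beta>])
    show "\<beta>' i = \<beta>'' i" if "\<beta>' \<in> {\<beta>'\<in>S. \<beta>' k = \<beta> k}" "\<beta>'' \<in> {\<beta>'\<in>S. \<beta>' k = \<beta> k}" "i \<notin> I" for \<beta>' \<beta>'' i
      using insert.prems(2)[of \<beta>' \<beta>'' i] that by (cases "i = k") auto
  qed (use insert.prems N * in auto)
qed

text \<open>\<open>poly_op\<close> selects coefficients by choice; uniqueness is what allows any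
  explicit representation of the polynomial to be used instead.\<close>

lemma coeffs_of_unique:
  assumes "coeffs_of q c" "coeffs_of q c'"
  shows "c = c'"
proof
  fix \<beta>
  \<comment> \<open>\<beta> itself is inserted so that the case of two vanishing coefficients at
    \<beta> is covered as well.\<close>
  define S where "S = insert \<beta> ({\<beta>. c \<beta> \<noteq> 0} \<union> {\<beta>. c' \<beta> \<noteq> 0})"
  have S: "finite S" using assms by (simp add: S_def coeffs_of_def)
  have ext: "q y = (\<Sum>\<beta>\<in>S. c \<beta> * mon \<beta> y)" if "coeffs_of q c" "{\<beta>. c \<beta> \<noteq> 0} \<subseteq> S" for c y
  proof -
    have "(\<Sum>\<beta> | c \<beta> \<noteq> 0. c \<beta> * mon \<beta> y) = (\<Sum>\<beta>\<in>S. c \<beta> * mon \<beta> y)"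
      by (rule sum.mono_neutral_left) (use S that in auto)
    then show ?thesis using that by (simp add: coeffs_of_def)
  qed
  have "(\<Sum>\<beta>\<in>S. (c \<beta> - c' \<beta>) * (\<Prod>i\<in>UNIV. y i ^ \<beta> i)) = 0" for y
    using ext[OF assms(1), of "\<chi> i. y i"] ext[OF assms(2), of "\<chi> i. y i"]
    by (simp add: S_def left_diff_distrib sum_subtractf subset_iff)
  from monomials_independent[OF finite S _ this, of \<beta>] show "c \<beta> = c' \<beta>"
    by (auto simp: S_def)
qed

text \<open>Polynomials in y with coefficients continuous in s, the shape of the Taylor increments.
  Continuity in s is inherited by the operator families built from them.\<close>

inductive time_poly :: "(real \<Rightarrow> real^'d \<Rightarrow> real) \<Rightarrow> bool" where
  monomial: "continuous_on UNIV c \<Longrightarrow> time_poly (\<lambda>s y. c s * mon \<beta> y)"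
| add: "time_poly q \<Longrightarrow> time_poly q' \<Longrightarrow> time_poly (\<lambda>s y. q s y + q' s y)"

lemma time_poly_coeff: "continuous_on UNIV c \<Longrightarrow> time_poly (\<lambda>s y :: real^'d. c s)"
  using time_poly.monomial[of c "\<lambda>_. 0"] by simp

lemma time_poly_coord: "time_poly (\<lambda>s y :: real^'d. y $ i)"
proof -
  have "mon (\<lambda>j. if j = i then 1 else 0) y = y $ i" for y :: "real^'d"
    by (simp add: if_distrib[of "\<lambda>n. _ ^ n"] prod.delta cong: if_cong)
  then show ?thesis using time_poly.monomial[of "\<lambda>_. 1" "\<lambda>j. if j = i then 1 else 0"] by simp
qed

lemma time_poly_mult:
  assumes "time_poly q" "time_poly q'"
  shows "time_poly (\<lambda>s y. q s y * q' s y)"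
  using assms
proof (induction q rule: time_poly.induct)
  case (monomial c \<beta>)
  from monomial(2,1) show ?case
  proof (induction q' rule: time_poly.induct)
    case (monomial c' \<beta>')
    have "time_poly (\<lambda>s y. (c s * c' s) * mon (\<lambda>i. \<beta> i + \<beta>' i) y)"
      by (intro time_poly.monomial continuous_intros monomial)
    then show ?case by (simp add: power_add prod.distrib mult_ac)
  next
    case (add q q')
    from time_poly.add[OF add.IH(1)[OF add.prems] add.IH(2)[OF add.prems]] show ?case by (simp add: distrib_left)
  qed
next
  case (add q1 q2)
  from time_poly.add[OF add.IH(1)[OF add.prems] add.IH(2)[OF add.prems]] show ?case by (simp add: distrib_right)
qed

lemma time_poly_sum: "(\<And>i. i \<in> S \<Longrightarrow> time_poly (q i)) \<Longrightarrow> time_poly (\<lambda>s y. \<Sum>i\<in>S. q i s y)"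
  by (induction S rule: infinite_finite_induct) (auto intro: time_poly.add time_poly_coeff)

lemma time_poly_prod: "(\<And>i. i \<in> S \<Longrightarrow> time_poly (q i)) \<Longrightarrow> time_poly (\<lambda>s y. \<Prod>i\<in>S. q i s y)"
  by (induction S rule: infinite_finite_induct) (auto intro: time_poly_mult time_poly_coeff)

lemma time_poly_power: "time_poly q \<Longrightarrow> time_poly (\<lambda>s y. q s y ^ n)"
  by (induction n) (auto intro: time_poly_mult time_poly_coeff)

lemma time_poly_diff:
  assumes "time_poly q" "time_poly q'"
  shows "time_poly (\<lambda>s y. q s y - q' s y)"
  using time_poly.add[OF assms(1) time_poly_mult[OF time_poly_coeff[of "\<lambda>_. -1"] assms(2)]] by simp

text \<open>One finite index set serves all times. The support of the coefficients at a single time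
  may be smaller and may vary with it.\<close>

lemma time_poly_coeffs:
  assumes "time_poly q"
  obtains J c where "finite J" "\<And>\<beta>. continuous_on UNIV (c \<beta>)" "\<And>\<beta> s. \<beta> \<notin> J \<Longrightarrow> c \<beta> s = 0"
    "\<And>s y. q s y = (\<Sum>\<beta>\<in>J. c \<beta> s * mon \<beta> y)"
proof -
  have "\<exists>J c. finite J \<and> (\<forall>\<beta>. continuous_on UNIV (c \<beta>)) \<and> (\<forall>\<beta> s. \<beta> \<notin> J \<longrightarrow> c \<beta> s = 0) \<and>
      (\<forall>s y. q s y = (\<Sum>\<beta>\<in>J. c \<beta> s * mon \<beta> y))"
    using assms
  proof (induction rule: time_poly.induct)
    case (monomial c \<beta>)
    then show ?case
      by (intro exI[of _ "{\<beta>}"] exI[of _ "\<lambda>\<beta>'. if \<beta>' = \<beta> then c else (\<lambda>_. 0)"]) (auto simp: continuous_on_const)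
  next
    case (add q q')
    from add.IH(1) obtain J c where J: "finite J" "\<forall>\<beta>. continuous_on UNIV (c \<beta>)"
        "\<forall>\<beta> s. \<beta> \<notin> J \<longrightarrow> c \<beta> s = 0" "\<forall>s y. q s y = (\<Sum>\<beta>\<in>J. c \<beta> s * mon \<beta> y)"
      by (elim exE conjE)
    from add.IH(2) obtain J' c' where J': "finite J'" "\<forall>\<beta>. continuous_on UNIV (c' \<beta>)"
        "\<forall>\<beta> s. \<beta> \<notin> J' \<longrightarrow> c' \<beta> s = 0" "\<forall>s y. q' s y = (\<Sum>\<beta>\<in>J'. c' \<beta> s * mon \<beta> y)"
      by (elim exE conjE)
    have q: "q s y = (\<Sum>\<beta>\<in>J \<union> J'. c \<beta> s * mon \<beta> y)" for s y
      unfolding J(4)[rule_format] by (rule sum.mono_neutral_left) (use J(1,3) J'(1) in auto)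
    have q': "q' s y = (\<Sum>\<beta>\<in>J \<union> J'. c' \<beta> s * mon \<beta> y)" for s y
      unfolding J'(4)[rule_format] by (rule sum.mono_neutral_left) (use J'(1,3) J(1) in auto)
    show ?case
    proof (intro exI[of _ "J \<union> J'"] exI[of _ "\<lambda>\<beta> s. c \<beta> s + c' \<beta> s"] conjI allI impI)
      show "continuous_on UNIV (\<lambda>s. c \<beta> s + c' \<beta> s)" for \<beta>
        using J(2) J'(2) by (intro continuous_on_add) blast+
      show "q s y + q' s y = (\<Sum>\<beta>\<in>J \<union> J'. (c \<beta> s + c' \<beta> s) * mon \<beta> y)" for s y
        unfolding q q' distrib_right sum.distrib ..
    qed (use J(1,3) J'(1,3) in auto)
  qed
  then obtain J c where J: "finite J" "\<forall>\<beta>. continuous_on UNIV (c \<beta>)"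
      "\<forall>\<beta> s. \<beta> \<notin> J \<longrightarrow> c \<beta> s = 0" "\<forall>s y. q s y = (\<Sum>\<beta>\<in>J. c \<beta> s * mon \<beta> y)"
    by (elim exE conjE)
  show thesis by (rule that[of J c]) (use J in \<open>blast+\<close>)
qed

text \<open>The set J may exceed the support of c, so that the sum over a time-independent J can
  replace the sum over a support that depends on s.\<close>

lemma poly_op_eq_sum:
  assumes "finite J" "\<And>\<beta>. \<beta> \<notin> J \<Longrightarrow> c \<beta> = 0" "\<And>y. q y = (\<Sum>\<beta>\<in>J. c \<beta> * mon \<beta> y)"
  shows "poly_op q D g x = (\<Sum>\<beta>\<in>J. c \<beta> * op_power D \<beta> g x)"
proof -
  have sub: "{\<beta>. c \<beta> \<noteq> 0} \<subseteq> J" using assms(2) by blast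
  have "(\<Sum>\<beta> | c \<beta> \<noteq> 0. c \<beta> * mon \<beta> y) = (\<Sum>\<beta>\<in>J. c \<beta> * mon \<beta> y)" for y
    by (rule sum.mono_neutral_left) (use assms(1) sub in auto)
  then have "coeffs_of q c"
    using assms(1) sub by (auto simp: coeffs_of_def assms(3) intro: finite_subset)
  then have "(SOME c. coeffs_of q c) = c"
    using coeffs_of_unique by blast
  then have "poly_op q D g x = (\<Sum>\<beta> | c \<beta> \<noteq> 0. c \<beta> * op_power D \<beta> g x)"
    by (simp add: poly_op_def)
  also have "\<dots> = (\<Sum>\<beta>\<in>J. c \<beta> * op_power D \<beta> g x)"
    by (rule sum.mono_neutral_left) (use assms(1) sub in auto)
  finally show ?thesis .
qed

lemma op_power_coord: "op_power (\<lambda>i g x. x $ i * g x) \<beta> g x = mon \<beta> x * g x" for x :: "'d::{finite,linorder} rvec"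
proof -
  have pow: "((\<lambda>g x. x $ i * g x) ^^ n) g x = (x $ i) ^ n * g x" for i n g and x :: "'d rvec"
    by (induction n arbitrary: x) auto
  have "foldr (\<lambda>i. (\<lambda>g x. x $ i * g x) ^^ \<beta> i) is g x = (\<Prod>i\<leftarrow>is. (x $ i) ^ \<beta> i) * g x" for "is"
    by (induction "is") (auto simp: pow)
  then show ?thesis
    by (simp add: op_power_def prod.distinct_set_conv_list[symmetric])
qed

lemma poly_op_coord:
  assumes "time_poly q"
  shows "poly_op (q s) (\<lambda>i g x. x $ i * g x) g x = q s x * g x"
proof -
  obtain J c where J: "finite J" "\<And>\<beta> s. \<beta> \<notin> J \<Longrightarrow> c \<beta> s = 0" "\<And>s y. q s y = (\<Sum>\<beta>\<in>J. c \<beta> s * mon \<beta> y)"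
    using assms by (rule time_poly_coeffs) blast
  show ?thesis
    by (subst poly_op_eq_sum[of J "\<lambda>\<beta>. c \<beta> s"]) (use J in \<open>auto simp: op_power_coord sum_distrib_right mult.assoc\<close>)
qed

section \<open>Operator words on tame functions\<close>

lemma op_power_tame:
  assumes "\<And>i f. tame f \<Longrightarrow> tame (D i f)" "tame f"
  shows "tame (op_power D \<beta> f)"
proof -
  have pow: "tame f \<Longrightarrow> tame ((D i ^^ n) f)" for i n f
    by (induction n) (auto intro: assms(1))
  have "tame (foldr (\<lambda>i. D i ^^ \<beta> i) is f)" for "is"
    by (induction "is") (auto intro: pow assms(2))
  then show ?thesis by (simp add: op_power_def)
qed

text \<open>L is moved past the factors one at a time; they keep their order, and every intermediate
  function is tame.\<close>

lemma op_power_intertwine: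
  assumes D: "\<And>i f. tame f \<Longrightarrow> tame (D i f)" and L: "\<And>i f. tame f \<Longrightarrow> L (D i f) = D' i (L f)" and f: "tame f"
  shows "L (op_power D \<beta> f) = op_power D' \<beta> (L f)"
proof -
  have powt: "tame f \<Longrightarrow> tame ((D i ^^ n) f)" for i n f
    by (induction n) (auto intro: D)
  have pow: "tame f \<Longrightarrow> L ((D i ^^ n) f) = (D' i ^^ n) (L f)" for i n f
    by (induction n) (auto simp: L powt)
  have "tame (foldr (\<lambda>i. D i ^^ \<beta> i) is f) \<and> L (foldr (\<lambda>i. D i ^^ \<beta> i) is f) = foldr (\<lambda>i. D' i ^^ \<beta> i) is (L f)" for "is"
    by (induction "is") (auto simp: powt pow f)
  then show ?thesis by (simp add: op_power_def)
qed

lemma poly_op_tame: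
  assumes "\<And>i f. tame f \<Longrightarrow> tame (D i f)" "tame f"
  shows "tame (poly_op q D f)"
  unfolding poly_op_def[abs_def] Let_def by (intro tame_sum tame_cmult op_power_tame assms)

section \<open>Families of differential operators\<close>

text \<open>Linearity is demanded on tame functions only: derivatives defined through
  \<open>deriv\<close> are additive just where they exist.\<close>

definition tame_linear :: "((real^'d \<Rightarrow> real) \<Rightarrow> real^'d \<Rightarrow> real) \<Rightarrow> bool" where
  "tame_linear \<Lambda> \<longleftrightarrow> (\<forall>f. tame f \<longrightarrow> tame (\<Lambda> f)) \<and>
     (\<forall>f g. tame f \<longrightarrow> tame g \<longrightarrow> \<Lambda> (\<lambda>x. f x + g x) = (\<lambda>x. \<Lambda> f x + \<Lambda> g x)) \<and>
     (\<forall>c f. tame f \<longrightarrow> \<Lambda> (\<lambda>x. c * f x) = (\<lambda>x. c * \<Lambda> f x))"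

text \<open>The parameter sits in scalar coefficients and the operators are fixed, so that
  integration over s never meets a derivative in x. The rule \<open>cong\<close> is required because
  rearrangements such as moving a scalar through an operator are valid on tame functions
  only.\<close>

inductive op_family :: "real set \<Rightarrow> (real \<Rightarrow> (real^'d \<Rightarrow> real) \<Rightarrow> real^'d \<Rightarrow> real) \<Rightarrow> bool" for S where
  basic: "tame_linear \<Lambda> \<Longrightarrow> continuous_on S c \<Longrightarrow> op_family S (\<lambda>s f x. c s * \<Lambda> f x)"
| add: "op_family S A \<Longrightarrow> op_family S A' \<Longrightarrow> op_family S (\<lambda>s f x. A s f x + A' s f x)"
| cong: "op_family S A \<Longrightarrow> (\<And>s f. s \<in> S \<Longrightarrow> tame f \<Longrightarrow> A s f = A' s f) \<Longrightarrow> op_family S A'"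

lemma tame_linear_cmult: "tame_linear \<Lambda> \<Longrightarrow> tame_linear (\<lambda>f x. c * \<Lambda> f x)"
  by (simp add: tame_linear_def tame_cmult distrib_left mult_ac)

lemma tame_linear_add: "tame_linear \<Lambda> \<Longrightarrow> tame_linear \<Lambda>' \<Longrightarrow> tame_linear (\<lambda>f x. \<Lambda> f x + \<Lambda>' f x)"
  by (simp add: tame_linear_def tame_add distrib_left add_ac)

lemma tame_linear_comp: "tame_linear \<Lambda> \<Longrightarrow> tame_linear \<Lambda>' \<Longrightarrow> tame_linear (\<lambda>f. \<Lambda> (\<Lambda>' f))"
  by (simp add: tame_linear_def)

lemma tame_linear_id: "tame_linear (\<lambda>f. f)"
  by (simp add: tame_linear_def)

lemma tame_linear_zero: "tame_linear (\<lambda>f x. 0)"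
  by (simp add: tame_linear_def tame_const)

lemma tame_linear_coord: "tame_linear (\<lambda>f x. x $ i * f x)"
  by (simp add: tame_linear_def tame_coord_mult distrib_left mult.left_commute)

lemma tame_linear_partial: "tame_linear (partial i)"
  by (simp add: tame_linear_def tame_partial dir_diff_add dir_diff_cmult tame_dir_diff)

lemma op_family_tame_linear:
  assumes "op_family S A" "s \<in> S"
  shows "tame_linear (A s)"
  using assms
proof (induction rule: op_family.induct)
  case (cong A A')
  then have "A s f = A' s f" if "tame f" for f using that by blast
  with cong.IH[OF cong.prems] show ?case
    by (simp add: tame_linear_def tame_add tame_cmult)
qed (simp_all add: tame_linear_cmult tame_linear_add)

lemma op_family_const: "tame_linear \<Lambda> \<Longrightarrow> op_family S (\<lambda>_. \<Lambda>)"
  using op_family.basic[of \<Lambda> S "\<lambda>_. 1"] by (simp add: continuous_on_const)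

lemma op_family_scale:
  assumes "op_family S A" "continuous_on S c"
  shows "op_family S (\<lambda>s f x. c s * A s f x)"
  using assms
proof (induction rule: op_family.induct)
  case (basic \<Lambda> c')
  have "op_family S (\<lambda>s f x. (c s * c' s) * \<Lambda> f x)"
    by (intro op_family.basic continuous_intros basic)
  then show ?case by (simp add: mult_ac)
next
  case (add A A')
  then show ?case using op_family.add[of S "\<lambda>s f x. c s * A s f x" "\<lambda>s f x. c s * A' s f x"] by (simp add: distrib_left)
next
  case (cong A A')
  from cong(3)[OF cong.prems] show ?case
    by (rule op_family.cong) (simp add: cong.hyps)
qed

lemma op_family_sum: "(\<And>i. i \<in> I \<Longrightarrow> op_family S (A i)) \<Longrightarrow> op_family S (\<lambda>s f x. \<Sum>i\<in>I. A i s f x)"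
  by (induction I rule: infinite_finite_induct) (auto intro: op_family.add op_family_const tame_linear_zero)

lemma op_family_compose_const:
  assumes "op_family S A" "tame_linear \<Lambda>"
  shows "op_family S (\<lambda>s f. \<Lambda> (A s f))"
  using assms
proof (induction rule: op_family.induct)
  case (basic \<Lambda>' c)
  have "op_family S (\<lambda>s f x. c s * \<Lambda> (\<Lambda>' f) x)"
    by (rule op_family.basic[OF tame_linear_comp[OF basic.prems basic.hyps(1)] basic.hyps(2)])
  then show ?case
  proof (rule op_family.cong)
    fix s and f :: "real^'a \<Rightarrow> real" assume "tame f"
    then have "tame (\<Lambda>' f)" using basic.hyps by (simp add: tame_linear_def)
    then show "(\<lambda>x. c s * \<Lambda> (\<Lambda>' f) x) = \<Lambda> (\<lambda>x. c s * \<Lambda>' f x)"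
      using basic.prems by (simp add: tame_linear_def)
  qed
next
  case (add A A')
  have "op_family S (\<lambda>s f x. \<Lambda> (A s f) x + \<Lambda> (A' s f) x)"
    by (intro op_family.add add)
  then show ?case
  proof (rule op_family.cong)
    fix s and f :: "real^'a \<Rightarrow> real" assume "s \<in> S" "tame f"
    then have "tame (A s f)" "tame (A' s f)"
      using add.hyps op_family_tame_linear unfolding tame_linear_def by blast+
    then show "(\<lambda>x. \<Lambda> (A s f) x + \<Lambda> (A' s f) x) = \<Lambda> (\<lambda>x. A s f x + A' s f x)"
      using add.prems by (simp add: tame_linear_def)
  qed
next
  case (cong A A')
  from cong(3)[OF cong.prems] show ?case
    by (rule op_family.cong) (simp add: cong.hyps)
qed

lemma op_family_compose:
  assumes "op_family S A" "op_family S A'"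
  shows "op_family S (\<lambda>s f. A s (A' s f))"
  using assms
proof (induction rule: op_family.induct)
  case (basic \<Lambda> c)
  then show ?case using op_family_scale[OF op_family_compose_const[OF basic.prems basic.hyps(1)] basic.hyps(2)] by simp
next
  case (add A1 A2)
  then show ?case using op_family.add[of S "\<lambda>s f. A1 s (A' s f)" "\<lambda>s f. A2 s (A' s f)"] by simp
next
  case (cong A1 A2)
  from cong(3)[OF cong.prems] show ?case
  proof (rule op_family.cong)
    fix s and f :: "real^'a \<Rightarrow> real" assume "s \<in> S" "tame f"
    then have "tame (A' s f)"
      using cong.prems op_family_tame_linear unfolding tame_linear_def by blast
    then show "A1 s (A' s f) = A2 s (A' s f)" using cong.hyps \<open>s \<in> S\<close> by blast
  qed
qed

lemma op_family_op_power:
  assumes "\<And>i. op_family S (\<lambda>s. D s i)"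
  shows "op_family S (\<lambda>s. op_power (D s) \<beta>)"
proof -
  have pow: "op_family S (\<lambda>s. D s i ^^ n)" for i n
  proof (induction n)
    case (Suc n)
    then show ?case using op_family_compose[OF assms[of i] Suc] by (simp add: o_def)
  qed (simp add: id_def op_family_const tame_linear_id)
  have "op_family S (\<lambda>s. foldr (\<lambda>i. D s i ^^ \<beta> i) is)" for "is"
  proof (induction "is")
    case (Cons i "is")
    then show ?case using op_family_compose[OF pow Cons] by (simp add: o_def)
  qed (simp add: id_def op_family_const tame_linear_id)
  then show ?thesis by (simp add: op_power_def)
qed

lemma op_family_poly_op:
  assumes "time_poly q" "\<And>i. op_family S (\<lambda>s. D s i)"
  shows "op_family S (\<lambda>s. poly_op (q s) (D s))"
proof -
  obtain J c where J: "finite J" "\<And>\<beta>. continuous_on UNIV (c \<beta>)" "\<And>\<beta> s. \<beta> \<notin> J \<Longrightarrow> c \<beta> s = 0" 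
    "\<And>s y. q s y = (\<Sum>\<beta>\<in>J. c \<beta> s * mon \<beta> y)"
    using assms(1) by (rule time_poly_coeffs) blast
  have "op_family S (\<lambda>s f x. \<Sum>\<beta>\<in>J. c \<beta> s * op_power (D s) \<beta> f x)"
    by (intro op_family_sum op_family_scale op_family_op_power assms continuous_on_subset[OF J(2)]) auto
  moreover have "poly_op (q s) (D s) f x = (\<Sum>\<beta>\<in>J. c \<beta> s * op_power (D s) \<beta> f x)" for s f x
    by (rule poly_op_eq_sum) (use J in auto)
  then have "(\<lambda>s. poly_op (q s) (D s)) = (\<lambda>s f x. \<Sum>\<beta>\<in>J. c \<beta> s * op_power (D s) \<beta> f x)"
    by (simp add: fun_eq_iff)
  ultimately show ?thesis by simp
qed

locale expansion_operators = gaussian_semigroup E C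
  for E C :: "real \<Rightarrow> 'd::{finite,linorder} rmat" +
  fixes I :: "'d set" and qa :: "nat \<Rightarrow> 'd \<Rightarrow> 'd \<Rightarrow> real \<Rightarrow> 'd rvec \<Rightarrow> real" and qb :: "nat \<Rightarrow> 'd \<Rightarrow> real \<Rightarrow> 'd rvec \<Rightarrow> real"
  assumes qa: "\<And>n i j. time_poly (qa n i j)" and qb: "\<And>n i. time_poly (qb n i)"
begin

text \<open>The lag \<sigma> and the time s of the coefficients are separate arguments, because
  \<open>P_G\<close> increases the former and leaves the latter alone. For the operator with base
  time t the lag is s - t.\<close>

definition G :: "nat \<Rightarrow> real \<Rightarrow> real \<Rightarrow> ('d rvec \<Rightarrow> real) \<Rightarrow> 'd rvec \<Rightarrow> real" where
  "G n \<sigma> s f x = 1/2 * (\<Sum>i\<in>I. \<Sum>j\<in>I. poly_op (qa n i j s) (Mo \<sigma>) (Gr \<sigma> i (Gr \<sigma> j f)) x)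
     + (\<Sum>i\<in>I. poly_op (qb n i s) (Mo \<sigma>) (Gr \<sigma> i f) x)"

text \<open>E is continuous on the whole line but C is controlled only for nonnegative lags, hence
  the restriction to s in [t, T]. The endpoint T is included, which makes the coefficients
  integrable up to T.\<close>

lemma continuous_on_coeffs:
  assumes "t \<le> T"
  shows "continuous_on {t..T} (\<lambda>s. E (s - t) $ i $ j)"
    and "continuous_on {t..T} (\<lambda>s. (C (s - t) ** transpose (E (- (s - t)))) $ i $ j)"
    and "continuous_on {t..T} (\<lambda>s. transpose (E (- (s - t))) $ i $ j)"
proof -
  have E: "continuous_on {t..T} (\<lambda>s. E (f s))" if "continuous_on {t..T} f" for f
    by (rule continuous_on_compose2[OF continuous_on_E that]) auto
  have C: "continuous_on {t..T} (\<lambda>s. C (s - t))"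
    by (rule continuous_on_compose2[OF continuous_on_C[of "T - t"]]) (auto intro!: continuous_intros)
  show "continuous_on {t..T} (\<lambda>s. E (s - t) $ i $ j)"
    "continuous_on {t..T} (\<lambda>s. (C (s - t) ** transpose (E (- (s - t)))) $ i $ j)"
    "continuous_on {t..T} (\<lambda>s. transpose (E (- (s - t))) $ i $ j)"
    unfolding matrix_matrix_mult_def transpose_def
    by (auto intro!: continuous_intros E C)
qed

lemma op_family_Mo: "t \<le> T \<Longrightarrow> op_family {t..T} (\<lambda>s. Mo (s - t) i)"
  unfolding Mo_eq[abs_def]
  by (intro op_family.add op_family_sum op_family_scale op_family_const tame_linear_coord tame_linear_partial continuous_on_coeffs)

lemma op_family_Gr: "t \<le> T \<Longrightarrow> op_family {t..T} (\<lambda>s. Gr (s - t) i)"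
  unfolding Gr_def[abs_def]
  by (intro op_family_sum op_family_scale op_family_const tame_linear_partial continuous_on_coeffs)

lemma op_family_G: "t \<le> T \<Longrightarrow> op_family {t..T} (\<lambda>s. G n (s - t) s)"
  unfolding G_def[abs_def]
  by (intro op_family.add op_family_sum op_family_scale op_family_Gr op_family_Mo qa qb continuous_on_const
      op_family_compose[OF op_family_poly_op] op_family_compose[OF op_family_Gr])

text \<open>The coefficients chosen in \<open>poly_op\<close> depend on q alone, so they agree on
  both sides, and P passes through sums, scalars and powers of \<open>Mo\<close>.\<close>

lemma P_poly_op:
  assumes \<tau>: "0 < \<tau>" and \<sigma>: "0 \<le> \<sigma>" and f: "tame f"
  shows "P \<tau> (poly_op q (Mo \<sigma>) f) = poly_op q (Mo (\<sigma> + \<tau>)) (P \<tau> f)"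
  unfolding poly_op_def[abs_def] Let_def
  by (subst P_sum[OF \<tau>], intro tame_cmult op_power_tame Mo_tame f, assumption)
    (simp add: P_cmult[OF \<tau>] op_power_intertwine[of "Mo \<sigma>" "P \<tau>" "Mo (\<sigma> + \<tau>)", OF Mo_tame P_Mo[OF \<tau> \<sigma>] f])

lemma P_G:
  assumes \<tau>: "0 < \<tau>" and \<sigma>: "0 \<le> \<sigma>" and f: "tame f"
  shows "P \<tau> (G n \<sigma> s f) = G n (\<sigma> + \<tau>) s (P \<tau> f)"
proof -
  have t: "tame (poly_op q (Mo \<sigma>) g)" if "tame g" for q g
    by (rule poly_op_tame[OF Mo_tame that])
  note t' = t[OF Gr_tame[OF Gr_tame[OF f]]] t[OF Gr_tame[OF f]]
  show ?thesis
    unfolding G_def[abs_def]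
    by (simp only: P_add[OF \<tau>] P_cmult[OF \<tau>] P_sum[OF \<tau>] t' tame_sum tame_cmult P_poly_op[OF \<tau> \<sigma>] Gr_tame f P_Gr[OF \<tau>])
qed

text \<open>At lag 0, from E(0) = 1 and C(0) = 0, \<open>Mo\<close> is multiplication by the
  coordinates and \<open>Gr\<close> is the plain gradient.\<close>

lemma G_0: "G n 0 s f x = 1/2 * (\<Sum>i\<in>I. \<Sum>j\<in>I. qa n i j s x * partial i (partial j f) x)
     + (\<Sum>i\<in>I. qb n i s x * partial i f x)"
proof -
  have "Gr 0 i g x = (mat 1 *v (\<chi> k. partial k g x)) $ i" for i g x
    by (simp add: Gr_eq E_0 del: matrix_vector_mul_lid)
  then have Gr: "Gr 0 i = partial i" for i
    by (simp add: fun_eq_iff) 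
  have Mo: "Mo 0 = (\<lambda>i g x. x $ i * g x)"
    by (simp add: fun_eq_iff Mo_eq C_0 E_0 mat_def if_distrib[of "\<lambda>x. x * _"] matrix_matrix_mult_def cong: if_cong)
  show ?thesis
    by (simp add: G_def Gr Mo poly_op_coord[OF qa] poly_op_coord[OF qb])
qed

end

section \<open>Iterated integrals over the simplex\<close>

text \<open>Integrability at every level of the iteration. It has to be tracked because the integral
  of a non-integrable function is 0 by convention, so that additivity can fail without it.\<close>

fun iterated_integrable :: "nat \<Rightarrow> real \<Rightarrow> real \<Rightarrow> (real list \<Rightarrow> real) \<Rightarrow> bool" where
  "iterated_integrable 0 t T F = True"
| "iterated_integrable (Suc h) t T F \<longleftrightarrow>
     set_integrable lborel {t..T} (\<lambda>s. simplex_integral h s T (\<lambda>ss. F (s # ss))) \<and>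
     (\<forall>s\<in>{t..T}. iterated_integrable h s T (\<lambda>ss. F (s # ss)))"

lemma simplex_integral_cong:
  assumes "\<And>ss. length ss = h \<Longrightarrow> set ss \<subseteq> {t..T} \<Longrightarrow> F ss = F' ss"
  shows "simplex_integral h t T F = simplex_integral h t T F'"
  using assms
proof (induction h arbitrary: t F F')
  case (Suc h)
  have "simplex_integral h s T (\<lambda>ss. F (s # ss)) = simplex_integral h s T (\<lambda>ss. F' (s # ss))" if "s \<in> {t..T}" for s
    by (rule Suc.IH, rule Suc.prems) (use that in \<open>auto dest!: subsetD\<close>)
  then show ?case by (auto intro!: set_lebesgue_integral_cong)
qed simp

lemma iterated_integrable_cong:
  assumes "\<And>ss. length ss = h \<Longrightarrow> set ss \<subseteq> {t..T} \<Longrightarrow> F ss = F' ss" "iterated_integrable h t T F"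
  shows "iterated_integrable h t T F'"
  using assms
proof (induction h arbitrary: t F F')
  case (Suc h)
  have eq: "F (s # ss) = F' (s # ss)" if "s \<in> {t..T}" "length ss = h" "set ss \<subseteq> {s..T}" for s ss
    by (rule Suc.prems) (use that in \<open>auto dest!: subsetD\<close>)
  have "simplex_integral h s T (\<lambda>ss. F (s # ss)) = simplex_integral h s T (\<lambda>ss. F' (s # ss))" if "s \<in> {t..T}" for s
    by (rule simplex_integral_cong) (use eq that in auto)
  then have "set_integrable lborel {t..T} (\<lambda>s. simplex_integral h s T (\<lambda>ss. F (s # ss))) \<longleftrightarrow>
      set_integrable lborel {t..T} (\<lambda>s. simplex_integral h s T (\<lambda>ss. F' (s # ss)))"
    by (intro set_integrable_cong refl)
  moreover have "iterated_integrable h s T (\<lambda>ss. F' (s # ss))" if "s \<in> {t..T}" for s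
    by (rule Suc.IH[of s "\<lambda>ss. F (s # ss)"]) (use eq that Suc.prems(2) in auto)
  ultimately show ?case using Suc.prems(2) by simp
qed simp

lemma simplex_integral_add:
  assumes "iterated_integrable h t T F" "iterated_integrable h t T F'"
  shows "iterated_integrable h t T (\<lambda>ss. F ss + F' ss) \<and>
    simplex_integral h t T (\<lambda>ss. F ss + F' ss) = simplex_integral h t T F + simplex_integral h t T F'"
  using assms
proof (induction h arbitrary: t F F')
  case (Suc h)
  let ?i = "\<lambda>F s. simplex_integral h s T (\<lambda>ss. F (s # ss))"
  have IH: "iterated_integrable h s T (\<lambda>ss. F (s # ss) + F' (s # ss))" 
    "?i (\<lambda>ss. F ss + F' ss) s = ?i F s + ?i F' s" if "s \<in> {t..T}" for s
    using Suc.IH[of s "\<lambda>ss. F (s # ss)" "\<lambda>ss. F' (s # ss)"] Suc.prems that by auto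
  have int: "set_integrable lborel {t..T} (?i F)" "set_integrable lborel {t..T} (?i F')"
    using Suc.prems by auto
  have "set_integrable lborel {t..T} (?i (\<lambda>ss. F ss + F' ss)) \<longleftrightarrow>
      set_integrable lborel {t..T} (\<lambda>s. ?i F s + ?i F' s)"
    by (intro set_integrable_cong refl IH(2))
  then have "set_integrable lborel {t..T} (?i (\<lambda>ss. F ss + F' ss))"
    using set_integral_add(1)[OF int] by simp
  moreover have "(LINT s:{t..T}|lborel. ?i (\<lambda>ss. F ss + F' ss) s) = (LINT s:{t..T}|lborel. ?i F s + ?i F' s)"
    by (rule set_lebesgue_integral_cong) (use IH(2) in auto)
  ultimately show ?case
    using set_integral_add(2)[OF int] IH(1) by simp
qed simp

lemma simplex_integral_cmult: "simplex_integral h t T (\<lambda>ss. c * F ss) = c * simplex_integral h t T F"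
  by (induction h arbitrary: t F) simp_all

lemma iterated_integrable_cmult: "iterated_integrable h t T F \<Longrightarrow> iterated_integrable h t T (\<lambda>ss. c * F ss)"
  by (induction h arbitrary: t F) (simp_all add: simplex_integral_cmult)

lemma iterated_integrable_zero: "iterated_integrable h t T (\<lambda>ss. 0)"
  using simplex_integral_cmult[of _ _ T 0 "\<lambda>_. 0"] by (induction h arbitrary: t) (auto simp: set_integrable_def)

lemma simplex_integral_zero: "simplex_integral h t T (\<lambda>ss. 0) = 0"
  using simplex_integral_cmult[of h t T 0 "\<lambda>_. 0"] by simp

lemma simplex_integral_sum:
  assumes "\<And>i. i \<in> I \<Longrightarrow> iterated_integrable h t T (F i)"
  shows "iterated_integrable h t T (\<lambda>ss. \<Sum>i\<in>I. F i ss) \<and>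
    simplex_integral h t T (\<lambda>ss. \<Sum>i\<in>I. F i ss) = (\<Sum>i\<in>I. simplex_integral h t T (F i))"
  using assms
  by (induction I rule: infinite_finite_induct)
    (auto simp: simplex_integral_add iterated_integrable_zero simplex_integral_zero)

text \<open>Separated functions c_1(s_1) ... c_h(s_h); the value 1 is the empty product that ends
  the recursion.\<close>

fun product_fun :: "(real \<Rightarrow> real) list \<Rightarrow> real list \<Rightarrow> real" where
  "product_fun (c # cs) (s # ss) = c s * product_fun cs ss"
| "product_fun _ _ = 1"

text \<open>Continuity in the lower limit belongs to the induction: the inner integral is a factor
  of the next integrand, which must again be integrable.\<close>

lemma iterated_integrable_product_fun:
  assumes "\<forall>c\<in>set cs. continuous_on {t..T} c"
  shows "continuous_on {t..T} (\<lambda>\<tau>. simplex_integral (length cs) \<tau> T (product_fun cs)) \<and>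
    (\<forall>\<tau>\<in>{t..T}. iterated_integrable (length cs) \<tau> T (product_fun cs))"
  using assms
proof (induction cs)
  case (Cons c cs)
  define g where "g s = c s * simplex_integral (length cs) s T (product_fun cs)" for s
  have g: "continuous_on {t..T} g"
    unfolding g_def using Cons by (intro continuous_intros) auto
  have int: "set_integrable lborel {\<tau>..T} g" if "\<tau> \<in> {t..T}" for \<tau>
    using that by (intro borel_integrable_atLeastAtMost' continuous_on_subset[OF g]) auto
  have "(LINT s:{\<tau>..T}|lborel. g s) = integral {\<tau>..T} g" if "\<tau> \<in> {t..T}" for \<tau>
    using set_borel_integral_eq_integral(2)[OF int[OF that]] .
  then have "continuous_on {t..T} (\<lambda>\<tau>. LINT s:{\<tau>..T}|lborel. g s)"
    by (intro continuous_on_eq[OF indefinite_integral_continuous_1'[OF integrable_continuous_interval[OF g]]]) simp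
  then show ?case
    using Cons int by (auto simp: simplex_integral_cmult g_def[abs_def] iterated_integrable_cmult)
qed (auto simp: continuous_on_const)

text \<open>Functions of the times with values in the tame functions: finite sums of separated
  scalars times fixed tame functions. For these, the simplex integral is a finite linear combination
  of tame functions.\<close>

inductive simplex_family :: "real set \<Rightarrow> nat \<Rightarrow> (real list \<Rightarrow> real^'d \<Rightarrow> real) \<Rightarrow> bool" for S h where
  basic: "length cs = h \<Longrightarrow> \<forall>c\<in>set cs. continuous_on S c \<Longrightarrow> tame f \<Longrightarrow> simplex_family S h (\<lambda>ss x. product_fun cs ss * f x)"
| add: "simplex_family S h F \<Longrightarrow> simplex_family S h F' \<Longrightarrow> simplex_family S h (\<lambda>ss x. F ss x + F' ss x)"
| cong: "simplex_family S h F \<Longrightarrow> (\<And>ss. length ss = h \<Longrightarrow> set ss \<subseteq> S \<Longrightarrow> F ss = F' ss) \<Longrightarrow> simplex_family S h F'"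

lemma simplex_family_tame:
  assumes "simplex_family S h F" "length ss = h" "set ss \<subseteq> S"
  shows "tame (F ss)"
  using assms
proof (induction rule: simplex_family.induct)
  case (cong F F')
  then show ?case by metis
qed (auto intro: tame_cmult tame_add)

lemma simplex_family_map:
  assumes "simplex_family S h F" "tame_linear \<Lambda>"
  shows "simplex_family S h (\<lambda>ss. \<Lambda> (F ss))"
  using assms
proof (induction rule: simplex_family.induct)
  case (basic cs f)
  then have "simplex_family S h (\<lambda>ss x. product_fun cs ss * \<Lambda> f x)"
    by (intro simplex_family.basic) (auto simp: tame_linear_def)
  then show ?case using basic by (simp add: tame_linear_def)
next
  case (add F F')
  have "simplex_family S h (\<lambda>ss x. \<Lambda> (F ss) x + \<Lambda> (F' ss) x)"
    using add by (intro simplex_family.add) auto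
  then show ?case
    by (rule simplex_family.cong)
      (use add.hyps add.prems in \<open>simp add: tame_linear_def simplex_family_tame\<close>)
next
  case (cong F F')
  from cong.IH[OF cong.prems] show ?case
    by (rule simplex_family.cong) (simp add: cong.hyps)
qed

text \<open>The head of the list is the new outermost time, on which the additional operator
  depends; its scalar coefficient becomes the first factor of \<open>product_fun\<close>.\<close>

lemma simplex_family_Cons:
  assumes A: "op_family S A" and "simplex_family S h F"
  shows "simplex_family S (Suc h) (\<lambda>ss. A (hd ss) (F (tl ss)))"
  using assms(2)
proof (induction rule: simplex_family.induct)
  case (basic cs f)
  from A show ?case
  proof (induction rule: op_family.induct)
    case (basic \<Lambda> c)
    have "simplex_family S (Suc h) (\<lambda>ss x. product_fun (c # cs) ss * \<Lambda> f x)"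
      by (rule simplex_family.basic)
        (use basic \<open>length cs = h\<close> \<open>\<forall>c\<in>set cs. continuous_on S c\<close> \<open>tame f\<close> in \<open>auto simp: tame_linear_def\<close>)
    then show ?case
    proof (rule simplex_family.cong)
      fix ss :: "real list" assume "length ss = Suc h"
      then obtain s ss' where "ss = s # ss'" by (cases ss) auto
      then show "(\<lambda>x. product_fun (c # cs) ss * \<Lambda> f x) = (\<lambda>x. c (hd ss) * \<Lambda> (\<lambda>x. product_fun cs (tl ss) * f x) x)"
        using basic.hyps(1) \<open>tame f\<close> by (simp add: tame_linear_def mult.assoc)
    qed
  next
    case (add A A')
    then show ?case by (intro simplex_family.add)
  next
    case (cong A A')
    from cong.IH show ?case
    proof (rule simplex_family.cong)
      fix ss :: "real list" assume "length ss = Suc h" "set ss \<subseteq> S"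
      then have "hd ss \<in> S" by (cases ss) auto
      then show "A (hd ss) (\<lambda>x. product_fun cs (tl ss) * f x) = A' (hd ss) (\<lambda>x. product_fun cs (tl ss) * f x)"
        by (intro cong.hyps tame_cmult \<open>tame f\<close>)
    qed
  qed
next
  case (add F F')
  have "simplex_family S (Suc h) (\<lambda>ss x. A (hd ss) (F (tl ss)) x + A (hd ss) (F' (tl ss)) x)"
    by (intro simplex_family.add add.IH)
  then show ?case
  proof (rule simplex_family.cong)
    fix ss :: "real list" assume ss: "length ss = Suc h" "set ss \<subseteq> S"
    then have "hd ss \<in> S" "length (tl ss) = h" "set (tl ss) \<subseteq> S" by (cases ss; auto)+
    then have "tame_linear (A (hd ss))" "tame (F (tl ss))" "tame (F' (tl ss))"
      using op_family_tame_linear[OF A] simplex_family_tame add.hyps by blast+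
    then show "(\<lambda>x. A (hd ss) (F (tl ss)) x + A (hd ss) (F' (tl ss)) x) = A (hd ss) (\<lambda>x. F (tl ss) x + F' (tl ss) x)"
      by (simp add: tame_linear_def)
  qed
next
  case (cong F F')
  from cong.IH show ?case
  proof (rule simplex_family.cong)
    fix ss :: "real list" assume "length ss = Suc h" "set ss \<subseteq> S"
    then have "length (tl ss) = h" "set (tl ss) \<subseteq> S" by (cases ss; auto)+
    then show "A (hd ss) (F (tl ss)) = A (hd ss) (F' (tl ss))" by (simp add: cong.hyps)
  qed
qed

lemma simplex_family_const: "tame f \<Longrightarrow> simplex_family S 0 (\<lambda>_. f)"
  using simplex_family.basic[of "[]" 0 S f] by simp

lemma simplex_family_zero: "simplex_family S h (\<lambda>_ _. 0)"
  using simplex_family.basic[of "replicate h (\<lambda>_. 0)" h S "\<lambda>_. 0"]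
  by (auto simp: continuous_on_const tame_const)

lemma simplex_family_sum:
  "(\<And>i. i \<in> I \<Longrightarrow> simplex_family S h (F i)) \<Longrightarrow> simplex_family S h (\<lambda>ss x. \<Sum>i\<in>I. F i ss x)"
  by (induction I rule: infinite_finite_induct) (auto intro: simplex_family.add simplex_family_zero)

lemma simplex_family_iterated_integrable:
  assumes "simplex_family {t..T} h F" "\<tau> \<in> {t..T}"
  shows "iterated_integrable h \<tau> T (\<lambda>ss. F ss x)"
  using assms
proof (induction rule: simplex_family.induct)
  case (basic cs f)
  then have "iterated_integrable h \<tau> T (\<lambda>ss. f x * product_fun cs ss)"
    using iterated_integrable_product_fun by (intro iterated_integrable_cmult) blast
  then show ?case by (simp add: mult.commute)
next
  case (add F F')
  then show ?case by (simp add: simplex_integral_add)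
next
  case (cong F F')
  have "F ss x = F' ss x" if "length ss = h" "set ss \<subseteq> {\<tau>..T}" for ss
    by (rule fun_cong, rule cong.hyps) (use that cong.prems in \<open>auto simp: subset_iff\<close>)
  from iterated_integrable_cong[OF this cong.IH[OF cong.prems]] show ?case .
qed

text \<open>For a generator the integral is a number times f, so that tameness and the exchange with
  \<Lambda> reduce to linearity of \<Lambda>. Sums use that both iterated integrals exist.\<close>

lemma simplex_family_integral:
  assumes "simplex_family {t..T} h F" "\<tau> \<in> {t..T}"
  shows "tame (\<lambda>x. simplex_integral h \<tau> T (\<lambda>ss. F ss x)) \<and>
    (\<forall>\<Lambda>. tame_linear \<Lambda> \<longrightarrow> \<Lambda> (\<lambda>x. simplex_integral h \<tau> T (\<lambda>ss. F ss x)) = (\<lambda>x. simplex_integral h \<tau> T (\<lambda>ss. \<Lambda> (F ss) x)))"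
  using assms
proof (induction rule: simplex_family.induct)
  case (basic cs f)
  have eq: "simplex_integral h \<tau> T (\<lambda>ss. product_fun cs ss * g) = simplex_integral h \<tau> T (product_fun cs) * g" for g
    using simplex_integral_cmult[of h \<tau> T g "product_fun cs"] by (simp add: mult.commute)
  then show ?case using basic by (simp add: tame_cmult tame_linear_def)
next
  case (add F F')
  note int = simplex_family_iterated_integrable[OF add.hyps(1) add.prems] simplex_family_iterated_integrable[OF add.hyps(2) add.prems]
  have eq: "(\<lambda>x. simplex_integral h \<tau> T (\<lambda>ss. F ss x + F' ss x)) = 
      (\<lambda>x. simplex_integral h \<tau> T (\<lambda>ss. F ss x) + simplex_integral h \<tau> T (\<lambda>ss. F' ss x))"
    using simplex_integral_add int by blast
  have "\<Lambda> (\<lambda>x. simplex_integral h \<tau> T (\<lambda>ss. F ss x + F' ss x)) = (\<lambda>x. simplex_integral h \<tau> T (\<lambda>ss. \<Lambda> (\<lambda>x. F ss x + F' ss x) x))"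
    if \<Lambda>: "tame_linear \<Lambda>" for \<Lambda>
  proof
    fix x
    note int' = simplex_family_iterated_integrable[OF simplex_family_map[OF add.hyps(1) \<Lambda>] add.prems]
      simplex_family_iterated_integrable[OF simplex_family_map[OF add.hyps(2) \<Lambda>] add.prems]
    have "\<Lambda> (\<lambda>x. simplex_integral h \<tau> T (\<lambda>ss. F ss x + F' ss x)) x =
        simplex_integral h \<tau> T (\<lambda>ss. \<Lambda> (F ss) x) + simplex_integral h \<tau> T (\<lambda>ss. \<Lambda> (F' ss) x)"
      unfolding eq using add.IH add.prems \<Lambda> by (simp add: tame_linear_def)
    also have "\<dots> = simplex_integral h \<tau> T (\<lambda>ss. \<Lambda> (F ss) x + \<Lambda> (F' ss) x)"
      using simplex_integral_add[OF int'] by simp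
    also have "\<dots> = simplex_integral h \<tau> T (\<lambda>ss. \<Lambda> (\<lambda>x. F ss x + F' ss x) x)"
    proof (rule simplex_integral_cong)
      fix ss assume ss: "length ss = h" "set ss \<subseteq> {\<tau>..T}"
      then have "tame (F ss)" "tame (F' ss)"
        using add.prems by (auto intro!: simplex_family_tame[OF add.hyps(1)] simplex_family_tame[OF add.hyps(2)] simp: subset_iff)
      then show "\<Lambda> (F ss) x + \<Lambda> (F' ss) x = \<Lambda> (\<lambda>x. F ss x + F' ss x) x"
        using \<Lambda> by (simp add: tame_linear_def)
    qed
    finally show "\<Lambda> (\<lambda>x. simplex_integral h \<tau> T (\<lambda>ss. F ss x + F' ss x)) x = simplex_integral h \<tau> T (\<lambda>ss. \<Lambda> (\<lambda>x. F ss x + F' ss x) x)" .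
  qed
  moreover have "tame (\<lambda>x. simplex_integral h \<tau> T (\<lambda>ss. F ss x + F' ss x))"
    unfolding eq using add.IH add.prems by (intro tame_add) auto
  ultimately show ?case by blast
next
  case (cong F F')
  have F: "F ss = F' ss" if "length ss = h" "set ss \<subseteq> {\<tau>..T}" for ss
    by (rule cong.hyps) (use that cong.prems in \<open>auto simp: subset_iff\<close>)
  have "simplex_integral h \<tau> T (\<lambda>ss. F ss x) = simplex_integral h \<tau> T (\<lambda>ss. F' ss x)"
    "simplex_integral h \<tau> T (\<lambda>ss. \<Lambda> (F ss) x) = simplex_integral h \<tau> T (\<lambda>ss. \<Lambda> (F' ss) x)" for x \<Lambda>
    by (rule simplex_integral_cong, simp add: F)+
  then show ?case using cong.IH[OF cong.prems] by simp
qed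

section \<open>Compositions of an integer\<close>

lemma finite_I_set: "finite (I_set n h)"
proof (rule finite_subset)
  show "I_set n h \<subseteq> {xs. set xs \<subseteq> {..n} \<and> length xs = h}"
    using member_le_sum_list by (fastforce simp: I_set_def)
qed (simp add: finite_lists_length_eq)

lemma I_set_0: "I_set n 0 = (if n = 0 then {[]} else {})"
  by (auto simp: I_set_def)

lemma I_set_empty: "n < h \<Longrightarrow> I_set n h = {}"
proof -
  have "length xs \<le> sum_list xs" if "\<forall>k\<in>set xs. 1 \<le> k" for xs :: "nat list"
    using that by (induction xs) auto
  then show "n < h \<Longrightarrow> I_set n h = {}" by (fastforce simp: I_set_def)
qed

text \<open>The first part k of a composition is split off, in parallel with the recursion for u_n,
  where the increment of order k meets u_(n-k).\<close>

lemma sum_I_set_Suc: "(\<Sum>is\<in>I_set n (Suc h). f is) = (\<Sum>k=1..n. \<Sum>is\<in>I_set (n - k) h. f (k # is))"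
proof -
  have "(\<Sum>k=1..n. \<Sum>is\<in>I_set (n - k) h. f (k # is)) = (\<Sum>(k, is)\<in>Sigma {1..n} (\<lambda>k. I_set (n - k) h). f (k # is))"
    by (rule sum.Sigma) (auto simp: finite_I_set)
  also have "\<dots> = (\<Sum>is\<in>I_set n (Suc h). f is)"
    by (rule sum.reindex_bij_witness[where i="\<lambda>is. (hd is, tl is)" and j="\<lambda>(k, is). k # is"])
      (auto simp: I_set_def length_Suc_conv)
  finally show ?thesis by simp
qed

section \<open>The expansion\<close>

lemma set_integral_sum_lborel:
  assumes "\<And>i. i \<in> I \<Longrightarrow> set_integrable lborel A (f i)"
  shows "(LINT s:A|lborel. \<Sum>i\<in>I. f i s) = (\<Sum>i\<in>I. LINT s:A|lborel. (f i s :: real))"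
  using assms unfolding set_lebesgue_integral_def set_integrable_def scaleR_sum_right
  by (rule Bochner_Integration.integral_sum)

text \<open>Both endpoints have to be excluded: at s = t the kernel degenerates, and at s = T the
  function u_0 is the datum, which need not be differentiable.\<close>

lemma set_integral_cong_interior:
  fixes f g :: "real \<Rightarrow> real"
  assumes "\<And>s. t < s \<Longrightarrow> s < T \<Longrightarrow> f s = g s"
  shows "(LINT s:{t..T}|lborel. f s) = (LINT s:{t..T}|lborel. g s)"
  unfolding set_lebesgue_integral_def
proof (rule integral_discrete_difference[of "{t, T}"])
  fix s assume "s \<notin> {t, T}"
  then have "t < s \<and> s < T" if "s \<in> {t..T}"
    using that by (auto simp: le_less)
  then show "indicator {t..T} s *\<^sub>R f s = indicator {t..T} s *\<^sub>R g s"
    using assms[of s] by (cases "s \<in> {t..T}") simp_all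
qed auto

context expansion_operators
begin

definition word_op :: "nat list \<Rightarrow> real list \<Rightarrow> real \<Rightarrow> ('d rvec \<Rightarrow> real) \<Rightarrow> 'd rvec \<Rightarrow> real" where
  "word_op is ss t = foldr (\<lambda>(k, s). G k (s - t) s) (zip is ss)"

text \<open>The lower limit \<tau> and the base time t are separate because P(s - t) moves the base
  time from s to t while the integrals keep their lower limit s. The bound N on the number of
  factors is the same for all n, and terms with h > n vanish; the term h = 0 covers n = 0.\<close>

definition L_sum :: "nat \<Rightarrow> nat \<Rightarrow> real \<Rightarrow> real \<Rightarrow> real \<Rightarrow> ('d rvec \<Rightarrow> real) \<Rightarrow> 'd rvec \<Rightarrow> real" where
  "L_sum N n T \<tau> t f x = (\<Sum>h\<le>N. simplex_integral h \<tau> T (\<lambda>ss. \<Sum>is\<in>I_set n h. word_op is ss t f x))"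

lemma word_op_Cons: "word_op (k # is) (s # ss) t f = G k (s - t) s (word_op is ss t f)"
  by (simp add: word_op_def)

lemma tame_linear_P: "0 < \<tau> \<Longrightarrow> tame_linear (P \<tau>)"
  by (simp add: tame_linear_def P_add P_cmult P_tame tame_measurable tame_subexponential)

lemma tame_linear_G: "t \<le> s \<Longrightarrow> tame_linear (G n (s - t) s)"
  using op_family_tame_linear[OF op_family_G[of t s n], of s] by simp

lemma simplex_family_word_op:
  assumes "t \<le> T" "tame f"
  shows "simplex_family {t..T} (length is) (\<lambda>ss. word_op is ss t f)"
proof (induction "is")
  case Nil
  then show ?case using assms by (simp add: word_op_def simplex_family_const)
next
  case (Cons k "is")
  from simplex_family_Cons[OF op_family_G[OF assms(1)] Cons, of k]
  show ?case unfolding length_Cons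
  proof (rule simplex_family.cong)
    fix ss :: "real list" assume "length ss = Suc (length is)"
    then show "G k (hd ss - t) (hd ss) (word_op is (tl ss) t f) = word_op (k # is) ss t f"
      by (cases ss) (auto simp: word_op_Cons)
  qed
qed

lemma simplex_family_sum_word_op:
  assumes "t \<le> T" "tame f"
  shows "simplex_family {t..T} h (\<lambda>ss x. \<Sum>is\<in>I_set n h. word_op is ss t f x)"
  by (rule simplex_family_sum) (use simplex_family_word_op[OF assms] in \<open>auto simp: I_set_def\<close>)

lemma word_op_tame:
  assumes "tame f" "t \<le> T" "length ss = length is" "set ss \<subseteq> {t..T}"
  shows "tame (word_op is ss t f)"
  using simplex_family_tame[OF simplex_family_word_op[OF assms(2,1)] assms(3,4)] .

text \<open>Each factor passes through P by \<open>P_G\<close>, its lag growing from s' - s to s' -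
  t. All times of the word lie after s, so the old lags are nonnegative.\<close>

lemma P_word_op:
  assumes f: "tame f" and s: "t < s" "s \<le> T" and ss: "length ss = length is" "set ss \<subseteq> {s..T}"
  shows "P (s - t) (word_op is ss s f) = word_op is ss t (P (s - t) f)"
  using ss
proof (induction "is" arbitrary: ss)
  case Nil
  then show ?case by (simp add: word_op_def)
next
  case (Cons k "is")
  then obtain s' ss' where ss: "ss = s' # ss'" by (cases ss) auto
  have "tame (word_op is ss' s f)"
    by (rule word_op_tame[of _ _ T]) (use f s Cons.prems ss in auto)
  then show ?case
    using Cons.IH[of ss'] Cons.prems s by (simp add: ss word_op_Cons P_G)
qed

lemma L_sum_tame:
  assumes "tame f" "t \<le> \<tau>" "\<tau> \<le> T"
  shows "tame (L_sum N n T \<tau> t f)"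
  unfolding L_sum_def[abs_def] using simplex_family_integral[OF simplex_family_sum_word_op] assms
  by (intro tame_sum) auto

lemma L_sum_map:
  assumes \<Lambda>: "tame_linear \<Lambda>" and "tame f" "t \<le> \<tau>" "\<tau> \<le> T"
  shows "\<Lambda> (L_sum N n T \<tau> t f) x = (\<Sum>h\<le>N. simplex_integral h \<tau> T (\<lambda>ss. \<Sum>is\<in>I_set n h. \<Lambda> (word_op is ss t f) x))"
proof -
  have sum: "\<Lambda> (\<lambda>x. \<Sum>i\<in>J. g i x) = (\<lambda>x. \<Sum>i\<in>J. \<Lambda> (g i) x)" if "finite J" "\<And>i. i \<in> J \<Longrightarrow> tame (g i)" for J :: "'i set" and g
    using that
  proof (induction J rule: finite_induct)
    case empty
    have "\<Lambda> (\<lambda>x. 0 * 0) = (\<lambda>x. 0 * \<Lambda> (\<lambda>x. 0) x)"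
      using \<Lambda> tame_const[of 0] unfolding tame_linear_def by blast
    then show ?case by simp
  next
    case (insert i J)
    then show ?case using \<Lambda> by (simp add: tame_linear_def tame_sum)
  qed
  have \<tau>: "\<tau> \<in> {t..T}" and tT: "t \<le> T" using assms by auto
  note fam = simplex_family_integral[OF simplex_family_sum_word_op[OF tT \<open>tame f\<close>] \<tau>]
  have "\<Lambda> (L_sum N n T \<tau> t f) x = (\<Sum>h\<le>N. \<Lambda> (\<lambda>x. simplex_integral h \<tau> T (\<lambda>ss. \<Sum>is\<in>I_set n h. word_op is ss t f x)) x)"
    unfolding L_sum_def[abs_def] using fam by (subst sum) auto
  also have "\<dots> = (\<Sum>h\<le>N. simplex_integral h \<tau> T (\<lambda>ss. \<Lambda> (\<lambda>x. \<Sum>is\<in>I_set n h. word_op is ss t f x) x))"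
    using fam \<Lambda> by simp
  also have "\<dots> = (\<Sum>h\<le>N. simplex_integral h \<tau> T (\<lambda>ss. \<Sum>is\<in>I_set n h. \<Lambda> (word_op is ss t f) x))"
  proof (rule sum.cong[OF refl], rule simplex_integral_cong)
    fix h ss assume ss: "length ss = h" "set ss \<subseteq> {\<tau>..T}"
    have "tame (word_op is ss t f)" if "is \<in> I_set n h" for "is"
      by (rule word_op_tame[of _ _ T]) (use that ss assms in \<open>auto simp: I_set_def subset_iff\<close>)
    then show "\<Lambda> (\<lambda>x. \<Sum>is\<in>I_set n h. word_op is ss t f x) x = (\<Sum>is\<in>I_set n h. \<Lambda> (word_op is ss t f) x)"
      by (subst sum) (auto simp: finite_I_set)
  qed
  finally show ?thesis .
qed

text \<open>Strong induction, since the recursion for u_n involves all earlier terms.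
  \<open>g\<close> stands for u_0 and \<open>V\<close> for the spatial integral in the recursion, of
  which only the values for t < s < T are prescribed.\<close>

lemma expansion:
  assumes g: "\<And>t. t < T \<Longrightarrow> tame (g t)" "\<And>s t. t < s \<Longrightarrow> s < T \<Longrightarrow> P (s - t) (g s) = g t"
    and u_0: "\<And>t. t < T \<Longrightarrow> u 0 t = g t"
    and u_Suc: "\<And>n t x. t < T \<Longrightarrow> u (Suc n) t x = (\<Sum>k=1..Suc n. LINT s:{t..T}|lborel. V k n t s x)"
    and V: "\<And>k n s t x. 1 \<le> k \<Longrightarrow> t < s \<Longrightarrow> s < T \<Longrightarrow> V k n t s x = P (s - t) (G k 0 s (u (Suc n - k) s)) x"
    and "n \<le> N" "t < T"
  shows "u n t x = L_sum N n T t t (g t) x"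
  using assms(6,7)
proof (induction n arbitrary: t x rule: less_induct)
  case (less n)
  show ?case
  proof (cases n)
    case 0
    have "L_sum N 0 T t t (g t) x = (\<Sum>h\<le>N. if h = 0 then g t x else 0)"
      unfolding L_sum_def
    proof (rule sum.cong[OF refl])
      fix h show "simplex_integral h t T (\<lambda>ss. \<Sum>is\<in>I_set 0 h. word_op is ss t (g t) x) = (if h = 0 then g t x else 0)"
        by (cases "h = 0") (auto simp: I_set_0 I_set_empty simplex_integral_zero word_op_def)
    qed
    then show ?thesis using less.prems by (simp add: 0 u_0)
  next
    case (Suc m)
    note t = less.prems(2)
    \<comment> \<open>The contribution of the words that start with k and have h further
      factors.\<close>
    define H where "H k h ss = (\<Sum>is\<in>I_set (n - k) h. word_op (k # is) ss t (g t) x)" for k h ss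
    have H: "iterated_integrable (Suc h) t T (H k h)" for k h
      unfolding H_def[abs_def]
    proof (rule conjunct1[OF simplex_integral_sum])
      fix "is" assume "is \<in> I_set (n - k) h"
      then have "length (k # is) = Suc h" by (simp add: I_set_def)
      then show "iterated_integrable (Suc h) t T (\<lambda>ss. word_op (k # is) ss t (g t) x)"
        using simplex_family_iterated_integrable[OF simplex_family_word_op[of t T "g t" "k # is"]] t g(1) by auto
    qed
    \<comment> \<open>By the induction hypothesis u_(n-k)(s) is an expansion with base time s. P
      changes its base time to t, the new factor of order k acquires the lag s - t, and the lower
      limit s remains.\<close>
    have V_eq: "V k m t s x = (\<Sum>h\<le>N. simplex_integral h s T (\<lambda>ss. H k h (s # ss)))"
      if s: "t < s" "s < T" and k: "k \<in> {1..n}" for s k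
    proof -
      have u: "u (n - k) s = L_sum N (n - k) T s s (g s)"
        using less.IH[of "n - k" s] k s less.prems by (auto simp: fun_eq_iff)
      have tame: "tame (L_sum N (n - k) T s s (g s))"
        by (rule L_sum_tame) (use s g in auto)
      have "P (s - t) (L_sum N (n - k) T s s (g s)) y = L_sum N (n - k) T s t (g t) y" for y
      proof -
        have "P (s - t) (L_sum N (n - k) T s s (g s)) y = 
          (\<Sum>h\<le>N. simplex_integral h s T (\<lambda>ss. \<Sum>is\<in>I_set (n - k) h. P (s - t) (word_op is ss s (g s)) y))"
          by (rule L_sum_map[OF tame_linear_P]) (use s g in auto)
        also have "\<dots> = L_sum N (n - k) T s t (g t) y"
          unfolding L_sum_def
        proof (intro sum.cong[OF refl] simplex_integral_cong)
          fix h ss "is" assume "length ss = h" "set ss \<subseteq> {s..T}" "is \<in> I_set (n - k) h"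
          then show "P (s - t) (word_op is ss s (g s)) y = word_op is ss t (g t) y"
            by (subst P_word_op[of _ _ _ T]) (use s g in \<open>auto simp: I_set_def\<close>)
        qed
        finally show ?thesis .
      qed
      then have PL: "P (s - t) (L_sum N (n - k) T s s (g s)) = L_sum N (n - k) T s t (g t)" by blast
      have "V k m t s x = P (s - t) (G k 0 s (L_sum N (n - k) T s s (g s))) x"
        using V[OF _ s] u Suc k by simp
      also have "\<dots> = G k (s - t) s (L_sum N (n - k) T s t (g t)) x"
        using P_G[of "s - t" 0, OF _ _ tame] s by (simp add: PL)
      also have "\<dots> = (\<Sum>h\<le>N. simplex_integral h s T (\<lambda>ss. \<Sum>is\<in>I_set (n - k) h. G k (s - t) s (word_op is ss t (g t)) x))"
        by (rule L_sum_map[OF tame_linear_G]) (use s g in auto)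
      finally show ?thesis by (simp add: H_def word_op_Cons)
    qed
    have "u n t x = (\<Sum>k=1..n. LINT s:{t..T}|lborel. V k m t s x)"
      using u_Suc[OF t] Suc by simp
    also have "\<dots> = (\<Sum>k=1..n. LINT s:{t..T}|lborel. \<Sum>h\<le>N. simplex_integral h s T (\<lambda>ss. H k h (s # ss)))"
      by (intro sum.cong[OF refl] set_integral_cong_interior V_eq) auto
    also have "\<dots> = (\<Sum>k=1..n. \<Sum>h\<le>N. simplex_integral (Suc h) t T (H k h))"
      using H by (simp add: set_integral_sum_lborel)
    also have "\<dots> = (\<Sum>h\<le>N. \<Sum>k=1..n. simplex_integral (Suc h) t T (H k h))"
      by (rule sum.swap)
    also have "\<dots> = (\<Sum>h\<le>N. simplex_integral (Suc h) t T (\<lambda>ss. \<Sum>k=1..n. H k h ss))"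
      by (intro sum.cong refl conjunct2[OF simplex_integral_sum, symmetric] H)
    also have "\<dots> = (\<Sum>h\<le>N. simplex_integral (Suc h) t T (\<lambda>ss. \<Sum>is\<in>I_set n (Suc h). word_op is ss t (g t) x))"
      by (simp only: sum_I_set_Suc H_def)
    also have "\<dots> = (\<Sum>h\<in>Suc ` {..N}. simplex_integral h t T (\<lambda>ss. \<Sum>is\<in>I_set n h. word_op is ss t (g t) x))"
      by (subst sum.reindex) auto
    \<comment> \<open>The ranges 1..N+1 and 0..N differ in two values of h, and there
      \<open>I_set n h\<close> is empty because 0 < n \<le> N.\<close>
    also have "\<dots> = L_sum N n T t t (g t) x"
      unfolding L_sum_def
    proof (rule sum.mono_neutral_cong)
      fix h assume "h \<in> {..N} - Suc ` {..N}"
      then have "h = 0" by (cases h) auto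
      then show "simplex_integral h t T (\<lambda>ss. \<Sum>is\<in>I_set n h. word_op is ss t (g t) x) = 0"
        by (simp add: I_set_0 Suc)
    next
      fix h assume "h \<in> Suc ` {..N} - {..N}"
      then have "n < h" using less.prems by auto
      then show "simplex_integral h t T (\<lambda>ss. \<Sum>is\<in>I_set n h. word_op is ss t (g t) x) = 0"
        by (simp add: I_set_empty simplex_integral_zero)
    qed auto
    finally show ?thesis .
  qed
qed

end

section \<open>Taylor polynomials of the coefficients\<close>

text \<open>The derivatives at \<zeta> are constants, and time enters through powers of s - fst
  \<zeta> and the moving centre exp((s - fst \<zeta>)B) applied to snd \<zeta>, which is continuous
  in s.\<close>

lemma taylor_time_poly:
  assumes "\<And>S. continuous_on S (\<lambda>t. matexp (t *\<^sub>R B))"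
  shows "time_poly (\<lambda>s y. taylor p B n f \<zeta> (s, y))"
proof -
  have c: "continuous_on UNIV (\<lambda>s. (matexp ((s - fst \<zeta>) *\<^sub>R B) *v snd \<zeta>) $ i)" for i
    unfolding matrix_vector_mult_def
    by (auto intro!: continuous_intros continuous_on_compose2[OF assms[of UNIV]])
  have *: "time_poly (\<lambda>s y. w * (s - fst \<zeta>) ^ k * (\<Prod>i\<in>UNIV. (y $ i - (matexp ((s - fst \<zeta>) *\<^sub>R B) *v snd \<zeta>) $ i) ^ \<beta> i))"
    for w k and \<beta> :: "'a \<Rightarrow> nat"
    by (intro time_poly_mult time_poly_prod time_poly_power time_poly_diff time_poly_coord)
      (auto intro!: time_poly_coeff continuous_intros c)
  show ?thesis
    unfolding taylor_def split_beta
    by (rule time_poly_sum, simp only: fst_conv snd_conv vector_minus_component, rule *)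
qed

text \<open>The field Y occurs in both operators and cancels. What is left differentiates in x alone
  and sees only the slice of v at time s; \<open>1 \<le> k\<close> makes subtraction in the natural
  numbers agree with that in the integers.\<close>

lemma K_op_diff:
  assumes "1 \<le> k"
  shows "K_op p B a b zb k v (s, \<xi>) - K_op p B a b zb (k - 1) v (s, \<xi>) =
    1/2 * (\<Sum>i\<in>first_block p. \<Sum>j\<in>first_block p.
      (taylor p B (int k) (a i j) zb (s, \<xi>) - taylor p B (int k - 1) (a i j) zb (s, \<xi>)) *
      partial i (partial j (\<lambda>y. v (s, y))) \<xi>) +
    (\<Sum>i\<in>first_block p. (taylor p B (int k - 1) (b i) zb (s, \<xi>) - taylor p B (int k - 2) (b i) zb (s, \<xi>)) *
      partial i (\<lambda>y. v (s, y)) \<xi>)"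
proof -
  have dx: "dx i v (s, y) = partial i (\<lambda>y. v (s, y)) y" for i v and y :: "'a rvec"
    by (simp add: lie_def partial_def flow_dx_def)
  have k: "int (k - 1) = int k - 1" using assms by simp
  show ?thesis
    unfolding K_op_def k
    by (simp add: dx left_diff_distrib sum_subtractf)
qed

theorem theoremA2:
  fixes N r :: nat and T M \<mu> :: real
    and p :: "nat \<Rightarrow> nat"
    and B :: "'d::{finite,linorder} rmat"
    and a :: "'d \<Rightarrow> 'd \<Rightarrow> 'd point \<Rightarrow> real"
    and b :: "'d \<Rightarrow> 'd point \<Rightarrow> real"
    and \<phi> :: "'d rvec \<Rightarrow> real"
  assumes "0 < T" and "0 < M" and "0 < \<mu>"
    and "continuous_on UNIV \<phi>" and "subexponential \<phi>"
    and "\<And>i j z. i \<in> first_block p \<Longrightarrow> j \<in> first_block p \<Longrightarrow> a i j z = a j i z"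
    and "\<And>z (\<xi> :: 'd rvec). \<lbrakk>\<forall>i. i \<notin> first_block p \<longrightarrow> \<xi> $ i = 0; \<xi> \<noteq> 0\<rbrakk> \<Longrightarrow>
           \<mu> * M * (norm \<xi>)\<^sup>2 < (\<Sum>i\<in>first_block p. \<Sum>j\<in>first_block p. a i j z * \<xi> $ i * \<xi> $ j) \<and>
           (\<Sum>i\<in>first_block p. \<Sum>j\<in>first_block p. a i j z * \<xi> $ i * \<xi> $ j) < M * (norm \<xi>)\<^sup>2"
    and "block_form r p B"
    and "\<And>i j. i \<in> first_block p \<Longrightarrow> j \<in> first_block p \<Longrightarrow>
           in_CB p B N 1 (a i j) \<and> CB_norm p B N 1 (a i j) \<le> ennreal M"
    and "\<And>i. i \<in> first_block p \<Longrightarrow>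
           in_CB p B N 1 (b i) \<and> CB_norm p B N 1 (b i) \<le> ennreal M"
  shows "\<forall>n zb t x. 1 \<le> n \<and> n \<le> N \<and> 0 \<le> t \<and> t < T \<longrightarrow>
           u_exp p B a b zb T \<phi> n (t, x) =
             L_op p B a b zb n t T (\<lambda>y. u_exp p B a b zb T \<phi> 0 (t, y)) x"
proof (intro allI impI, elim conjE)
  fix n zb t x
  assume n: "1 \<le> n" "n \<le> N" and t: "0 \<le> t" "t < T"
  let ?I = "first_block p" and ?A = "A_mat p a zb"
  have form: "(?A *v \<eta>) \<bullet> \<eta> = (\<Sum>i\<in>?I. \<Sum>j\<in>?I. a i j zb * \<eta> $ i * \<eta> $ j)" for \<eta>
  proof -
    have "(?A *v \<eta>) \<bullet> \<eta> = (\<Sum>i\<in>UNIV. if i \<in> ?I then (\<Sum>j\<in>UNIV. if j \<in> ?I then a i j zb * \<eta> $ i * \<eta> $ j else 0) else 0)"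
      unfolding inner_vec_def matrix_vector_mult_def A_mat_def
      by (auto simp: sum_distrib_right intro!: sum.cong)
    then show ?thesis by (simp add: sum.If_cases)
  qed
  have coercive: "0 \<le> (?A *v \<eta>) \<bullet> \<eta> \<and> ((?A *v \<eta>) \<bullet> \<eta> = 0 \<longrightarrow> (\<forall>i\<in>?I. \<eta> $ i = 0))" for \<eta>
  proof -
    \<comment> \<open>Ellipticity is assumed for vectors supported on the first block, so \<eta> is
      truncated to it; the form does not see the other components.\<close>
    define \<xi> :: "'d rvec" where "\<xi> = (\<chi> i. if i \<in> ?I then \<eta> $ i else 0)"
    have eq: "(?A *v \<eta>) \<bullet> \<eta> = (\<Sum>i\<in>?I. \<Sum>j\<in>?I. a i j zb * \<xi> $ i * \<xi> $ j)"
      unfolding form by (simp add: \<xi>_def)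
    show ?thesis
    proof (cases "\<xi> = 0")
      case True
      have "\<eta> $ i = \<xi> $ i" if "i \<in> ?I" for i using that by (simp add: \<xi>_def)
      then have "\<forall>i\<in>?I. \<eta> $ i = 0" by (simp add: True)
      then show ?thesis unfolding eq by (simp add: True)
    next
      case False
      then have "\<mu> * M * (norm \<xi>)\<^sup>2 < (?A *v \<eta>) \<bullet> \<eta>"
        unfolding eq using assms(7)[of \<xi> zb] by (simp add: \<xi>_def)
      moreover have "0 \<le> \<mu> * M * (norm \<xi>)\<^sup>2" using assms(2,3) by simp
      ultimately show ?thesis by linarith
    qed
  qed
  interpret D: degenerate_diffusion r p B ?A
  proof
    show "transpose ?A = ?A"
      using assms(6) by (auto simp: transpose_def A_mat_def vec_eq_iff)
  qed (use assms(8) coercive in auto)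
  have C: "C_mat p B a zb \<tau> = D.C \<tau>" for \<tau>
    unfolding C_mat_def D.C_eq D.F_def D.matexp_transpose D.E_def ..
  \<comment> \<open>The increments of the Taylor polynomials; the drift is one order behind the
    diffusion coefficients because a first derivative has degree one less.\<close>
  define qa where "qa m i j s y = taylor p B (int m) (a i j) zb (s, y) - taylor p B (int m - 1) (a i j) zb (s, y)"
    for m i j s y
  define qb where "qb m i s y = taylor p B (int m - 1) (b i) zb (s, y) - taylor p B (int m - 2) (b i) zb (s, y)"
    for m i s y
  interpret X: expansion_operators D.E D.C ?I qa qb
  proof
    show "pos_def (D.C \<tau>)" if "0 < \<tau>" for \<tau>
      using D.C_sym D.C_pos[OF that] by (simp add: pos_def_def)
    show "time_poly (qa m i j)" "time_poly (qb m i)" for m i j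
      unfolding qa_def[abs_def] qb_def[abs_def] 
      by (intro time_poly_diff taylor_time_poly D.continuous_on_matexp)+
  qed (simp_all add: D.E_0 D.E_add D.C_add D.C_0 D.continuous_on_E D.continuous_on_C)
  have M: "M_op p B a zb \<tau> = X.Mo \<tau>" for \<tau>
    unfolding fun_eq_iff M_op_def X.Mo_def M_mat_def C D.matexp_transpose D.E_def by simp
  have Gr: "grad_op B \<tau> = X.Gr \<tau>" for \<tau>
    unfolding fun_eq_iff grad_op_def X.Gr_def D.matexp_transpose D.E_def by simp
  have G: "G_op p B a b zb k t s = X.G k (s - t) s" for k t s
    unfolding fun_eq_iff G_op_def X.G_def M Gr qa_def[symmetric] qb_def[symmetric] by simp
  have \<Gamma>: "(LINT y|lborel. Gamma0 p B a zb (t, x) (s, y) * f y) = X.P (s - t) f x" if "t < s" for t s x f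
  proof -
    have "0 < s - t" using that by simp
    note eq = gaussian_kernel.J_def[OF X.kernel[OF this]] X.heat_eq[OF this]
    show ?thesis
      unfolding X.P_def eq unfolding Gamma0_def split C X.\<kappa>_def D.E_def[symmetric] by simp
  qed
  let ?u = "\<lambda>n t y. u_exp p B a b zb T \<phi> n (t, y)"
  let ?g = "\<lambda>t. X.P (T - t) \<phi>"
  have \<phi>: "\<phi> \<in> borel_measurable borel" "subexponential \<phi>"
    using assms(4,5) by (auto intro: borel_measurable_continuous_onI)
  have u_0: "?u 0 t = ?g t" if "t < T" for t
    using that \<Gamma>[OF that] by (simp add: fun_eq_iff)
  have "?u n t x = X.L_sum N n T t t (?g t) x"
  \<comment> \<open>\<open>V\<close> is instantiated with the inner integral over \<xi> from the
    recursion of \<open>u_exp\<close>. It is a value of P as soon as t < s.\<close>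
  proof (rule X.expansion[of T ?g ?u "\<lambda>k n t s x. LINT \<xi>|lborel. Gamma0 p B a zb (t, x) (s, \<xi>) *
        (K_op p B a b zb k (u_exp p B a b zb T \<phi> (Suc n - k)) (s, \<xi>)
         - K_op p B a b zb (k - 1) (u_exp p B a b zb T \<phi> (Suc n - k)) (s, \<xi>))"])
    show "tame (?g t)" if "t < T" for t
      using that \<phi> by (intro X.P_tame) auto
    show "X.P (s - t) (?g s) = ?g t" if "t < s" "s < T" for s t
      using that X.P_P[OF _ _ \<phi>, of "s - t" "T - s"] by simp
    show "?u 0 t = ?g t" if "t < T" for t by (rule u_0[OF that])
    fix k m :: nat and s t :: real and x :: "'d rvec" assume k: "1 \<le> k" and s: "t < s" "s < T"
    have "K_op p B a b zb k (u_exp p B a b zb T \<phi> (Suc m - k)) (s, \<xi>)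
         - K_op p B a b zb (k - 1) (u_exp p B a b zb T \<phi> (Suc m - k)) (s, \<xi>) = X.G k 0 s (?u (Suc m - k) s) \<xi>" for \<xi>
      unfolding K_op_diff[OF k] X.G_0 qa_def qb_def ..
    then show "(LINT \<xi>|lborel. Gamma0 p B a zb (t, x) (s, \<xi>) *
        (K_op p B a b zb k (u_exp p B a b zb T \<phi> (Suc m - k)) (s, \<xi>)
         - K_op p B a b zb (k - 1) (u_exp p B a b zb T \<phi> (Suc m - k)) (s, \<xi>))) =
       X.P (s - t) (X.G k 0 s (?u (Suc m - k) s)) x"
      by (simp only: \<Gamma>[OF s(1)])
  qed (use n t in \<open>simp_all del: sum.cl_ivl_Suc\<close>)
  also have "\<dots> = (\<Sum>h=1..n. simplex_integral h t T (\<lambda>ss. \<Sum>is\<in>I_set n h. X.word_op is ss t (?g t) x))"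
    unfolding X.L_sum_def
  proof (rule sum.mono_neutral_right)
    show "\<forall>h\<in>{..N} - {1..n}. simplex_integral h t T (\<lambda>ss. \<Sum>is\<in>I_set n h. X.word_op is ss t (?g t) x) = 0"
    proof
      fix h assume "h \<in> {..N} - {1..n}"
      then have "h = 0 \<or> n < h" by auto
      then have "I_set n h = {}" using n I_set_0 I_set_empty by auto
      then show "simplex_integral h t T (\<lambda>ss. \<Sum>is\<in>I_set n h. X.word_op is ss t (?g t) x) = 0"
        by (simp add: simplex_integral_zero)
    qed
  qed (use n in auto)
  also have "\<dots> = L_op p B a b zb n t T (?u 0 t) x"
    unfolding L_op_def G X.word_op_def u_0[OF t(2)] ..
  finally show "?u n t x = L_op p B a b zb n t T (?u 0 t) x" .
qed

end
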